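(* The category of points of the epicyclic topos $\widehat{\tilde\Lambda^{\rm op}}$ (the topos of contravariant functors from $\tilde\Lambda^{\rm op}$ to sets) is equivalent to the category $\mathcal P$ whose objects are pairs $(K,E)$, where $K$ is an algebraic extension of $\mathbb F=\mathbb Z_{\max}$ and $E$ is an archimedean semimodule over $K$, and whose morphisms are projective classes of semilinear maps together with injective semifield morphisms.
   Context: Epicyclic category. For $n\ge 0$ let $\underline n$ denote $\mathbb Z$ with its usual order and the automorphism $x\mapsto x+n+1$. The epicyclic category $\tilde\Lambda$ has the objects $\underline n$, $n\ge 0$; $\mathrm{Hom}_{\tilde\Lambda}(\underline n,\underline m)$ is the set of equivalence classes of non-decreasing maps $f:\mathbb Z\to\mathbb Z$ for which there is an integer $k>0$ with $f(x+n+1)=f(x)+k(m+1)$ for all $x$, where $f\sim g$ iff there is $a\in\mathbb Z$ with $g(x)=f(x)+a(m+1)$ for all $x$. Composition is composition of maps. Topos and points. For a small category $\mathcal C$, $\hat{\mathcal C}$ is the topos of contravariant functors $\mathcal C\to\mathrm{Sets}$. Its category of points is equivalent to the category of flat covariant functors $\mathcal C\to \mathrm{Sets}$ and natural transformations. (Thus the points of $\widehat{\tilde\Lambda^{\rm op}}$ are the flat functors $\tilde\Lambda^{\rm op}\to\mathrm{Sets}$.) The category $\mathcal P$. $\mathbb Z_{\max}=(\mathbb Z\cup\{-\infty\},\max,+)$ is the semifield of tropical integers. An algebraic extension $K$ of $\mathbb Z_{\max}$ is equivalently given by a totally ordered abelian group $(H,H_+)$ isomorphic to a subgroup of $\mathbb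 Q$ containing $\mathbb Z$ with the induced order, via $K=H_{\max}:=(H\cup\{-\infty\},\max,+)$; injective semifield morphisms $K\to K'$ correspond to injective morphisms of ordered groups $\sigma:H\to H'$. An archimedean semimodule $E$ over $K=H_{\max}$ is equivalently given by a non-empty totally ordered set $X$ (with $E=X\cup\{-\infty\}$, addition being $\max$) on which $H$ acts by order automorphisms $x\mapsto h+x$ such that $h+x>x$ for all $h\in H_+$, $h\neq 0$, $x\in X$, and such that for all $x,y\in X$ there exists $h\in H_+$ with $h+x>y$. A morphism $(K,E)\to(K',E')$ in $\mathcal P$ is given by an injective semifield morphism $\sigma:K\to K'$ and a projective class of $\sigma$-semilinear maps $f:E\to E'$ (additive, $f(\lambda \xi)=\sigma(\lambda)f(\xi)$, not identically zero), two such maps being in the same projective class if they differ by multiplication by an invertible element of $K'$. Equivalently: an injective ordered group morphism $\sigma:H\to H'$ and a class of non-decreasing maps $f:X\to X'$ with $f(h+x)=\sigma(h)+f(x)$, modulo $f\sim h'+f$ for $h'\in H'$. *)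

theory Defs
  imports "HOL-Algebra.Algebra" "HOL-Library.FuncSet"
begin

section \<open>Categories\<close>

text \<open>
  Categories are given by families of hom-sets. Hom-sets of different pairs of objects may
  overlap, so composition takes the three objects as arguments:
  \<open>Comp C a b c g f\<close> is the composite of \<open>f : a \<rightarrow> b\<close> and \<open>g : b \<rightarrow> c\<close>.
\<close>

record ('o, 'm) cat =
  Ob :: "'o set"
  Hom :: "'o \<Rightarrow> 'o \<Rightarrow> 'm set"
  Id :: "'o \<Rightarrow> 'm"
  Comp :: "'o \<Rightarrow> 'o \<Rightarrow> 'o \<Rightarrow> 'm \<Rightarrow> 'm \<Rightarrow> 'm"

definition is_category :: "('o, 'm) cat \<Rightarrow> bool" where
  "is_category C \<longleftrightarrow>
     (\<forall>a\<in>Ob C. Id C a \<in> Hom C a a) \<and>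
     (\<forall>a\<in>Ob C. \<forall>b\<in>Ob C. \<forall>c\<in>Ob C. \<forall>f\<in>Hom C a b. \<forall>g\<in>Hom C b c.
        Comp C a b c g f \<in> Hom C a c) \<and>
     (\<forall>a\<in>Ob C. \<forall>b\<in>Ob C. \<forall>f\<in>Hom C a b.
        Comp C a a b f (Id C a) = f \<and> Comp C a b b (Id C b) f = f) \<and>
     (\<forall>a\<in>Ob C. \<forall>b\<in>Ob C. \<forall>c\<in>Ob C. \<forall>d\<in>Ob C.
        \<forall>f\<in>Hom C a b. \<forall>g\<in>Hom C b c. \<forall>h\<in>Hom C c d.
        Comp C a b d (Comp C b c d h g) f = Comp C a c d h (Comp C a b c g f))"

definition opposite :: "('o, 'm) cat \<Rightarrow> ('o, 'm) cat" where
  "opposite C = \<lparr>Ob = Ob C, Hom = (\<lambda>a b. Hom C b a), Id = Id C,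
                 Comp = (\<lambda>a b c g f. Comp C c b a f g)\<rparr>"

definition full_subcategory :: "('o, 'm) cat \<Rightarrow> ('o \<Rightarrow> bool) \<Rightarrow> ('o, 'm) cat" where
  "full_subcategory C P = C\<lparr>Ob := {a \<in> Ob C. P a}\<rparr>"

definition iso_in :: "('o, 'm) cat \<Rightarrow> 'o \<Rightarrow> 'o \<Rightarrow> 'm \<Rightarrow> bool" where
  "iso_in C a b f \<longleftrightarrow> f \<in> Hom C a b \<and>
     (\<exists>g\<in>Hom C b a. Comp C a b a g f = Id C a \<and> Comp C b a b f g = Id C b)"

record ('o, 'm, 'p, 'n) ftor =
  on_ob :: "'o \<Rightarrow> 'p"
  on_arr :: "'o \<Rightarrow> 'o \<Rightarrow> 'm \<Rightarrow> 'n"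

definition is_ftor :: "('o, 'm) cat \<Rightarrow> ('p, 'n) cat \<Rightarrow> ('o, 'm, 'p, 'n) ftor \<Rightarrow> bool" where
  "is_ftor C D F \<longleftrightarrow>
     (\<forall>a\<in>Ob C. on_ob F a \<in> Ob D) \<and>
     (\<forall>a\<in>Ob C. \<forall>b\<in>Ob C. \<forall>f\<in>Hom C a b. on_arr F a b f \<in> Hom D (on_ob F a) (on_ob F b)) \<and>
     (\<forall>a\<in>Ob C. on_arr F a a (Id C a) = Id D (on_ob F a)) \<and>
     (\<forall>a\<in>Ob C. \<forall>b\<in>Ob C. \<forall>c\<in>Ob C. \<forall>f\<in>Hom C a b. \<forall>g\<in>Hom C b c.
        on_arr F a c (Comp C a b c g f) =
        Comp D (on_ob F a) (on_ob F b) (on_ob F c) (on_arr F b c g) (on_arr F a b f))"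

definition id_ftor :: "('o, 'm, 'o, 'm) ftor" where
  "id_ftor = \<lparr>on_ob = (\<lambda>a. a), on_arr = (\<lambda>a b f. f)\<rparr>"

definition comp_ftor ::
  "('p, 'n, 'q, 'l) ftor \<Rightarrow> ('o, 'm, 'p, 'n) ftor \<Rightarrow> ('o, 'm, 'q, 'l) ftor" where
  "comp_ftor G F = \<lparr>on_ob = (\<lambda>a. on_ob G (on_ob F a)),
     on_arr = (\<lambda>a b f. on_arr G (on_ob F a) (on_ob F b) (on_arr F a b f))\<rparr>"

definition is_nat_trans ::
  "('o, 'm) cat \<Rightarrow> ('p, 'n) cat \<Rightarrow> ('o, 'm, 'p, 'n) ftor \<Rightarrow> ('o, 'm, 'p, 'n) ftor \<Rightarrow>
   ('o \<Rightarrow> 'n) \<Rightarrow> bool" where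
  "is_nat_trans C D F G \<tau> \<longleftrightarrow>
     (\<forall>a\<in>Ob C. \<tau> a \<in> Hom D (on_ob F a) (on_ob G a)) \<and>
     (\<forall>a\<in>Ob C. \<forall>b\<in>Ob C. \<forall>f\<in>Hom C a b.
        Comp D (on_ob F a) (on_ob F b) (on_ob G b) (\<tau> b) (on_arr F a b f) =
        Comp D (on_ob F a) (on_ob G a) (on_ob G b) (on_arr G a b f) (\<tau> a))"

definition naturally_isomorphic ::
  "('o, 'm) cat \<Rightarrow> ('p, 'n) cat \<Rightarrow> ('o, 'm, 'p, 'n) ftor \<Rightarrow> ('o, 'm, 'p, 'n) ftor \<Rightarrow> bool" where
  "naturally_isomorphic C D F G \<longleftrightarrow>
     (\<exists>\<tau>. is_nat_trans C D F G \<tau> \<and> (\<forall>a\<in>Ob C. iso_in D (on_ob F a) (on_ob G a) (\<tau> a)))"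

definition equivalent_categories :: "('o, 'm) cat \<Rightarrow> ('p, 'n) cat \<Rightarrow> bool" where
  "equivalent_categories C D \<longleftrightarrow> is_category C \<and> is_category D \<and>
     (\<exists>F G. is_ftor C D F \<and> is_ftor D C G \<and>
        naturally_isomorphic C C (comp_ftor G F) id_ftor \<and>
        naturally_isomorphic D D (comp_ftor F G) id_ftor)"

text \<open>
  Functors that are objects of a functor category, and the natural transformations between them,
  are normalised to \<open>undefined\<close> outside \<open>C\<close>, so that HOL equality is equality of functors on \<open>C\<close>.
\<close>

definition extensional_ftor :: "('o, 'm) cat \<Rightarrow> ('o, 'm, 'p, 'n) ftor \<Rightarrow> bool" where
  "extensional_ftor C F \<longleftrightarrow>
     (\<forall>a. a \<notin> Ob C \<longrightarrow> on_ob F a = undefined) \<and>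
     (\<forall>a b f. \<not> (a \<in> Ob C \<and> b \<in> Ob C \<and> f \<in> Hom C a b) \<longrightarrow> on_arr F a b f = undefined)"

definition functor_category ::
  "('o, 'm) cat \<Rightarrow> ('p, 'n) cat \<Rightarrow> (('o, 'm, 'p, 'n) ftor, 'o \<Rightarrow> 'n) cat" where
  "functor_category C D =
     \<lparr>Ob = {F. is_ftor C D F \<and> extensional_ftor C F},
      Hom = (\<lambda>F G. {\<tau>. is_nat_trans C D F G \<tau> \<and> \<tau> \<in> extensional (Ob C)}),
      Id = (\<lambda>F. \<lambda>a\<in>Ob C. Id D (on_ob F a)),
      Comp = (\<lambda>F G H \<tau> \<rho>. \<lambda>a\<in>Ob C. Comp D (on_ob F a) (on_ob G a) (on_ob H a) (\<tau> a) (\<rho> a))\<rparr>"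


section \<open>Flat functors and points of presheaf topoi\<close>

text \<open>
  The type \<open>'u\<close> plays the role of the universe: \<open>Sets\<close> is the category of all subsets of \<open>'u\<close>
  and all maps between them. The semifields and semimodules below have carriers in the same \<open>'u\<close>.
\<close>

definition Sets :: "('u set, 'u \<Rightarrow> 'u) cat" where
  "Sets = \<lparr>Ob = UNIV, Hom = (\<lambda>A B. A \<rightarrow>\<^sub>E B), Id = (\<lambda>A. \<lambda>x\<in>A. x),
           Comp = (\<lambda>A B D g f. compose A g f)\<rparr>"

definition elements_category ::
  "('o, 'm) cat \<Rightarrow> ('o, 'm, 'u set, 'u \<Rightarrow> 'u) ftor \<Rightarrow> ('o \<times> 'u, 'm) cat" where
  "elements_category C F =
     \<lparr>Ob = {(a, x). a \<in> Ob C \<and> x \<in> on_ob F a},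
      Hom = (\<lambda>(a, x) (b, y). {f \<in> Hom C a b. on_arr F a b f x = y}),
      Id = (\<lambda>(a, x). Id C a),
      Comp = (\<lambda>(a, x) (b, y) (c, z). Comp C a b c)\<rparr>"

definition cofiltered :: "('o, 'm) cat \<Rightarrow> bool" where
  "cofiltered C \<longleftrightarrow>
     Ob C \<noteq> {} \<and>
     (\<forall>a\<in>Ob C. \<forall>b\<in>Ob C. \<exists>c\<in>Ob C. Hom C c a \<noteq> {} \<and> Hom C c b \<noteq> {}) \<and>
     (\<forall>a\<in>Ob C. \<forall>b\<in>Ob C. \<forall>f\<in>Hom C a b. \<forall>g\<in>Hom C a b.
        \<exists>c\<in>Ob C. \<exists>h\<in>Hom C c a. Comp C c a b f h = Comp C c a b g h)"

definition flat :: "('o, 'm) cat \<Rightarrow> ('o, 'm, 'u set, 'u \<Rightarrow> 'u) ftor \<Rightarrow> bool" where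
  "flat C F \<longleftrightarrow> is_ftor C Sets F \<and> cofiltered (elements_category C F)"

text \<open>
  The points of the topos of contravariant functors \<open>C \<rightarrow> Sets\<close> are represented by the flat
  covariant functors \<open>C \<rightarrow> Sets\<close>, with natural transformations as morphisms.
\<close>

definition presheaf_topos_points ::
  "('o, 'm) cat \<Rightarrow> (('o, 'm, 'u set, 'u \<Rightarrow> 'u) ftor, 'o \<Rightarrow> 'u \<Rightarrow> 'u) cat" where
  "presheaf_topos_points C = full_subcategory (functor_category C Sets) (flat C)"


section \<open>The epicyclic category\<close>

text \<open>The object \<open>n\<close> stands for the integers with the automorphism \<open>x \<mapsto> x + n + 1\<close>.\<close>

definition epicyclic_map :: "nat \<Rightarrow> nat \<Rightarrow> (int \<Rightarrow> int) \<Rightarrow> bool" where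
  "epicyclic_map n m f \<longleftrightarrow>
     mono f \<and> (\<exists>k>0. \<forall>x. f (x + int n + 1) = f x + k * (int m + 1))"

definition epicyclic_class :: "nat \<Rightarrow> (int \<Rightarrow> int) \<Rightarrow> (int \<Rightarrow> int) set" where
  "epicyclic_class m f = {g. \<exists>a. \<forall>x. g x = f x + a * (int m + 1)}"

definition epicyclic :: "(nat, (int \<Rightarrow> int) set) cat" where
  "epicyclic =
     \<lparr>Ob = UNIV,
      Hom = (\<lambda>n m. {epicyclic_class m f |f. epicyclic_map n m f}),
      Id = (\<lambda>n. epicyclic_class n (\<lambda>x. x)),
      Comp = (\<lambda>n m p G F. {g \<circ> f |g f. g \<in> G \<and> f \<in> F})\<rparr>"


section \<open>Algebraic extensions of the tropical integers and archimedean semimodules\<close>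

locale semifield = semiring K + comm_monoid K for K (structure) +
  assumes one_not_zero: "\<one> \<noteq> \<zero>"
    and nonzero_Units: "carrier K - {\<zero>} \<subseteq> Units K"

text \<open>\<open>Hmax H\<close> is \<open>H \<union> {-\<infinity>}\<close> with maximum and addition; \<open>None\<close> is \<open>-\<infinity>\<close>.\<close>

definition Hmax :: "rat set \<Rightarrow> rat option ring" where
  "Hmax H =
     \<lparr>carrier = insert None (Some ` H),
      monoid.mult = (\<lambda>x y. case (x, y) of (Some a, Some b) \<Rightarrow> Some (a + b) | _ \<Rightarrow> None),
      one = Some 0,
      ring.zero = None,
      add = (\<lambda>x y. case x of None \<Rightarrow> y
                    | Some a \<Rightarrow> (case y of None \<Rightarrow> x | Some b \<Rightarrow> Some (max a b)))\<rparr>"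

text \<open>
  Only the existence of an embedding of \<open>Hmax \<int>\<close> is required: it is not part of the data, and the
  morphisms below need not respect one.
\<close>

definition algebraic_extension_Zmax :: "('k, 'r) ring_scheme \<Rightarrow> bool" where
  "algebraic_extension_Zmax K \<longleftrightarrow> semifield K \<and>
     (\<exists>H. \<int> \<subseteq> H \<and> (\<forall>a\<in>H. \<forall>b\<in>H. a - b \<in> H) \<and> ring_iso K (Hmax H) \<noteq> {})"

text \<open>
  The library record of modules is reused for semimodules; its multiplication and unit on the
  semimodule are not used.
\<close>

locale semimodule = K: semiring K + E: abelian_monoid E
  for K :: "('k, 'r) ring_scheme" (structure) and E :: "('k, 'e, 's) module_scheme" (structure) +
  assumes smult_closed: "\<lbrakk>a \<in> carrier K; x \<in> carrier E\<rbrakk> \<Longrightarrow> a \<odot>\<^bsub>E\<^esub> x \<in> carrier E"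
    and smult_l_distr: "\<lbrakk>a \<in> carrier K; b \<in> carrier K; x \<in> carrier E\<rbrakk> \<Longrightarrow>
      (a \<oplus>\<^bsub>K\<^esub> b) \<odot>\<^bsub>E\<^esub> x = (a \<odot>\<^bsub>E\<^esub> x) \<oplus>\<^bsub>E\<^esub> (b \<odot>\<^bsub>E\<^esub> x)"
    and smult_r_distr: "\<lbrakk>a \<in> carrier K; x \<in> carrier E; y \<in> carrier E\<rbrakk> \<Longrightarrow>
      a \<odot>\<^bsub>E\<^esub> (x \<oplus>\<^bsub>E\<^esub> y) = (a \<odot>\<^bsub>E\<^esub> x) \<oplus>\<^bsub>E\<^esub> (a \<odot>\<^bsub>E\<^esub> y)"
    and smult_assoc: "\<lbrakk>a \<in> carrier K; b \<in> carrier K; x \<in> carrier E\<rbrakk> \<Longrightarrow>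
      (a \<otimes>\<^bsub>K\<^esub> b) \<odot>\<^bsub>E\<^esub> x = a \<odot>\<^bsub>E\<^esub> (b \<odot>\<^bsub>E\<^esub> x)"
    and smult_one: "x \<in> carrier E \<Longrightarrow> \<one>\<^bsub>K\<^esub> \<odot>\<^bsub>E\<^esub> x = x"
    and smult_l_null: "x \<in> carrier E \<Longrightarrow> \<zero>\<^bsub>K\<^esub> \<odot>\<^bsub>E\<^esub> x = \<zero>\<^bsub>E\<^esub>"
    and smult_r_null: "a \<in> carrier K \<Longrightarrow> a \<odot>\<^bsub>E\<^esub> \<zero>\<^bsub>E\<^esub> = \<zero>\<^bsub>E\<^esub>"

text \<open>The order on an idempotent additive monoid for which addition is the maximum.\<close>

definition add_le :: "('a, 'r) ring_scheme \<Rightarrow> 'a \<Rightarrow> 'a \<Rightarrow> bool" where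
  "add_le R x y \<longleftrightarrow> x \<oplus>\<^bsub>R\<^esub> y = y"

definition add_less :: "('a, 'r) ring_scheme \<Rightarrow> 'a \<Rightarrow> 'a \<Rightarrow> bool" where
  "add_less R x y \<longleftrightarrow> add_le R x y \<and> x \<noteq> y"

text \<open>
  In additive notation, with \<open>K = H \<union> {-\<infinity>}\<close> and \<open>E = X \<union> {-\<infinity>}\<close>: \<open>X\<close> is non-empty and totally
  ordered, \<open>h > 0\<close> implies \<open>h + x > x\<close>, and for all \<open>x\<close>, \<open>y\<close> some \<open>h \<ge> 0\<close> satisfies \<open>h + x > y\<close>.
  The zero of \<open>H\<close> is \<open>\<one>\<^bsub>K\<^esub>\<close>.
\<close>

locale archimedean_semimodule = semimodule +
  assumes nontrivial: "carrier E \<noteq> {\<zero>\<^bsub>E\<^esub>}"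
    and add_is_max: "\<lbrakk>x \<in> carrier E; y \<in> carrier E\<rbrakk> \<Longrightarrow> x \<oplus>\<^bsub>E\<^esub> y \<in> {x, y}"
    and increasing: "\<lbrakk>h \<in> carrier K; add_less K \<one>\<^bsub>K\<^esub> h; x \<in> carrier E - {\<zero>\<^bsub>E\<^esub>}\<rbrakk> \<Longrightarrow>
      add_less E x (h \<odot>\<^bsub>E\<^esub> x)"
    and archimedean: "\<lbrakk>x \<in> carrier E - {\<zero>\<^bsub>E\<^esub>}; y \<in> carrier E - {\<zero>\<^bsub>E\<^esub>}\<rbrakk> \<Longrightarrow>
      \<exists>h\<in>carrier K. add_le K \<one>\<^bsub>K\<^esub> h \<and> add_less E y (h \<odot>\<^bsub>E\<^esub> x)"


section \<open>The category \<open>\<P>\<close>\<close>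

definition semifield_embeddings ::
  "('k, 'r) ring_scheme \<Rightarrow> ('l, 's) ring_scheme \<Rightarrow> ('k \<Rightarrow> 'l) set" where
  "semifield_embeddings K K' =
     {\<sigma> \<in> ring_hom K K'. \<sigma> \<zero>\<^bsub>K\<^esub> = \<zero>\<^bsub>K'\<^esub> \<and> inj_on \<sigma> (carrier K) \<and> \<sigma> \<in> extensional (carrier K)}"

definition semilinear_maps ::
  "('k, 'r) ring_scheme \<Rightarrow> ('k, 'e, 's) module_scheme \<Rightarrow> ('l, 'f, 't) module_scheme \<Rightarrow>
   ('k \<Rightarrow> 'l) \<Rightarrow> ('e \<Rightarrow> 'f) set" where
  "semilinear_maps K E E' \<sigma> =
     {f \<in> carrier E \<rightarrow>\<^sub>E carrier E'.
        (\<forall>x\<in>carrier E. \<forall>y\<in>carrier E. f (x \<oplus>\<^bsub>E\<^esub> y) = f x \<oplus>\<^bsub>E'\<^esub> f y) \<and>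
        (\<forall>a\<in>carrier K. \<forall>x\<in>carrier E. f (a \<odot>\<^bsub>E\<^esub> x) = \<sigma> a \<odot>\<^bsub>E'\<^esub> f x) \<and>
        (\<exists>x\<in>carrier E. f x \<noteq> \<zero>\<^bsub>E'\<^esub>)}"

definition projective_class ::
  "('e, 'r) ring_scheme \<Rightarrow> ('l, 's) ring_scheme \<Rightarrow> ('l, 'f, 't) module_scheme \<Rightarrow>
   ('e \<Rightarrow> 'f) \<Rightarrow> ('e \<Rightarrow> 'f) set" where
  "projective_class E K' E' f = {\<lambda>x\<in>carrier E. u \<odot>\<^bsub>E'\<^esub> f x |u. u \<in> Units K'}"

type_synonym 'u \<P>_ob = "'u ring \<times> ('u, 'u) module"
type_synonym 'u \<P>_arr = "('u \<Rightarrow> 'u) \<times> ('u \<Rightarrow> 'u) set"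

definition \<P> :: "('u \<P>_ob, 'u \<P>_arr) cat" where
  "\<P> =
     \<lparr>Ob = {(K, E). algebraic_extension_Zmax K \<and> archimedean_semimodule K E},
      Hom = (\<lambda>(K, E) (K', E').
        {(\<sigma>, projective_class E K' E' f) |\<sigma> f.
           \<sigma> \<in> semifield_embeddings K K' \<and> f \<in> semilinear_maps K E E' \<sigma>}),
      Id = (\<lambda>(K, E). (\<lambda>a\<in>carrier K. a, projective_class E K E (\<lambda>x\<in>carrier E. x))),
      Comp = (\<lambda>(K, E) (K', E') (K'', E'') (\<sigma>', G) (\<sigma>, F).
        (compose (carrier K) \<sigma>' \<sigma>, {compose (carrier E) g f |g f. g \<in> G \<and> f \<in> F}))\<rparr>"

end

theory Submission
  imports Defs
begin

text \<open>
  An object of \<open>\<P>\<close> is the same thing as an ordered set \<open>X\<close> with an archimedean action of a group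
  \<open>\<int> \<subseteq> H \<subseteq> \<rat>\<close>. It is the filtered colimit of the objects of the epicyclic category mapping to
  it: two elements of \<open>H\<close> are multiples of a common \<open>\<delta> > 0\<close>, and a subset of \<open>X\<close> consisting of
  finitely many orbits of \<open>\<delta>\<close> is a copy of \<open>\<int>\<close> with the translation by some \<open>n + 1\<close>. Hence
  \<open>n \<mapsto> Hom(n, X)\<close> is flat and determines \<open>X\<close>.

  Conversely, let \<open>F\<close> be flat. Morphisms of the epicyclic category are only classes of maps, so
  the colimit of the copies of \<open>\<int>\<close> over the elements of \<open>F\<close> makes no sense directly. Each element
  is therefore equipped with a map from the object \<open>0\<close> that restricts it to a fixed base point in
  \<open>F 0\<close>; maps under \<open>0\<close> have canonical representatives, and the colimit over them is \<open>X\<close>.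
\<close>

section \<open>Equivalences of categories\<close>

text \<open>The equivalence is composed of two functors, from \<P> to \<open>arch_actions\<close>
  and from there to the points, each fully faithful and essentially surjective. The category in the
  middle removes the algebra: in suitable coordinates an embedding of groups is multiplication by
  some \<open>c > 0\<close>, and as the action is free, \<open>c\<close> can be read off from the
  map of points. A morphism is then just a translation class of maps. Morphisms need not preserve
  the copy of \<int> in the group; for a flat functor it is fixed by giving the base point period 1.
  Two obstacles shape the details. All sets must lie in one type \<open>'u\<close>, while classes of
  periodic maps and points of a colimit are not elements of \<open>'u\<close>. They receive codes: a
  periodic map is determined by \<open>n + 2\<close> values, a representative of a point of the
  colimit by five, and \<open>'u\<close> is infinite as soon as an action or a flat functor exists.
  Moreover, a relation in the colimit holds only after refinement. Arguments therefore gather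
  finitely many points, group elements and inequalities in one chart, where they become arithmetic
  of integers.\<close>

lemma cat_Id: "is_category C \<Longrightarrow> a \<in> Ob C \<Longrightarrow> Id C a \<in> Hom C a a"
  by (simp add: is_category_def)

lemma cat_Comp:
  "is_category C \<Longrightarrow> a \<in> Ob C \<Longrightarrow> b \<in> Ob C \<Longrightarrow> c \<in> Ob C \<Longrightarrow> f \<in> Hom C a b \<Longrightarrow> g \<in> Hom C b c \<Longrightarrow>
   Comp C a b c g f \<in> Hom C a c"
  unfolding is_category_def by blast

lemma cat_Id_right:
  "is_category C \<Longrightarrow> a \<in> Ob C \<Longrightarrow> b \<in> Ob C \<Longrightarrow> f \<in> Hom C a b \<Longrightarrow> Comp C a a b f (Id C a) = f"
  unfolding is_category_def by blast

lemma cat_Id_left: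
  "is_category C \<Longrightarrow> a \<in> Ob C \<Longrightarrow> b \<in> Ob C \<Longrightarrow> f \<in> Hom C a b \<Longrightarrow> Comp C a b b (Id C b) f = f"
  unfolding is_category_def by blast

lemma cat_assoc:
  "is_category C \<Longrightarrow> a \<in> Ob C \<Longrightarrow> b \<in> Ob C \<Longrightarrow> c \<in> Ob C \<Longrightarrow> d \<in> Ob C \<Longrightarrow>
   f \<in> Hom C a b \<Longrightarrow> g \<in> Hom C b c \<Longrightarrow> h \<in> Hom C c d \<Longrightarrow>
   Comp C a b d (Comp C b c d h g) f = Comp C a c d h (Comp C a b c g f)"
  unfolding is_category_def by blast

lemma ftor_Ob: "is_ftor C D F \<Longrightarrow> a \<in> Ob C \<Longrightarrow> on_ob F a \<in> Ob D"
  unfolding is_ftor_def by blast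

lemma ftor_Hom:
  "is_ftor C D F \<Longrightarrow> a \<in> Ob C \<Longrightarrow> b \<in> Ob C \<Longrightarrow> f \<in> Hom C a b \<Longrightarrow>
   on_arr F a b f \<in> Hom D (on_ob F a) (on_ob F b)"
  unfolding is_ftor_def by blast

lemma ftor_Id: "is_ftor C D F \<Longrightarrow> a \<in> Ob C \<Longrightarrow> on_arr F a a (Id C a) = Id D (on_ob F a)"
  unfolding is_ftor_def by blast

lemma ftor_Comp:
  "is_ftor C D F \<Longrightarrow> a \<in> Ob C \<Longrightarrow> b \<in> Ob C \<Longrightarrow> c \<in> Ob C \<Longrightarrow> f \<in> Hom C a b \<Longrightarrow> g \<in> Hom C b c \<Longrightarrow>
   on_arr F a c (Comp C a b c g f) =
   Comp D (on_ob F a) (on_ob F b) (on_ob F c) (on_arr F b c g) (on_arr F a b f)"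
  unfolding is_ftor_def by blast

lemma iso_in_comp:
  assumes C: "is_category C" and ob: "a \<in> Ob C" "b \<in> Ob C" "c \<in> Ob C"
    and f: "iso_in C a b f" and g: "iso_in C b c g"
  shows "iso_in C a c (Comp C a b c g f)"
proof -
  from f obtain f' where f1: "f \<in> Hom C a b" "f' \<in> Hom C b a"
    "Comp C a b a f' f = Id C a" "Comp C b a b f f' = Id C b"
    unfolding iso_in_def by blast
  from g obtain g' where g1: "g \<in> Hom C b c" "g' \<in> Hom C c b"
    "Comp C b c b g' g = Id C b" "Comp C c b c g g' = Id C c"
    unfolding iso_in_def by blast
  let ?h = "Comp C c b a f' g'"
  have gf: "Comp C a b c g f \<in> Hom C a c" and h: "?h \<in> Hom C c a"
    using cat_Comp[OF C] ob f1 g1 by auto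
  have "Comp C a c a ?h (Comp C a b c g f) = Comp C a b a f' (Comp C a c b g' (Comp C a b c g f))"
    by (rule cat_assoc[OF C]) (use ob f1 g1 gf in auto)
  also have "Comp C a c b g' (Comp C a b c g f) = f"
    using cat_assoc[OF C ob(1,2,3,2) f1(1) g1(1,2)] cat_Id_left[OF C ob(1,2) f1(1)] g1(3) by simp
  finally have 1: "Comp C a c a ?h (Comp C a b c g f) = Id C a"
    using f1(3) by simp
  have "Comp C c a c (Comp C a b c g f) ?h = Comp C c b c g (Comp C c a b f ?h)"
    by (rule cat_assoc[OF C]) (use ob f1 g1 h in auto)
  also have "Comp C c a b f ?h = g'"
    using cat_assoc[OF C ob(3,2,1,2) g1(2) f1(2,1)] cat_Id_left[OF C ob(3,2) g1(2)] f1(4) by simp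
  finally have 2: "Comp C c a c (Comp C a b c g f) ?h = Id C c"
    using g1(4) by simp
  show ?thesis
    unfolding iso_in_def using gf h 1 2 by blast
qed

lemma ftor_iso_in:
  assumes F: "is_ftor C D F" and ob: "a \<in> Ob C" "b \<in> Ob C" and f: "iso_in C a b f"
  shows "iso_in D (on_ob F a) (on_ob F b) (on_arr F a b f)"
proof -
  from f obtain g where "f \<in> Hom C a b" "g \<in> Hom C b a"
    "Comp C a b a g f = Id C a" "Comp C b a b f g = Id C b"
    unfolding iso_in_def by blast
  then show ?thesis
    unfolding iso_in_def
    using ftor_Hom[OF F] ftor_Id[OF F] ftor_Comp[OF F, of a b a f g] ftor_Comp[OF F, of b a b g f] ob
    by (metis (no_types, lifting))
qed

text \<open>Fully faithful and essentially surjective. In this form equivalences compose easily, and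
  a quasi-inverse has to be constructed only once, for the composite.\<close>

definition is_equivalence :: "('o, 'm) cat \<Rightarrow> ('p, 'n) cat \<Rightarrow> ('o, 'm, 'p, 'n) ftor \<Rightarrow> bool" where
  "is_equivalence C D F \<longleftrightarrow> is_ftor C D F \<and>
     (\<forall>a\<in>Ob C. \<forall>b\<in>Ob C. bij_betw (on_arr F a b) (Hom C a b) (Hom D (on_ob F a) (on_ob F b))) \<and>
     (\<forall>d\<in>Ob D. \<exists>c\<in>Ob C. \<exists>f. iso_in D (on_ob F c) d f)"

lemma is_equivalence_comp:
  assumes E: "is_category E" and F: "is_equivalence C D F" and G: "is_equivalence D E G"
  shows "is_equivalence C E (comp_ftor G F)"
proof -
  have F1: "is_ftor C D F" and G1: "is_ftor D E G"
    using F G by (auto simp: is_equivalence_def)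
  have FG: "is_ftor C E (comp_ftor G F)"
    unfolding is_ftor_def comp_ftor_def
    using ftor_Ob[OF F1] ftor_Ob[OF G1] ftor_Hom[OF F1] ftor_Hom[OF G1] ftor_Id[OF F1] ftor_Id[OF G1]
      ftor_Comp[OF F1] ftor_Comp[OF G1]
    by simp
  have "bij_betw (on_arr (comp_ftor G F) a b) (Hom C a b)
      (Hom E (on_ob (comp_ftor G F) a) (on_ob (comp_ftor G F) b))"
    if "a \<in> Ob C" "b \<in> Ob C" for a b
  proof -
    have "bij_betw (on_arr F a b) (Hom C a b) (Hom D (on_ob F a) (on_ob F b))"
      using F that by (simp add: is_equivalence_def)
    moreover have "bij_betw (on_arr G (on_ob F a) (on_ob F b)) (Hom D (on_ob F a) (on_ob F b))
        (Hom E (on_ob G (on_ob F a)) (on_ob G (on_ob F b)))"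
      using G that ftor_Ob[OF F1] by (simp add: is_equivalence_def)
    ultimately show ?thesis
      using bij_betw_trans by (fastforce simp: comp_ftor_def o_def)
  qed
  moreover have "\<exists>c\<in>Ob C. \<exists>f. iso_in E (on_ob (comp_ftor G F) c) e f" if e: "e \<in> Ob E" for e
  proof -
    obtain d g where d: "d \<in> Ob D" "iso_in E (on_ob G d) e g"
      using G e unfolding is_equivalence_def by blast
    obtain c f where c: "c \<in> Ob C" "iso_in D (on_ob F c) d f"
      using F d unfolding is_equivalence_def by blast
    have "iso_in E (on_ob G (on_ob F c)) (on_ob G d) (on_arr G (on_ob F c) d f)"
      using ftor_iso_in[OF G1] c d ftor_Ob[OF F1] by blast
    from iso_in_comp[OF E _ _ e this d(2)] show ?thesis
      using c d e ftor_Ob[OF G1] ftor_Ob[OF F1] by (auto simp: comp_ftor_def)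
  qed
  ultimately show ?thesis
    using FG by (simp add: is_equivalence_def)
qed

text \<open>The quasi-inverse is chosen object by object: \<open>A d\<close> is a preimage of
  \<open>d\<close> up to the isomorphism \<open>e d\<close> with inverse \<open>k d\<close>. A
  morphism is conjugated by these isomorphisms and pulled back along the full and faithful
  \<open>F\<close>. The conclusion runs from \<open>D\<close> to \<open>C\<close>, because the
  functor to which it is applied starts at \<P>.\<close>

lemma is_equivalence_imp_equivalent_categories:
  assumes C: "is_category C" and D: "is_category D" and F: "is_equivalence C D F"
  shows "equivalent_categories D C"
proof -
  have F1: "is_ftor C D F"
    using F by (simp add: is_equivalence_def)
  note FOb = ftor_Ob[OF F1] and FHom = ftor_Hom[OF F1] and FId = ftor_Id[OF F1]
    and FComp = ftor_Comp[OF F1]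
  have bij: "bij_betw (on_arr F a b) (Hom C a b) (Hom D (on_ob F a) (on_ob F b))"
    if "a \<in> Ob C" "b \<in> Ob C" for a b
    using F that by (simp add: is_equivalence_def)
  have inj: "f = g" if "a \<in> Ob C" "b \<in> Ob C" "f \<in> Hom C a b" "g \<in> Hom C a b"
    "on_arr F a b f = on_arr F a b g" for a b f g
    using bij[OF that(1,2)] that(3-) by (auto simp: bij_betw_def inj_on_def)
  have "\<forall>d\<in>Ob D. \<exists>c f. c \<in> Ob C \<and> iso_in D (on_ob F c) d f"
    using F unfolding is_equivalence_def by blast
  then obtain A e where A: "\<And>d. d \<in> Ob D \<Longrightarrow> A d \<in> Ob C"
    and e: "\<And>d. d \<in> Ob D \<Longrightarrow> iso_in D (on_ob F (A d)) d (e d)"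
    by metis
  have "\<forall>d\<in>Ob D. \<exists>k. k \<in> Hom D d (on_ob F (A d)) \<and>
      Comp D (on_ob F (A d)) d (on_ob F (A d)) k (e d) = Id D (on_ob F (A d)) \<and>
      Comp D d (on_ob F (A d)) d (e d) k = Id D d"
    using e unfolding iso_in_def by blast
  then obtain k where k: "\<And>d. d \<in> Ob D \<Longrightarrow> k d \<in> Hom D d (on_ob F (A d))"
    and ke: "\<And>d. d \<in> Ob D \<Longrightarrow>
      Comp D (on_ob F (A d)) d (on_ob F (A d)) (k d) (e d) = Id D (on_ob F (A d))"
    and ek: "\<And>d. d \<in> Ob D \<Longrightarrow> Comp D d (on_ob F (A d)) d (e d) (k d) = Id D d"
    by metis
  have eH: "\<And>d. d \<in> Ob D \<Longrightarrow> e d \<in> Hom D (on_ob F (A d)) d"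
    using e by (simp add: iso_in_def)
  define FA where "FA d = on_ob F (A d)" for d
  have FA: "\<And>d. d \<in> Ob D \<Longrightarrow> FA d \<in> Ob D"
    using A FOb by (simp add: FA_def)
  define pre where "pre a b x = inv_into (Hom C a b) (on_arr F a b) x" for a b x
  have pre: "pre a b x \<in> Hom C a b" "on_arr F a b (pre a b x) = x"
    if "a \<in> Ob C" "b \<in> Ob C" "x \<in> Hom D (on_ob F a) (on_ob F b)" for a b x
    using bij[OF that(1,2)] that(3)
    by (auto simp: pre_def bij_betw_def inv_into_into f_inv_into_f)
  \<comment> \<open>The conjugate of \<open>f\<close> by the chosen isomorphisms; the quasi-inverse
    will send \<open>f\<close> to the preimage of it under \<open>F\<close>.\<close>
  define cj where "cj d d' f = Comp D (FA d) d' (FA d') (k d') (Comp D (FA d) d d' f (e d))" for d d' f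
  have cj1: "Comp D (FA d) d d' f (e d) \<in> Hom D (FA d) d'"
    if "d \<in> Ob D" "d' \<in> Ob D" "f \<in> Hom D d d'" for d d' f
    by (rule cat_Comp[OF D]) (use that FA eH in \<open>auto simp: FA_def\<close>)
  have cj: "cj d d' f \<in> Hom D (FA d) (FA d')"
    if "d \<in> Ob D" "d' \<in> Ob D" "f \<in> Hom D d d'" for d d' f
    unfolding cj_def by (rule cat_Comp[OF D]) (use that FA k cj1 in \<open>auto simp: FA_def\<close>)
  have ecj: "Comp D (FA d) (FA d') d' (e d') (cj d d' f) = Comp D (FA d) d d' f (e d)"
    if "d \<in> Ob D" "d' \<in> Ob D" "f \<in> Hom D d d'" for d d' f
  proof -
    have "Comp D (FA d) (FA d') d' (e d') (cj d d' f) =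
      Comp D (FA d) d' d' (Comp D d' (FA d') d' (e d') (k d')) (Comp D (FA d) d d' f (e d))"
      unfolding cj_def
      by (rule cat_assoc[OF D, symmetric]) (use that FA k eH cj1 in \<open>auto simp: FA_def\<close>)
    also have "\<dots> = Comp D (FA d) d d' f (e d)"
      using ek that cat_Id_left[OF D] cj1 FA by (simp add: FA_def)
    finally show ?thesis .
  qed
  \<comment> \<open>\<open>e d\<close> is a monomorphism, with left inverse \<open>k d\<close>.
    Identities between conjugates are thus checked after composing with \<open>e d\<close>, where
    \<open>ecj\<close> removes the conjugation.\<close>
  have cancel: "x = y" if "c \<in> Ob D" "d \<in> Ob D" "x \<in> Hom D c (FA d)" "y \<in> Hom D c (FA d)"
    "Comp D c (FA d) d (e d) x = Comp D c (FA d) d (e d) y" for c d x y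
  proof -
    have *: "Comp D c d (FA d) (k d) (Comp D c (FA d) d (e d) z) = z" if "z \<in> Hom D c (FA d)" for z
    proof -
      have "Comp D c d (FA d) (k d) (Comp D c (FA d) d (e d) z) =
        Comp D c (FA d) (FA d) (Comp D (FA d) d (FA d) (k d) (e d)) z"
        by (rule cat_assoc[OF D, symmetric]) (use \<open>c \<in> Ob D\<close> \<open>d \<in> Ob D\<close> that FA k eH in \<open>auto simp: FA_def\<close>)
      also have "\<dots> = z"
        using ke \<open>c \<in> Ob D\<close> \<open>d \<in> Ob D\<close> that cat_Id_left[OF D] FA by (simp add: FA_def)
      finally show ?thesis .
    qed
    show ?thesis
      by (metis *[OF that(3)] *[OF that(4)] that(5))
  qed
  define G where "G = \<lparr>on_ob = A, on_arr = (\<lambda>d d' f. pre (A d) (A d') (cj d d' f))\<rparr>"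
  have GH: "pre (A d) (A d') (cj d d' f) \<in> Hom C (A d) (A d')"
    "on_arr F (A d) (A d') (pre (A d) (A d') (cj d d' f)) = cj d d' f"
    if "d \<in> Ob D" "d' \<in> Ob D" "f \<in> Hom D d d'" for d d' f
    using pre A cj that by (auto simp: FA_def)
  have G1: "is_ftor D C G"
    unfolding is_ftor_def
  proof (intro conjI ballI)
    show "on_ob G a \<in> Ob C" if "a \<in> Ob D" for a
      using A that by (simp add: G_def)
    show "on_arr G a b f \<in> Hom C (on_ob G a) (on_ob G b)"
      if "a \<in> Ob D" "b \<in> Ob D" "f \<in> Hom D a b" for a b f
      using GH that by (simp add: G_def)
  next
    fix a assume a: "a \<in> Ob D"
    have "cj a a (Id D a) = Id D (FA a)"
      using a cat_Id_left[OF D FA[OF a] a eH[OF a, folded FA_def]] ke[OF a] by (simp add: FA_def cj_def)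
    then have "on_arr F (A a) (A a) (pre (A a) (A a) (cj a a (Id D a))) = on_arr F (A a) (A a) (Id C (A a))"
      using GH(2)[OF a a cat_Id[OF D a]] FId A a by (simp add: FA_def)
    then show "on_arr G a a (Id D a) = Id C (on_ob G a)"
      using inj[OF A[OF a] A[OF a] GH(1)[OF a a cat_Id[OF D a]] cat_Id[OF C A[OF a]]]
      by (simp add: G_def)
  next
    fix a b c f g assume a: "a \<in> Ob D" and b: "b \<in> Ob D" and c: "c \<in> Ob D"
      and f: "f \<in> Hom D a b" and g: "g \<in> Hom D b c"
    have gf: "Comp D a b c g f \<in> Hom D a c"
      using cat_Comp[OF D] a b c f g by blast
    have "Comp D (FA a) (FA c) c (e c) (Comp D (FA a) (FA b) (FA c) (cj b c g) (cj a b f)) =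
      Comp D (FA a) (FA b) c (Comp D (FA b) (FA c) c (e c) (cj b c g)) (cj a b f)"
      by (rule cat_assoc[OF D, symmetric]) (use a b c f g FA cj eH in \<open>auto simp: FA_def\<close>)
    also have "\<dots> = Comp D (FA a) (FA b) c (Comp D (FA b) b c g (e b)) (cj a b f)"
      using ecj b c g by simp
    also have "\<dots> = Comp D (FA a) b c g (Comp D (FA a) (FA b) b (e b) (cj a b f))"
      by (rule cat_assoc[OF D]) (use a b c f g FA cj eH in \<open>auto simp: FA_def\<close>)
    also have "\<dots> = Comp D (FA a) b c g (Comp D (FA a) a b f (e a))"
      using ecj a b f by simp
    also have "\<dots> = Comp D (FA a) a c (Comp D a b c g f) (e a)"
      by (rule cat_assoc[OF D, symmetric]) (use a b c f g FA cj eH in \<open>auto simp: FA_def\<close>)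
    also have "\<dots> = Comp D (FA a) (FA c) c (e c) (cj a c (Comp D a b c g f))"
      using ecj[OF a c gf] by simp
    finally have *: "Comp D (FA a) (FA b) (FA c) (cj b c g) (cj a b f) = cj a c (Comp D a b c g f)"
      by (rule cancel[OF FA[OF a] c
            cat_Comp[OF D FA[OF a] FA[OF b] FA[OF c] cj[OF a b f] cj[OF b c g]] cj[OF a c gf]])
    have "on_arr F (A a) (A c) (pre (A a) (A c) (cj a c (Comp D a b c g f))) =
      on_arr F (A a) (A c) (Comp C (A a) (A b) (A c) (pre (A b) (A c) (cj b c g)) (pre (A a) (A b) (cj a b f)))"
      by (simp add: GH(2)[OF a c gf] GH(2)[OF a b f] GH(2)[OF b c g]
          FComp[OF A[OF a] A[OF b] A[OF c] GH(1)[OF a b f] GH(1)[OF b c g]] *[unfolded FA_def])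
    then show "on_arr G a c (Comp D a b c g f) =
       Comp C (on_ob G a) (on_ob G b) (on_ob G c) (on_arr G b c g) (on_arr G a b f)"
      using inj[OF A[OF a] A[OF c] GH(1)[OF a c gf]
          cat_Comp[OF C A[OF a] A[OF b] A[OF c] GH(1)[OF a b f] GH(1)[OF b c g]]]
      by (simp add: G_def)
  qed
  have nat1: "naturally_isomorphic D D (comp_ftor F G) id_ftor"
    unfolding naturally_isomorphic_def
  proof (intro exI conjI ballI)
    show "is_nat_trans D D (comp_ftor F G) id_ftor e"
      unfolding is_nat_trans_def
      using eH GH(2) ecj by (simp add: comp_ftor_def id_ftor_def G_def FA_def)
    show "iso_in D (on_ob (comp_ftor F G) a) (on_ob id_ftor a) (e a)" if "a \<in> Ob D" for a
      using e that by (simp add: comp_ftor_def id_ftor_def G_def)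
  qed
  \<comment> \<open>The other natural isomorphism is the preimage under \<open>F\<close> of
    \<open>e\<close> at \<open>F c\<close>; its inverse \<open>s\<close> below is the preimage of
    \<open>k\<close>.\<close>
  define t where "t c = pre (A (on_ob F c)) c (e (on_ob F c))" for c
  have AF: "A (on_ob F c) \<in> Ob C" if "c \<in> Ob C" for c
    using that A FOb by blast
  have t: "t c \<in> Hom C (A (on_ob F c)) c" "on_arr F (A (on_ob F c)) c (t c) = e (on_ob F c)"
    if "c \<in> Ob C" for c
    using pre AF eH FOb that by (auto simp: t_def)
  have nat2: "naturally_isomorphic C C (comp_ftor G F) id_ftor"
    unfolding naturally_isomorphic_def
  proof (intro exI conjI ballI)
    show "is_nat_trans C C (comp_ftor G F) id_ftor t"
      unfolding is_nat_trans_def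
    proof (intro conjI ballI)
      show "t a \<in> Hom C (on_ob (comp_ftor G F) a) (on_ob id_ftor a)" if "a \<in> Ob C" for a
        using t that by (simp add: comp_ftor_def id_ftor_def G_def)
      fix a b f assume a: "a \<in> Ob C" and b: "b \<in> Ob C" and f: "f \<in> Hom C a b"
      let ?Aa = "A (on_ob F a)" and ?Ab = "A (on_ob F b)"
      let ?g = "pre ?Aa ?Ab (cj (on_ob F a) (on_ob F b) (on_arr F a b f))"
      have g: "?g \<in> Hom C ?Aa ?Ab"
        "on_arr F ?Aa ?Ab ?g = cj (on_ob F a) (on_ob F b) (on_arr F a b f)"
        using GH FOb FHom a b f by auto
      have "Comp C ?Aa ?Ab b (t b) ?g = Comp C ?Aa a b f (t a)"
      proof (rule inj[OF AF[OF a] b])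
        show "Comp C ?Aa ?Ab b (t b) ?g \<in> Hom C ?Aa b" "Comp C ?Aa a b f (t a) \<in> Hom C ?Aa b"
          using cat_Comp[OF C] AF a b t g f by auto
        show "on_arr F ?Aa b (Comp C ?Aa ?Ab b (t b) ?g) = on_arr F ?Aa b (Comp C ?Aa a b f (t a))"
          using FComp AF a b t g f ecj[OF FOb[OF a] FOb[OF b] FHom[OF a b f]] by (simp add: FA_def)
      qed
      then show "Comp C (on_ob (comp_ftor G F) a) (on_ob (comp_ftor G F) b) (on_ob id_ftor b) (t b)
             (on_arr (comp_ftor G F) a b f) =
            Comp C (on_ob (comp_ftor G F) a) (on_ob id_ftor a) (on_ob id_ftor b) (on_arr id_ftor a b f) (t a)"
        by (simp add: comp_ftor_def id_ftor_def G_def)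
    qed
    fix a assume a: "a \<in> Ob C"
    let ?Aa = "A (on_ob F a)"
    define s where "s = pre a ?Aa (k (on_ob F a))"
    have s: "s \<in> Hom C a ?Aa" "on_arr F a ?Aa s = k (on_ob F a)"
      using pre AF k FOb a by (auto simp: s_def)
    have "Comp C ?Aa a ?Aa s (t a) = Id C ?Aa"
      by (rule inj[OF AF[OF a] AF[OF a] cat_Comp[OF C AF[OF a] a AF[OF a] t(1)[OF a] s(1)] cat_Id[OF C AF[OF a]]])
        (simp add: FComp[OF AF[OF a] a AF[OF a] t(1)[OF a] s(1)] FId[OF AF[OF a]] s t(2)[OF a] ke[OF FOb[OF a]])
    moreover have "Comp C a ?Aa a (t a) s = Id C a"
      by (rule inj[OF a a cat_Comp[OF C a AF[OF a] a s(1) t(1)[OF a]] cat_Id[OF C a]])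
        (simp add: FComp[OF a AF[OF a] a s(1) t(1)[OF a]] FId[OF a] s t(2)[OF a] ek[OF FOb[OF a]])
    ultimately show "iso_in C (on_ob (comp_ftor G F) a) (on_ob id_ftor a) (t a)"
      using s t[OF a] by (auto simp: iso_in_def comp_ftor_def id_ftor_def G_def)
  qed
  show ?thesis
    unfolding equivalent_categories_def using C D F1 G1 nat1 nat2 by blast
qed

section \<open>Sets, full subcategories and functor categories\<close>

lemma is_category_Sets: "is_category Sets"
  unfolding is_category_def Sets_def
  by (auto simp: compose_def PiE_def Pi_def extensional_def restrict_def fun_eq_iff)

lemma is_category_full_subcategory: "is_category C \<Longrightarrow> is_category (full_subcategory C P)"
  unfolding is_category_def full_subcategory_def by auto

lemma is_category_functor_category:
  assumes D: "is_category D"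
  shows "is_category (functor_category C D)"
proof -
  show ?thesis
    unfolding is_category_def
  proof (intro conjI ballI)
    fix F assume F: "F \<in> Ob (functor_category C D)"
    then have F1: "is_ftor C D F"
      by (simp add: functor_category_def)
    show "Id (functor_category C D) F \<in> Hom (functor_category C D) F F"
      using ftor_Ob[OF F1] ftor_Hom[OF F1] cat_Id[OF D] cat_Id_left[OF D] cat_Id_right[OF D]
      by (auto simp: functor_category_def is_nat_trans_def)
  next
    fix F G H t r
    assume F: "F \<in> Ob (functor_category C D)" and G: "G \<in> Ob (functor_category C D)"
      and H: "H \<in> Ob (functor_category C D)"
      and t: "t \<in> Hom (functor_category C D) F G" and r: "r \<in> Hom (functor_category C D) G H"
    have F1: "is_ftor C D F" and G1: "is_ftor C D G" and H1: "is_ftor C D H"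
      using F G H by (simp_all add: functor_category_def)
    note ob = ftor_Ob[OF F1] ftor_Ob[OF G1] ftor_Ob[OF H1]
    have tH: "\<And>a. a \<in> Ob C \<Longrightarrow> t a \<in> Hom D (on_ob F a) (on_ob G a)"
      and rH: "\<And>a. a \<in> Ob C \<Longrightarrow> r a \<in> Hom D (on_ob G a) (on_ob H a)"
      using t r by (auto simp: functor_category_def is_nat_trans_def)
    have "Comp D (on_ob F a) (on_ob F b) (on_ob H b)
        (Comp D (on_ob F b) (on_ob G b) (on_ob H b) (r b) (t b)) (on_arr F a b f) =
       Comp D (on_ob F a) (on_ob H a) (on_ob H b) (on_arr H a b f)
        (Comp D (on_ob F a) (on_ob G a) (on_ob H a) (r a) (t a))"
      if a: "a \<in> Ob C" and b: "b \<in> Ob C" and f: "f \<in> Hom C a b" for a b f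
    proof -
      note m = ftor_Hom[OF F1 a b f] ftor_Hom[OF G1 a b f] ftor_Hom[OF H1 a b f]
      have 1: "Comp D (on_ob F a) (on_ob F b) (on_ob G b) (t b) (on_arr F a b f) =
          Comp D (on_ob F a) (on_ob G a) (on_ob G b) (on_arr G a b f) (t a)"
        using t a b f by (auto simp: functor_category_def is_nat_trans_def)
      have 2: "Comp D (on_ob G a) (on_ob G b) (on_ob H b) (r b) (on_arr G a b f) =
          Comp D (on_ob G a) (on_ob H a) (on_ob H b) (on_arr H a b f) (r a)"
        using r a b f by (auto simp: functor_category_def is_nat_trans_def)
      \<comment> \<open>The two naturality squares are pasted: the composite is reassociated before,
        between and after their use.\<close>
      show ?thesis
        using cat_assoc[OF D _ _ _ _ m(1) tH rH, OF ob(1) ob(1) ob(2) ob(3), OF a b b b b b]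
          cat_assoc[OF D _ _ _ _ tH m(2) rH, OF ob(1) ob(2) ob(2) ob(3), OF a a b b a b]
          cat_assoc[OF D _ _ _ _ tH rH m(3), OF ob(1) ob(2) ob(3) ob(3), OF a a a b a a] 1 2
        by simp
    qed
    then show "Comp (functor_category C D) F G H r t \<in> Hom (functor_category C D) F H"
      using cat_Comp[OF D] ob tH rH by (simp add: functor_category_def is_nat_trans_def)
  next
    fix F G t
    assume F: "F \<in> Ob (functor_category C D)" and G: "G \<in> Ob (functor_category C D)"
      and t: "t \<in> Hom (functor_category C D) F G"
    have F1: "is_ftor C D F" and G1: "is_ftor C D G"
      using F G by (simp_all add: functor_category_def)
    have tH: "\<And>a. a \<in> Ob C \<Longrightarrow> t a \<in> Hom D (on_ob F a) (on_ob G a)" and te: "t \<in> extensional (Ob C)"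
      using t by (auto simp: functor_category_def is_nat_trans_def)
    have "(\<lambda>a\<in>Ob C. t a) = t"
      using te by (simp add: extensional_restrict)
    then show "Comp (functor_category C D) F F G t (Id (functor_category C D) F) = t"
      "Comp (functor_category C D) F G G (Id (functor_category C D) G) t = t"
      using tH ftor_Ob[OF F1] ftor_Ob[OF G1] cat_Id_left[OF D] cat_Id_right[OF D]
        extensional_arb[OF te]
      by (auto simp: functor_category_def fun_eq_iff restrict_def)
  next
    fix F G H K t r s
    assume "F \<in> Ob (functor_category C D)" "G \<in> Ob (functor_category C D)"
      "H \<in> Ob (functor_category C D)" "K \<in> Ob (functor_category C D)"
      and trs: "t \<in> Hom (functor_category C D) F G" "r \<in> Hom (functor_category C D) G H"
      "s \<in> Hom (functor_category C D) H K"
    then have fs: "is_ftor C D F" "is_ftor C D G" "is_ftor C D H" "is_ftor C D K"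
      by (simp_all add: functor_category_def)
    have m: "\<And>a. a \<in> Ob C \<Longrightarrow> t a \<in> Hom D (on_ob F a) (on_ob G a)"
      "\<And>a. a \<in> Ob C \<Longrightarrow> r a \<in> Hom D (on_ob G a) (on_ob H a)"
      "\<And>a. a \<in> Ob C \<Longrightarrow> s a \<in> Hom D (on_ob H a) (on_ob K a)"
      using trs by (auto simp: functor_category_def is_nat_trans_def)
    show "Comp (functor_category C D) F G K (Comp (functor_category C D) G H K s r) t =
       Comp (functor_category C D) F H K s (Comp (functor_category C D) F G H r t)"
      using cat_assoc[OF D _ _ _ _ m(1) m(2) m(3)] fs[THEN ftor_Ob]
      by (simp add: functor_category_def restrict_def fun_eq_iff)
  qed
qed

section \<open>Archimedean actions of subgroups of the rationals\<close>

text \<open>An object of \<P> with both copies of -\<infinity> removed. The group is a concrete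
  subset of \<rat>, so that ordered embeddings become multiplications by constants.\<close>

record 'a action =
  Grp :: "rat set"
  Pts :: "'a set"
  Leq :: "'a \<Rightarrow> 'a \<Rightarrow> bool"
  Act :: "rat \<Rightarrow> 'a \<Rightarrow> 'a"

text \<open>The bound in \<open>Act_arch\<close> is weak, whereas the one for semimodules is strict;
  adding 1 to \<open>h\<close> passes from the first to the second.\<close>

locale arch_action =
  fixes A :: "'a action"
  assumes Ints_Grp: "\<int> \<subseteq> Grp A"
    and Grp_diff: "\<lbrakk>h \<in> Grp A; k \<in> Grp A\<rbrakk> \<Longrightarrow> h - k \<in> Grp A"
    and Pts_nonempty: "Pts A \<noteq> {}"
    and Leq_refl: "x \<in> Pts A \<Longrightarrow> Leq A x x"
    and Leq_antisym: "\<lbrakk>x \<in> Pts A; y \<in> Pts A; Leq A x y; Leq A y x\<rbrakk> \<Longrightarrow> x = y"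
    and Leq_trans: "\<lbrakk>x \<in> Pts A; y \<in> Pts A; z \<in> Pts A; Leq A x y; Leq A y z\<rbrakk> \<Longrightarrow> Leq A x z"
    and Leq_total: "\<lbrakk>x \<in> Pts A; y \<in> Pts A\<rbrakk> \<Longrightarrow> Leq A x y \<or> Leq A y x"
    and Act_closed: "\<lbrakk>h \<in> Grp A; x \<in> Pts A\<rbrakk> \<Longrightarrow> Act A h x \<in> Pts A"
    and Act_0: "x \<in> Pts A \<Longrightarrow> Act A 0 x = x"
    and Act_add: "\<lbrakk>h \<in> Grp A; k \<in> Grp A; x \<in> Pts A\<rbrakk> \<Longrightarrow> Act A (h + k) x = Act A h (Act A k x)"
    and Act_mono: "\<lbrakk>h \<in> Grp A; x \<in> Pts A; y \<in> Pts A; Leq A x y\<rbrakk> \<Longrightarrow> Leq A (Act A h x) (Act A h y)"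
    and Act_pos: "\<lbrakk>h \<in> Grp A; 0 < h; x \<in> Pts A\<rbrakk> \<Longrightarrow> Leq A x (Act A h x) \<and> Act A h x \<noteq> x"
    and Act_arch: "\<lbrakk>x \<in> Pts A; y \<in> Pts A\<rbrakk> \<Longrightarrow> \<exists>h\<in>Grp A. 0 \<le> h \<and> Leq A y (Act A h x)"
begin

lemma Grp_0: "0 \<in> Grp A" and Grp_1: "1 \<in> Grp A"
  using Ints_Grp by auto

lemma Grp_uminus: "h \<in> Grp A \<Longrightarrow> - h \<in> Grp A"
  using Grp_diff[OF Grp_0] by simp

lemma Grp_add: "h \<in> Grp A \<Longrightarrow> k \<in> Grp A \<Longrightarrow> h + k \<in> Grp A"
  using Grp_diff[of h "- k"] Grp_uminus by simp

lemma Grp_mult: "h \<in> Grp A \<Longrightarrow> of_int j * h \<in> Grp A"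
proof (induction j rule: int_induct[where k = 0])
  case base
  then show ?case by (simp add: Grp_0)
next
  case (step1 i)
  then show ?case by (simp add: Grp_add distrib_right)
next
  case (step2 i)
  then show ?case by (simp add: Grp_diff left_diff_distrib)
qed

lemma Act_uminus: "h \<in> Grp A \<Longrightarrow> x \<in> Pts A \<Longrightarrow> Act A (- h) (Act A h x) = x"
  using Act_add[of "- h" h x] Grp_uminus Act_0 by simp

lemma Act_commute:
  "h \<in> Grp A \<Longrightarrow> k \<in> Grp A \<Longrightarrow> x \<in> Pts A \<Longrightarrow> Act A h (Act A k x) = Act A k (Act A h x)"
  by (metis Act_add add.commute)

lemma Act_Leq_iff:
  assumes "h \<in> Grp A" "x \<in> Pts A" "y \<in> Pts A"
  shows "Leq A (Act A h x) (Act A h y) \<longleftrightarrow> Leq A x y"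
  using assms Act_mono[of h x y] Act_mono[of "- h" "Act A h x" "Act A h y"] Act_uminus Grp_uminus Act_closed
  by auto

text \<open>Each orbit is a copy of the ordered group, because a positive element moves every point
  strictly up. In particular the action is free, which is the source of the uniqueness arguments
  below.\<close>

lemma Act_Leq_Act_iff:
  assumes h: "h \<in> Grp A" and k: "k \<in> Grp A" and x: "x \<in> Pts A"
  shows "Leq A (Act A h x) (Act A k x) \<longleftrightarrow> h \<le> k"
proof -
  have *: "Leq A (Act A h x) (Act A k x) \<and> Act A k x \<noteq> Act A h x" if "h < k" "h \<in> Grp A" "k \<in> Grp A" for h k
    using Act_pos[of "k - h" "Act A h x"] Act_add[of "k - h" h x] Grp_diff x Act_closed that by simp
  consider "h < k" | "h = k" | "k < h" by linarith
  then show ?thesis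
  proof cases
    case 3
    then show ?thesis
      using *[OF 3 k h] Leq_antisym Act_closed h k x by (metis less_le_not_le)
  qed (use * h k x Leq_refl Act_closed in auto)
qed

lemma Act_eq_iff:
  "h \<in> Grp A \<Longrightarrow> k \<in> Grp A \<Longrightarrow> x \<in> Pts A \<Longrightarrow> Act A h x = Act A k x \<longleftrightarrow> h = k"
  by (metis Act_Leq_Act_iff Act_closed Leq_refl order_antisym)

lemma Act_inj: "h \<in> Grp A \<Longrightarrow> x \<in> Pts A \<Longrightarrow> y \<in> Pts A \<Longrightarrow> Act A h x = Act A h y \<Longrightarrow> x = y"
  by (metis Act_uminus)

text \<open>Finitely generated subgroups of \<rat> are cyclic. Over a common denominator
  \<open>D\<close> the generator is \<open>gcd m n\<close> divided by \<open>D\<close>, and Bezout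
  puts it into the group.\<close>

lemma common_divisor:
  assumes "a \<in> Grp A" "b \<in> Grp A" "0 < a"
  shows "\<exists>\<delta>\<in>Grp A. 0 < \<delta> \<and> (\<exists>i>0. a = of_int i * \<delta>) \<and> (\<exists>j. b = of_int j * \<delta>)"
proof -
  obtain p q where a: "a = of_int p / of_int q" "q > 0"
    by (metis quotient_of_div quotient_of_denom_pos surj_pair)
  obtain r s where b: "b = of_int r / of_int s" "s > 0"
    by (metis quotient_of_div quotient_of_denom_pos surj_pair)
  define D where "D = q * s"
  define m n where "m = p * s" and "n = r * q"
  have am: "a = of_int m / of_int D" and bn: "b = of_int n / of_int D" and D: "D > 0"
    using a b by (auto simp: D_def m_def n_def)
  have m: "m > 0"
    using assms(3) a b by (auto simp: m_def zero_less_divide_iff)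
  obtain u v where uv: "u * m + v * n = gcd m n"
    using bezout_int by blast
  define \<delta> :: rat where "\<delta> = of_int (gcd m n) / of_int D"
  have "\<delta> = of_int u * a + of_int v * b"
    unfolding \<delta>_def uv[symmetric] am bn by (simp add: add_divide_distrib)
  then have "\<delta> \<in> Grp A"
    using Grp_add Grp_mult assms by simp
  moreover have "0 < \<delta>"
    using m D by (simp add: \<delta>_def)
  moreover have "a = of_int (m div gcd m n) * \<delta>" "b = of_int (n div gcd m n) * \<delta>"
    using am bn by (simp_all add: \<delta>_def flip: of_int_mult)
  moreover have "m div gcd m n > 0"
    using m by (simp add: pos_imp_zdiv_pos_iff zdvd_imp_le)
  ultimately show ?thesis by blast
qed

end

section \<open>The category of archimedean actions\<close>

definition act_maps :: "'a action \<Rightarrow> 'b action \<Rightarrow> ('a \<Rightarrow> 'b) set" where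
  "act_maps A B = {f \<in> Pts A \<rightarrow>\<^sub>E Pts B.
     (\<forall>x\<in>Pts A. \<forall>y\<in>Pts A. Leq A x y \<longrightarrow> Leq B (f x) (f y)) \<and>
     (\<exists>c>0. \<forall>h\<in>Grp A. c * h \<in> Grp B \<and> (\<forall>x\<in>Pts A. f (Act A h x) = Act B (c * h) (f x)))}"

definition act_class :: "'a action \<Rightarrow> 'b action \<Rightarrow> ('a \<Rightarrow> 'b) \<Rightarrow> ('a \<Rightarrow> 'b) set" where
  "act_class A B f = {\<lambda>x\<in>Pts A. Act B h (f x) |h. h \<in> Grp B}"

definition arch_actions :: "('a action, ('a \<Rightarrow> 'a) set) cat" where
  "arch_actions =
     \<lparr>Ob = {A. arch_action A},
      Hom = (\<lambda>A B. {act_class A B f |f. f \<in> act_maps A B}),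
      Id = (\<lambda>A. act_class A A (\<lambda>x\<in>Pts A. x)),
      Comp = (\<lambda>A B C G F. {compose (Pts A) g f |g f. g \<in> G \<and> f \<in> F})\<rparr>"

text \<open>The factor \<open>c\<close> is the additive form of an embedding of semifields, since
  ordered embeddings between subgroups of \<rat> are multiplications by positive constants. Between
  archimedean actions it is determined by \<open>f\<close>, as the case \<open>h = 1\<close> and
  freeness show.\<close>

lemma act_mapsE:
  assumes "f \<in> act_maps A B"
  obtains c where "c > 0" "\<And>h. h \<in> Grp A \<Longrightarrow> c * h \<in> Grp B"
    "\<And>h x. h \<in> Grp A \<Longrightarrow> x \<in> Pts A \<Longrightarrow> f (Act A h x) = Act B (c * h) (f x)"
  using assms unfolding act_maps_def by blast

lemma act_maps_Pts: "f \<in> act_maps A B \<Longrightarrow> x \<in> Pts A \<Longrightarrow> f x \<in> Pts B"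
  and act_maps_extensional: "f \<in> act_maps A B \<Longrightarrow> f \<in> extensional (Pts A)"
  and act_maps_mono: "f \<in> act_maps A B \<Longrightarrow> x \<in> Pts A \<Longrightarrow> y \<in> Pts A \<Longrightarrow> Leq A x y \<Longrightarrow> Leq B (f x) (f y)"
  unfolding act_maps_def by (auto simp: PiE_iff)

lemma act_maps_compose:
  assumes A: "arch_action A" and f: "f \<in> act_maps A B" and g: "g \<in> act_maps B C"
  shows "compose (Pts A) g f \<in> act_maps A C"
proof -
  interpret A: arch_action A by (rule A)
  obtain c where c: "c > 0" "\<And>h. h \<in> Grp A \<Longrightarrow> c * h \<in> Grp B"
    "\<And>h x. h \<in> Grp A \<Longrightarrow> x \<in> Pts A \<Longrightarrow> f (Act A h x) = Act B (c * h) (f x)"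
    using act_mapsE[OF f] by blast
  obtain d where d: "d > 0" "\<And>h. h \<in> Grp B \<Longrightarrow> d * h \<in> Grp C"
    "\<And>h x. h \<in> Grp B \<Longrightarrow> x \<in> Pts B \<Longrightarrow> g (Act B h x) = Act C (d * h) (g x)"
    using act_mapsE[OF g] by blast
  have "(d * c) * h \<in> Grp C \<and>
      (\<forall>x\<in>Pts A. compose (Pts A) g f (Act A h x) = Act C ((d * c) * h) (compose (Pts A) g f x))"
    if "h \<in> Grp A" for h
    using that c d act_maps_Pts[OF f] A.Act_closed by (simp add: compose_eq mult.assoc)
  moreover have "d * c > 0"
    using c d by simp
  ultimately show ?thesis
    using act_maps_Pts[OF f] act_maps_Pts[OF g] act_maps_mono[OF f] act_maps_mono[OF g]
    unfolding act_maps_def by (auto simp: compose_eq compose_def)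
qed

lemma act_maps_id: "arch_action A \<Longrightarrow> (\<lambda>x\<in>Pts A. x) \<in> act_maps A A"
  unfolding act_maps_def by (auto intro!: exI[of _ 1] simp: arch_action.Act_closed)

lemma act_maps_Act:
  assumes B: "arch_action B" and A: "arch_action A" and f: "f \<in> act_maps A B" and k: "k \<in> Grp B"
  shows "(\<lambda>x\<in>Pts A. Act B k (f x)) \<in> act_maps A B"
proof -
  interpret B: arch_action B by (rule B)
  obtain c where c: "c > 0" "\<And>h. h \<in> Grp A \<Longrightarrow> c * h \<in> Grp B"
    "\<And>h x. h \<in> Grp A \<Longrightarrow> x \<in> Pts A \<Longrightarrow> f (Act A h x) = Act B (c * h) (f x)"
    using act_mapsE[OF f] by blast
  show ?thesis
    using act_maps_Pts[OF f] act_maps_mono[OF f] B.Act_closed[OF k] B.Act_mono[OF k] c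
      B.Act_commute[OF k] arch_action.Act_closed[OF A]
    unfolding act_maps_def by (auto intro!: exI[of _ c])
qed

lemma act_class_self:
  assumes B: "arch_action B" and f: "f \<in> act_maps A B"
  shows "f \<in> act_class A B f"
proof -
  interpret B: arch_action B by (rule B)
  have "(\<lambda>x\<in>Pts A. Act B 0 (f x)) = f"
    using act_maps_Pts[OF f] act_maps_extensional[OF f] B.Act_0
    by (auto simp: fun_eq_iff extensional_def)
  then show ?thesis
    unfolding act_class_def using B.Grp_0 by (auto intro!: exI[of _ 0])
qed

lemma act_class_eqI:
  assumes B: "arch_action B" and f: "f \<in> act_maps A B" and k: "k \<in> Grp B"
    and g: "\<And>x. x \<in> Pts A \<Longrightarrow> g x = Act B k (f x)"
  shows "act_class A B g = act_class A B f"
proof -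
  interpret B: arch_action B by (rule B)
  have 1: "(\<lambda>x\<in>Pts A. Act B h (g x)) = (\<lambda>x\<in>Pts A. Act B (h + k) (f x))" if "h \<in> Grp B" for h
    using that k act_maps_Pts[OF f] B.Act_add g by (auto simp: fun_eq_iff)
  have "(\<lambda>x\<in>Pts A. Act B h (f x)) = (\<lambda>x\<in>Pts A. Act B (h - k) (g x))" if "h \<in> Grp B" for h
    using 1[OF B.Grp_diff[OF that k]] by simp
  then show ?thesis
    unfolding act_class_def using 1 B.Grp_add[OF _ k] B.Grp_diff[OF _ k] by blast
qed

lemma act_class_eq_iff:
  assumes A: "arch_action A" and B: "arch_action B" and f: "f \<in> act_maps A B" and g: "g \<in> act_maps A B"
  shows "act_class A B f = act_class A B g \<longleftrightarrow> (\<exists>h\<in>Grp B. \<forall>x\<in>Pts A. g x = Act B h (f x))"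
proof
  assume "act_class A B f = act_class A B g"
  then have "g \<in> act_class A B f"
    using act_class_self[OF B g] by simp
  then show "\<exists>h\<in>Grp B. \<forall>x\<in>Pts A. g x = Act B h (f x)"
    unfolding act_class_def by auto
next
  assume "\<exists>h\<in>Grp B. \<forall>x\<in>Pts A. g x = Act B h (f x)"
  then show "act_class A B f = act_class A B g"
    using act_class_eqI[OF B f] by metis
qed

text \<open>Since \<open>g\<close> turns a translation by \<open>h\<close> into a translation by
  \<open>d * h\<close>, all composites of representatives are translates of one map. Every translate
  already occurs with \<open>h = 0\<close>.\<close>

lemma act_class_compose:
  assumes A: "arch_action A" and B: "arch_action B" and C: "arch_action C"
    and f: "f \<in> act_maps A B" and g: "g \<in> act_maps B C"
  shows "{compose (Pts A) g' f' |g' f'. g' \<in> act_class B C g \<and> f' \<in> act_class A B f} =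
    act_class A C (compose (Pts A) g f)" (is "?L = ?R")
proof -
  interpret B: arch_action B by (rule B)
  interpret C: arch_action C by (rule C)
  obtain d where d: "d > 0" "\<And>h. h \<in> Grp B \<Longrightarrow> d * h \<in> Grp C"
    "\<And>h x. h \<in> Grp B \<Longrightarrow> x \<in> Pts B \<Longrightarrow> g (Act B h x) = Act C (d * h) (g x)"
    using act_mapsE[OF g] by blast
  have *: "compose (Pts A) (\<lambda>x\<in>Pts B. Act C k (g x)) (\<lambda>x\<in>Pts A. Act B h (f x)) =
    (\<lambda>x\<in>Pts A. Act C (k + d * h) (compose (Pts A) g f x))" if "k \<in> Grp C" "h \<in> Grp B" for k h
    using that act_maps_Pts[OF f] act_maps_Pts[OF g] d C.Act_add B.Act_closed
    by (auto simp: fun_eq_iff compose_def)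
  have "?L \<subseteq> ?R"
  proof
    fix x assume "x \<in> ?L"
    then obtain k h where "k \<in> Grp C" "h \<in> Grp B"
      "x = compose (Pts A) (\<lambda>x\<in>Pts B. Act C k (g x)) (\<lambda>x\<in>Pts A. Act B h (f x))"
      unfolding act_class_def by blast
    then show "x \<in> ?R"
      using * C.Grp_add d unfolding act_class_def by auto
  qed
  moreover have "?R \<subseteq> ?L"
  proof
    fix x assume "x \<in> ?R"
    then obtain k where k: "k \<in> Grp C" "x = (\<lambda>x\<in>Pts A. Act C k (compose (Pts A) g f x))"
      unfolding act_class_def by blast
    then have "x = compose (Pts A) (\<lambda>x\<in>Pts B. Act C k (g x)) (\<lambda>x\<in>Pts A. Act B 0 (f x))"
      using *[OF k(1) B.Grp_0] by simp
    then show "x \<in> ?L"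
      using k B.Grp_0 unfolding act_class_def by blast
  qed
  ultimately show ?thesis by blast
qed

lemma arch_actions_Comp:
  assumes "arch_action A" "arch_action B" "arch_action C" "f \<in> act_maps A B" "g \<in> act_maps B C"
  shows "Comp arch_actions A B C (act_class B C g) (act_class A B f) = act_class A C (compose (Pts A) g f)"
  using act_class_compose[OF assms] by (simp add: arch_actions_def)

lemma arch_actions_Hom: "f \<in> act_maps A B \<Longrightarrow> act_class A B f \<in> Hom arch_actions A B"
  by (auto simp: arch_actions_def)

lemma arch_actions_HomE:
  assumes "F \<in> Hom arch_actions A B"
  obtains f where "f \<in> act_maps A B" "F = act_class A B f"
  using assms by (auto simp: arch_actions_def)

lemma Ob_arch_actions: "A \<in> Ob arch_actions \<longleftrightarrow> arch_action A"
  by (simp add: arch_actions_def)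

lemma Id_arch_actions: "Id arch_actions A = act_class A A (\<lambda>x\<in>Pts A. x)"
  by (simp add: arch_actions_def)

lemma iso_in_arch_actionsI:
  assumes A: "arch_action A" and B: "arch_action B" and f: "f \<in> act_maps A B" and g: "g \<in> act_maps B A"
    and gf: "\<And>x. x \<in> Pts A \<Longrightarrow> g (f x) = x" and fg: "\<And>y. y \<in> Pts B \<Longrightarrow> f (g y) = y"
  shows "iso_in arch_actions A B (act_class A B f)"
proof -
  have "compose (Pts A) g f = (\<lambda>x\<in>Pts A. x)" "compose (Pts B) f g = (\<lambda>x\<in>Pts B. x)"
    using gf fg by (auto simp: compose_def fun_eq_iff)
  then show ?thesis
    unfolding iso_in_def
    using arch_actions_Comp[OF A B A f g] arch_actions_Comp[OF B A B g f] arch_actions_Hom f g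
    by (auto simp: Id_arch_actions intro!: bexI[of _ "act_class B A g"])
qed

section \<open>Periodic maps\<close>

lemma epicyclic_mapE:
  assumes "epicyclic_map n m f"
  obtains k where "k > 0" "\<And>t. f (t + int n + 1) = f t + k * (int m + 1)"
    "\<And>t q. f (t + q * (int n + 1)) = f t + q * k * (int m + 1)"
proof -
  obtain k where k: "k > 0" "\<And>t. f (t + int n + 1) = f t + k * (int m + 1)"
    using assms unfolding epicyclic_map_def by blast
  have "f (t + q * (int n + 1)) = f t + q * k * (int m + 1)" for t q
  proof (induction q rule: int_induct[where k = 0])
    case base
    then show ?case by simp
  next
    case (step1 i)
    then show ?case
      using k(2)[of "t + i * (int n + 1)"] by (simp add: algebra_simps)
  next
    case (step2 i)
    then show ?case
      using k(2)[of "t + (i - 1) * (int n + 1)"] by (simp add: algebra_simps)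
  qed
  then show ?thesis
    using k that by blast
qed

lemma epicyclic_map_mono: "epicyclic_map n m f \<Longrightarrow> s \<le> t \<Longrightarrow> f s \<le> f t"
  unfolding epicyclic_map_def by (blast dest: monoD)

lemma epicyclic_map_id: "epicyclic_map n n (\<lambda>x. x)"
  unfolding epicyclic_map_def mono_def by (intro conjI exI[of _ 1]) simp_all

lemma epicyclic_map_comp:
  assumes f: "epicyclic_map n m f" and g: "epicyclic_map m p g"
  shows "epicyclic_map n p (g \<circ> f)"
proof -
  obtain k where k: "k > 0" "\<And>t. f (t + int n + 1) = f t + k * (int m + 1)"
    "\<And>t q. f (t + q * (int n + 1)) = f t + q * k * (int m + 1)"
    using f by (rule epicyclic_mapE) (rule that)
  obtain l where l: "l > 0" "\<And>t. g (t + int m + 1) = g t + l * (int p + 1)"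
    "\<And>t q. g (t + q * (int m + 1)) = g t + q * l * (int p + 1)"
    using g by (rule epicyclic_mapE) (rule that)
  have "mono (g \<circ> f)"
    using f g by (simp add: epicyclic_map_def mono_def)
  moreover have "(g \<circ> f) (t + int n + 1) = (g \<circ> f) t + (k * l) * (int p + 1)" for t
    using k(2)[of t] l(3)[of "f t" k] by simp
  ultimately show ?thesis
    unfolding epicyclic_map_def using k(1) l(1) mult_pos_pos by blast
qed

lemma epicyclic_map_shift:
  "epicyclic_map n m f \<Longrightarrow> epicyclic_map n m (\<lambda>t. f t + a * (int m + 1))"
  unfolding epicyclic_map_def mono_def by force

text \<open>The automorphism of the object 0 is the successor, so all maps out of it are of this
  shape: arithmetic progressions whose step is a positive multiple of \<open>n + 1\<close>.\<close>

lemma epicyclic_map_slope: "k > 0 \<Longrightarrow> epicyclic_map 0 n (\<lambda>t. s + k * (int n + 1) * t)"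
  unfolding epicyclic_map_def
  by (intro conjI exI[of _ k]) (auto simp: mono_def distrib_left intro!: add_mono mult_left_mono)

lemma epicyclic_class_self: "f \<in> epicyclic_class m f"
  by (auto simp: epicyclic_class_def intro: exI[of _ 0])

lemma epicyclic_class_eq_iff:
  "epicyclic_class m f = epicyclic_class m g \<longleftrightarrow> (\<exists>a. \<forall>x. g x = f x + a * (int m + 1))"
proof
  assume "epicyclic_class m f = epicyclic_class m g"
  then have "g \<in> epicyclic_class m f"
    using epicyclic_class_self by blast
  then show "\<exists>a. \<forall>x. g x = f x + a * (int m + 1)"
    by (simp add: epicyclic_class_def)
next
  assume "\<exists>a. \<forall>x. g x = f x + a * (int m + 1)"
  then obtain a where a: "\<And>x. g x = f x + a * (int m + 1)" by blast
  have "(\<exists>b. \<forall>x. h x = f x + b * (int m + 1)) \<longleftrightarrow> (\<exists>b. \<forall>x. h x = g x + b * (int m + 1))" for h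
  proof
    assume "\<exists>b. \<forall>x. h x = f x + b * (int m + 1)"
    then obtain b where "\<forall>x. h x = f x + b * (int m + 1)" by blast
    then have "\<forall>x. h x = g x + (b - a) * (int m + 1)"
      using a by (simp add: algebra_simps)
    then show "\<exists>b. \<forall>x. h x = g x + b * (int m + 1)" by blast
  next
    assume "\<exists>b. \<forall>x. h x = g x + b * (int m + 1)"
    then obtain b where "\<forall>x. h x = g x + b * (int m + 1)" by blast
    then have "\<forall>x. h x = f x + (b + a) * (int m + 1)"
      using a by (simp add: algebra_simps)
    then show "\<exists>b. \<forall>x. h x = f x + b * (int m + 1)" by blast
  qed
  then show "epicyclic_class m f = epicyclic_class m g"
    by (simp add: epicyclic_class_def)
qed

text \<open>A shift of \<open>f\<close> by a multiple of \<open>m + 1\<close> comes out of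
  \<open>g\<close> as a shift by a multiple of \<open>p + 1\<close>, so elementwise composition
  stays inside one class.\<close>

lemma epicyclic_class_comp:
  assumes g: "epicyclic_map m p g"
  shows "{g' \<circ> f' |g' f'. g' \<in> epicyclic_class p g \<and> f' \<in> epicyclic_class m f} = epicyclic_class p (g \<circ> f)"
    (is "?L = ?R")
proof -
  obtain l where l: "l > 0" "\<And>t. g (t + int m + 1) = g t + l * (int p + 1)"
    "\<And>t q. g (t + q * (int m + 1)) = g t + q * l * (int p + 1)"
    using g by (rule epicyclic_mapE) (rule that)
  have "?L \<subseteq> ?R"
  proof
    fix h assume "h \<in> ?L"
    then obtain g' f' a b where "h = g' \<circ> f'" "\<And>x. g' x = g x + a * (int p + 1)"
      "\<And>x. f' x = f x + b * (int m + 1)"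
      unfolding epicyclic_class_def by blast
    then have "h x = g (f x) + (a + b * l) * (int p + 1)" for x
      using l(3)[of "f x" b] by (simp add: algebra_simps)
    then show "h \<in> ?R"
      by (auto simp: epicyclic_class_def)
  qed
  moreover have "?R \<subseteq> ?L"
  proof
    fix h assume "h \<in> ?R"
    then obtain a where "\<And>x. h x = g (f x) + a * (int p + 1)"
      unfolding epicyclic_class_def by auto
    then have "h = (\<lambda>x. g x + a * (int p + 1)) \<circ> f"
      by auto
    moreover have "(\<lambda>x. g x + a * (int p + 1)) \<in> epicyclic_class p g"
      by (auto simp: epicyclic_class_def)
    ultimately show "h \<in> ?L"
      using epicyclic_class_self by blast
  qed
  ultimately show ?thesis by blast
qed

text \<open>Morphisms from the object \<open>n\<close> to \<open>A\<close>, with \<open>A\<close>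
  seen as a generalised object of the epicyclic category. The group may have no generator, so any
  positive \<open>h\<close> serves as period. Dividing by \<open>translates\<close> gives the
  hom-set.\<close>

definition periodic :: "'a action \<Rightarrow> nat \<Rightarrow> (int \<Rightarrow> 'a) set" where
  "periodic A n = {e. (\<forall>t. e t \<in> Pts A) \<and> (\<forall>s t. s \<le> t \<longrightarrow> Leq A (e s) (e t)) \<and>
     (\<exists>h\<in>Grp A. 0 < h \<and> (\<forall>t. e (t + int n + 1) = Act A h (e t)))}"

definition translates :: "'a action \<Rightarrow> (int \<Rightarrow> 'a) \<Rightarrow> (int \<Rightarrow> 'a) \<Rightarrow> bool" where
  "translates A e e' \<longleftrightarrow> (\<exists>h\<in>Grp A. \<forall>t. e' t = Act A h (e t))"

text \<open>
  The increasing bijections \<open>d\<close> from \<open>\<int>\<close> onto the unions of \<open>p + 1\<close> orbits of \<open>\<delta>\<close> in \<open>Pts A\<close>.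
\<close>

definition enumeration :: "'a action \<Rightarrow> nat \<Rightarrow> rat \<Rightarrow> (int \<Rightarrow> 'a) \<Rightarrow> bool" where
  "enumeration A p \<delta> d \<longleftrightarrow> (\<forall>t. d t \<in> Pts A) \<and> (\<forall>s t. Leq A (d s) (d t) \<longleftrightarrow> s \<le> t) \<and>
     \<delta> \<in> Grp A \<and> 0 < \<delta> \<and> (\<forall>t. d (t + int p + 1) = Act A \<delta> (d t))"

lemma periodic_Pts: "e \<in> periodic A n \<Longrightarrow> e t \<in> Pts A"
  and periodic_mono: "e \<in> periodic A n \<Longrightarrow> s \<le> t \<Longrightarrow> Leq A (e s) (e t)"
  by (auto simp: periodic_def)

lemma enumeration_periodic: "enumeration A p \<delta> d \<Longrightarrow> d \<in> periodic A p"
  by (auto simp: enumeration_def periodic_def)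

lemma div_mod_Suc_int:
  fixes t N :: int
  assumes "N > 0"
  shows "(t + 1) div N = (if t mod N = N - 1 then t div N + 1 else t div N)"
    and "(t + 1) mod N = (if t mod N = N - 1 then 0 else t mod N + 1)"
proof -
  define q r where "q = (if t mod N = N - 1 then t div N + 1 else t div N)"
    and "r = (if t mod N = N - 1 then 0 else t mod N + 1)"
  have "0 \<le> t mod N" "t mod N < N" using assms by auto
  then have "0 \<le> r" "r < N"
    using assms unfolding r_def by auto
  moreover have "t + 1 = N * q + r"
  proof (cases "t mod N = N - 1")
    case True
    have "t + 1 = N * (t div N) + t mod N + 1" by simp
    also have "\<dots> = N * q + r"
      unfolding True by (simp add: q_def r_def True distrib_left)
    finally show ?thesis .
  qed (simp add: q_def r_def)
  ultimately have "(t + 1) div N = q" "(t + 1) mod N = r"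
    using int_div_pos_eq int_mod_pos_eq by blast+
  then show "(t + 1) div N = (if t mod N = N - 1 then t div N + 1 else t div N)"
    "(t + 1) mod N = (if t mod N = N - 1 then 0 else t mod N + 1)"
    by (simp_all add: q_def r_def)
qed

context arch_action
begin

lemma period_shift:
  assumes e: "\<And>t. e t \<in> Pts A" and h: "h \<in> Grp A" and p: "\<And>t. e (t + int n + 1) = Act A h (e t)"
  shows "e (t + q * (int n + 1)) = Act A (of_int q * h) (e t)"
proof (induction q rule: int_induct[where k = 0])
  case base
  then show ?case by (simp add: Act_0 e)
next
  case (step1 i)
  then show ?case
    using p[of "t + i * (int n + 1)"] Act_add[of h "of_int i * h" "e t"] Grp_mult[OF h] h e
    by (simp add: algebra_simps)
next
  case (step2 i)
  \<comment> \<open>Downwards the period is cancelled: both sides agree after acting by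
    \<open>h\<close>, which is injective.\<close>
  have "e (t + i * (int n + 1)) = Act A h (e (t + (i - 1) * (int n + 1)))"
    using p[of "t + (i - 1) * (int n + 1)"] by (simp add: algebra_simps)
  moreover have "Act A (of_int i * h) (e t) = Act A h (Act A (of_int (i - 1) * h) (e t))"
    using Act_add[OF h Grp_mult[OF h, of "i - 1"] e[of t]] by (simp add: algebra_simps)
  ultimately show ?case
    using step2.IH Act_inj[OF h e Act_closed[OF Grp_mult[OF h] e]] by metis
qed

lemma periodicE:
  assumes "e \<in> periodic A n"
  obtains h where "h \<in> Grp A" "0 < h" "\<And>t. e (t + int n + 1) = Act A h (e t)"
    "\<And>t q. e (t + q * (int n + 1)) = Act A (of_int q * h) (e t)"
proof -
  obtain h where h: "h \<in> Grp A" "0 < h" "\<And>t. e (t + int n + 1) = Act A h (e t)"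
    using assms unfolding periodic_def by blast
  show ?thesis
    by (rule that[OF h]) (rule period_shift[of e, OF periodic_Pts[OF assms] h(1) h(3)])
qed

lemma periodic_comp:
  assumes e: "e \<in> periodic A m" and f: "epicyclic_map n m f"
  shows "e \<circ> f \<in> periodic A n"
proof -
  obtain h where h: "h \<in> Grp A" "0 < h" "\<And>t. e (t + int m + 1) = Act A h (e t)"
    "\<And>t q. e (t + q * (int m + 1)) = Act A (of_int q * h) (e t)"
    using e by (rule periodicE) (rule that)
  obtain k where k: "k > 0" "\<And>t. f (t + int n + 1) = f t + k * (int m + 1)"
    "\<And>t q. f (t + q * (int n + 1)) = f t + q * k * (int m + 1)"
    using f by (rule epicyclic_mapE) (rule that)
  have "(e \<circ> f) (t + int n + 1) = Act A (of_int k * h) ((e \<circ> f) t)" for t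
    using k(2)[of t] h(4)[of "f t" k] by simp
  moreover have "of_int k * h \<in> Grp A" "0 < of_int k * h"
    using h(1,2) k(1) Grp_mult by auto
  ultimately show ?thesis
    unfolding periodic_def
    using periodic_Pts[OF e] periodic_mono[OF e] epicyclic_map_mono[OF f] by auto
qed

lemma periodic_Act:
  assumes e: "e \<in> periodic A n" and k: "k \<in> Grp A"
  shows "(\<lambda>t. Act A k (e t)) \<in> periodic A n"
proof -
  obtain h where h: "h \<in> Grp A" "0 < h" "\<And>t. e (t + int n + 1) = Act A h (e t)"
    "\<And>t q. e (t + q * (int n + 1)) = Act A (of_int q * h) (e t)"
    using e by (rule periodicE) (rule that)
  have "Act A k (e (t + int n + 1)) = Act A h (Act A k (e t))" for t
    using h(1,3) k periodic_Pts[OF e] Act_commute by simp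
  then show ?thesis
    unfolding periodic_def
    using periodic_Pts[OF e] periodic_mono[OF e] h(1,2) k Act_closed Act_mono by auto
qed

text \<open>Because the group contains \<int>, every point lies on a copy of the object 0 with
  period 1, which can be enumerated jointly with any other periodic map.\<close>

lemma orbit_periodic:
  assumes x: "x \<in> Pts A"
  shows "(\<lambda>t. Act A (of_int t) x) \<in> periodic A 0"
proof -
  have "of_int t \<in> Grp A" for t
    using Ints_Grp by auto
  then show ?thesis
    unfolding periodic_def
    using Act_closed Act_Leq_Act_iff x Act_add[of 1 "of_int t" x for t] Grp_1
    by (auto intro!: bexI[of _ 1] simp: add.commute)
qed

lemma translates_refl: "(\<And>t. e t \<in> Pts A) \<Longrightarrow> translates A e e"
  unfolding translates_def using Grp_0 Act_0 by (auto intro!: bexI[of _ 0])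

lemma translates_sym: "(\<And>t. e t \<in> Pts A) \<Longrightarrow> translates A e e' \<Longrightarrow> translates A e' e"
  unfolding translates_def using Grp_uminus Act_uminus by metis

lemma translates_trans:
  "(\<And>t. e t \<in> Pts A) \<Longrightarrow> translates A e e' \<Longrightarrow> translates A e' e'' \<Longrightarrow> translates A e e''"
  unfolding translates_def using Grp_add Act_add by metis

section \<open>Enumerations of finitely many orbits\<close>

lemma step_mono:
  assumes d: "\<And>t. d t \<in> Pts A" and step: "\<And>t. Leq A (d t) (d (t + 1))" and st: "s \<le> (t::int)"
  shows "Leq A (d s) (d t)"
  using st
proof (induction t rule: int_ge_induct)
  case base
  then show ?case using d Leq_refl by blast
next
  case (step i)
  then show ?case using d assms(2) Leq_trans by blast
qed

text \<open>Every orbit of \<open>\<delta>\<close> meets the half-open window that begins at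
  \<open>s0\<close> and ends at its translate by \<open>\<delta>\<close>: the first member of the
  orbit that is not below \<open>s0\<close> has not yet reached the upper end. A first one exists
  because the archimedean property bounds the admissible \<open>j\<close> from below.\<close>

lemma exists_first:
  assumes s: "s \<in> Pts A" and s0: "s0 \<in> Pts A" and dl: "\<delta> \<in> Grp A" "0 < \<delta>"
  shows "\<exists>j::int. Leq A s0 (Act A (of_int j * \<delta>) s) \<and> \<not> Leq A (Act A \<delta> s0) (Act A (of_int j * \<delta>) s)"
proof -
  \<comment> \<open>The archimedean property for multiples of \<open>\<delta>\<close>: the element
    of the group is rounded up.\<close>
  have J: "\<exists>J::int. Leq A y (Act A (of_int J * \<delta>) x)" if xy: "x \<in> Pts A" "y \<in> Pts A" for x y
  proof -
    obtain h where h: "h \<in> Grp A" "Leq A y (Act A h x)"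
      using Act_arch[OF xy] by blast
    have "h \<le> of_int \<lceil>h / \<delta>\<rceil> * \<delta>"
      using dl by (simp flip: pos_divide_le_eq)
    then have "Leq A (Act A h x) (Act A (of_int \<lceil>h / \<delta>\<rceil> * \<delta>) x)"
      using Act_Leq_Act_iff h Grp_mult[OF dl(1)] xy by blast
    then show ?thesis
      using h xy Leq_trans Act_closed Grp_mult[OF dl(1)] by meson
  qed
  obtain J M :: int where J: "Leq A s0 (Act A (of_int J * \<delta>) s)" and M: "Leq A s (Act A (of_int M * \<delta>) s0)"
    using J s s0 by metis
  \<comment> \<open>The translate of \<open>s0\<close> by \<open>M\<close> steps lies above
    \<open>s\<close>, so translating \<open>s\<close> by fewer than \<open>- M\<close> steps leaves
    it strictly below \<open>s0\<close>.\<close>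
  have lb: "- M \<le> j" if "Leq A s0 (Act A (of_int j * \<delta>) s)" for j
  proof -
    have "Leq A (Act A (of_int j * \<delta>) s) (Act A (of_int j * \<delta>) (Act A (of_int M * \<delta>) s0))"
      using M s s0 Act_mono Act_closed Grp_mult[OF dl(1)] by blast
    also have "Act A (of_int j * \<delta>) (Act A (of_int M * \<delta>) s0) = Act A (of_int (j + M) * \<delta>) s0"
      using Act_add[OF Grp_mult[OF dl(1), of j] Grp_mult[OF dl(1), of M] s0] by (simp add: algebra_simps)
    finally have "Leq A (Act A 0 s0) (Act A (of_int (j + M) * \<delta>) s0)"
      using that Leq_trans s s0 Act_closed Grp_mult[OF dl(1)] Act_0 by metis
    then have "0 \<le> of_int (j + M) * \<delta>"
      using Act_Leq_Act_iff[OF Grp_0 Grp_mult[OF dl(1)] s0] by blast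
    then show ?thesis
      using dl by (simp add: zero_le_mult_iff flip: of_int_add)
  qed
  \<comment> \<open>Shifted by \<open>M\<close>, the candidates are natural numbers, so there is a
    least one.\<close>
  define P where "P n \<longleftrightarrow> Leq A s0 (Act A (of_int (int n - M) * \<delta>) s)" for n
  have "P (nat (J + M))"
    using J lb[OF J] by (simp add: P_def)
  then have L: "P (LEAST n. P n)" and least: "\<And>n. P n \<Longrightarrow> (LEAST n. P n) \<le> n"
    by (auto intro: LeastI Least_le)
  define j where "j = int (LEAST n. P n) - M"
  have j: "Leq A s0 (Act A (of_int j * \<delta>) s)"
    using L by (simp add: P_def j_def)
  \<comment> \<open>A translate beyond the upper end could be moved back by \<open>\<delta>\<close>,
    against minimality.\<close>
  moreover have "\<not> Leq A (Act A \<delta> s0) (Act A (of_int j * \<delta>) s)"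
  proof
    assume "Leq A (Act A \<delta> s0) (Act A (of_int j * \<delta>) s)"
    moreover have "Act A (of_int j * \<delta>) s = Act A \<delta> (Act A (of_int (j - 1) * \<delta>) s)"
      using Act_add[OF dl(1) Grp_mult[OF dl(1), of "j - 1"] s] by (simp add: algebra_simps)
    ultimately have *: "Leq A s0 (Act A (of_int (j - 1) * \<delta>) s)"
      using Act_Leq_iff[OF dl(1) s0 Act_closed[OF Grp_mult[OF dl(1), of "j - 1"] s]] by simp
    then have "P (nat (j - 1 + M))"
      using lb[OF *] by (simp add: P_def)
    from least[OF this] show False
      using lb[OF *] by (simp add: j_def)
  qed
  ultimately show ?thesis by blast
qed

text \<open>All points are moved into one window of length \<open>\<delta>\<close>. The finite set
  \<open>D\<close> found there is sorted and repeated with period \<open>\<delta>\<close>; its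
  \<open>N\<close> elements give a copy of \<int> with the translation by \<open>N\<close>, hence
  \<open>p = N - 1\<close>.\<close>

lemma exists_enumeration:
  assumes S: "finite S" "S \<noteq> {}" "S \<subseteq> Pts A" and dl: "\<delta> \<in> Grp A" "0 < \<delta>"
  shows "\<exists>p d. enumeration A p \<delta> d \<and> S \<subseteq> range d"
proof -
  obtain s0 where s0: "s0 \<in> S" using S by blast
  have s0P: "s0 \<in> Pts A" using s0 S by blast
  have "\<forall>s\<in>S. \<exists>j::int. Leq A s0 (Act A (of_int j * \<delta>) s) \<and> \<not> Leq A (Act A \<delta> s0) (Act A (of_int j * \<delta>) s)"
    using exists_first s0P dl S by blast
  then obtain j :: "'a \<Rightarrow> int" where
    j: "\<And>s. s \<in> S \<Longrightarrow> Leq A s0 (Act A (of_int (j s) * \<delta>) s)"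
      "\<And>s. s \<in> S \<Longrightarrow> \<not> Leq A (Act A \<delta> s0) (Act A (of_int (j s) * \<delta>) s)"
    by metis
  define y where "y s = Act A (of_int (j s) * \<delta>) s" for s
  define D where "D = y ` S"
  have D: "finite D" "D \<noteq> {}" "D \<subseteq> Pts A"
    using S Act_closed Grp_mult[OF dl(1)] by (auto simp: D_def y_def)
  have D1: "Leq A s0 x" "\<not> Leq A (Act A \<delta> s0) x" if "x \<in> D" for x
    using that j by (auto simp: D_def y_def)
  \<comment> \<open>Points of one window differ by less than \<open>\<delta>\<close>. So the
    smallest of them, moved by \<open>\<delta>\<close>, lies above the largest, and the repetition
    of \<open>D\<close> stays increasing at the end of a block.\<close>
  have D2: "\<not> Leq A (Act A \<delta> x) x'" if "x \<in> D" "x' \<in> D" for x x'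
    using D1[OF that(1)] D1[OF that(2)] that D Leq_trans Act_closed[OF dl(1)] Act_mono[OF dl(1)] s0P
    by (meson subsetD)
  \<comment> \<open>The rank of \<open>x\<close>: in a total order this counts the points of
    \<open>D\<close> strictly below \<open>x\<close>.\<close>
  define r where "r x = card {z \<in> D. \<not> Leq A x z}" for x
  have r_less: "r x < card D" if "x \<in> D" for x
    unfolding r_def using that D Leq_refl by (intro psubset_card_mono) auto
  have r_mono: "r x < r x'" if "x \<in> D" "x' \<in> D" "\<not> Leq A x' x" for x x'
  proof -
    have "{z \<in> D. \<not> Leq A x z} \<subset> {z \<in> D. \<not> Leq A x' z}"
    proof
      show "{z \<in> D. \<not> Leq A x z} \<subseteq> {z \<in> D. \<not> Leq A x' z}"
        using that D Leq_trans Leq_total by (smt (verit) Collect_mono_iff subsetD)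
      show "{z \<in> D. \<not> Leq A x z} \<noteq> {z \<in> D. \<not> Leq A x' z}"
        using that D Leq_refl by blast
    qed
    then show ?thesis
      unfolding r_def using D by (intro psubset_card_mono) auto
  qed
  have r_inj: "inj_on r D"
    using r_mono Leq_antisym D by (metis inj_onI less_irrefl subsetD)
  have r_img: "r ` D = {..<card D}"
    using r_less r_inj by (intro card_subset_eq) (auto simp: card_image)
  define g where "g i = inv_into D r i" for i
  have g: "g i \<in> D" "r (g i) = i" if "i < card D" for i
    using that r_img by (auto simp: g_def inv_into_into f_inv_into_f)
  have gP: "g i \<in> Pts A" if "i < card D" for i
    using g that D by blast
  have gr: "g (r x) = x" if "x \<in> D" for x
    using that r_inj by (simp add: g_def)
  have g_mono: "Leq A (g i) (g k)" if "i < k" "k < card D" for i k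
    using r_mono[of "g k" "g i"] g[of i] g[of k] that by (metis less_asym less_trans)
  have N: "card D > 0"
    using D by (simp add: card_gt_0_iff)
  define N where "N = int (card D)"
  have N0: "N > 0" using N by (simp add: N_def)
  define p where "p = card D - 1"
  have pN: "int p + 1 = N"
    using N by (simp add: p_def N_def)
  \<comment> \<open>The quotient is the number of the window, the remainder the rank inside
    it.\<close>
  define d where "d t = Act A (of_int (t div N) * \<delta>) (g (nat (t mod N)))" for t
  have mN: "nat (t mod N) < card D" for t
    using N0 by (simp add: nat_less_iff N_def)
  have dP: "d t \<in> Pts A" for t
    using mN gP Act_closed Grp_mult[OF dl(1)] by (simp add: d_def)
  have step: "Leq A (d t) (d (t + 1)) \<and> d t \<noteq> d (t + 1)" for t
  proof (cases "t mod N = N - 1")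
    case True
    have *: "d (t + 1) = Act A (of_int (t div N) * \<delta>) (Act A \<delta> (g 0))"
      using True div_mod_Suc_int[OF N0, of t] Act_add[OF Grp_mult[OF dl(1)] dl(1) gP[OF N]]
      by (simp add: d_def algebra_simps)
    have "\<not> Leq A (Act A \<delta> (g 0)) (g (nat (t mod N)))"
      using D2 g mN N by blast
    then show ?thesis
      unfolding * unfolding d_def
      using Leq_total Leq_refl Act_closed[OF dl(1) gP[OF N]] gP[OF mN] Act_mono[OF Grp_mult[OF dl(1)]]
        Act_inj[OF Grp_mult[OF dl(1)]] by metis
  next
    case False
    have "nat ((t + 1) mod N) = nat (t mod N) + 1"
      using False div_mod_Suc_int[OF N0, of t] N0 by (simp add: nat_add_distrib)
    then have "Leq A (g (nat (t mod N))) (g (nat ((t + 1) mod N)))"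
      using g_mono[OF _ mN[of "t + 1"], of "nat (t mod N)"] by simp
    moreover have "g (nat (t mod N)) \<noteq> g (nat ((t + 1) mod N))"
      using g(2)[OF mN[of t]] g(2)[OF mN[of "t + 1"]] \<open>nat ((t + 1) mod N) = nat (t mod N) + 1\<close> by force
    moreover have "(t + 1) div N = t div N"
      using False div_mod_Suc_int[OF N0, of t] by simp
    ultimately show ?thesis
      unfolding d_def using gP[OF mN] Act_mono[OF Grp_mult[OF dl(1)]]
        Act_inj[OF Grp_mult[OF dl(1)]] by metis
  qed
  have mono: "Leq A (d s) (d t)" if "s \<le> t" for s t
    using step_mono[of d s t] dP step that by blast
  have strict: "\<not> Leq A (d t) (d s)" if "s < t" for s t
  proof
    assume a: "Leq A (d t) (d s)"
    have "Leq A (d (s + 1)) (d s)"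
      using Leq_trans[OF dP[of "s + 1"] dP[of t] dP[of s] mono a] that by simp
    then show False
      using step[of s] Leq_antisym dP by blast
  qed
  have "enumeration A p \<delta> d"
    unfolding enumeration_def
  proof (intro conjI allI)
    show "Leq A (d s) (d t) \<longleftrightarrow> s \<le> t" for s t
      by (meson mono strict not_le)
    have "(t + N) div N = t div N + 1" "(t + N) mod N = t mod N" for t
      using N0 by auto
    then show "d (t + int p + 1) = Act A \<delta> (d t)" for t
      using Act_add[OF dl(1) Grp_mult[OF dl(1), of "t div N"] gP[OF mN[of t]]]
      by (simp only: d_def add.assoc pN) (simp add: distrib_right add.commute)
  qed (use dP dl in auto)
  moreover have "S \<subseteq> range d"
  proof
    fix s assume s: "s \<in> S"
    then have ys: "y s \<in> D" by (simp add: D_def)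
    \<comment> \<open>\<open>y s\<close> is \<open>s\<close> moved up by \<open>j s\<close> windows,
      so \<open>s\<close> sits \<open>j s\<close> blocks before the position of \<open>y s\<close>,
      which lies in block 0.\<close>
    let ?t = "int (r (y s)) + (- j s) * N"
    have 1: "?t div N = - j s" "?t mod N = int (r (y s))"
      using N0 r_less[OF ys] by (simp_all only: div_mult_self1 mod_mult_self1) (auto simp: N_def)
    have "d ?t = Act A (- (of_int (j s) * \<delta>)) (y s)"
      unfolding d_def 1 using gr[OF ys] by simp
    also have "\<dots> = s"
      unfolding y_def using Act_uminus Grp_mult[OF dl(1)] s S by blast
    finally show "s \<in> range d" by (metis rangeI)
  qed
  ultimately show ?thesis by blast
qed

text \<open>One fundamental domain in the range of \<open>d\<close> is enough: the period of
  \<open>e\<close> is \<open>k\<close> times that of \<open>d\<close>, so the other values follow.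
  As \<open>d\<close> is strictly increasing, the index map \<open>u\<close> inherits order and
  period from \<open>e\<close>.\<close>

lemma enumeration_factor:
  assumes d: "enumeration A p \<delta> d" and e: "e \<in> periodic A n" and k: "k > 0"
    and per: "\<And>t. e (t + int n + 1) = Act A (of_int k * \<delta>) (e t)"
    and rng: "e ` {0..int n} \<subseteq> range d"
  shows "\<exists>u. epicyclic_map n p u \<and> e = d \<circ> u"
proof -
  have dP: "\<And>t. d t \<in> Pts A" and dl: "\<delta> \<in> Grp A" and dper: "\<And>t. d (t + int p + 1) = Act A \<delta> (d t)"
    and ord: "\<And>s t. Leq A (d s) (d t) \<longleftrightarrow> s \<le> t"
    using d by (auto simp: enumeration_def)
  have dsh: "d (t + q * (int p + 1)) = Act A (of_int q * \<delta>) (d t)" for t q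
    using period_shift[of d, OF dP dl dper] .
  have inj: "d s = d t \<longleftrightarrow> s = t" for s t
    using ord Leq_refl dP by (metis order_antisym order_refl)
  have "e t \<in> range d" for t
  proof -
    let ?r = "t mod (int n + 1)" and ?q = "t div (int n + 1)"
    have "?r \<in> {0..int n}"
      using pos_mod_bound[of "int n + 1" t] by auto
    then obtain s where s: "e ?r = d s"
      using rng by blast
    have "t = ?r + ?q * (int n + 1)"
      by (metis add.commute div_mult_mod_eq)
    then have "e t = Act A (of_int ?q * (of_int k * \<delta>)) (e ?r)"
      using period_shift[of e, OF periodic_Pts[OF e] Grp_mult[OF dl] per, of ?r ?q] by simp
    also have "\<dots> = d (s + (?q * k) * (int p + 1))"
      using dsh[of s "?q * k"] s by (simp add: mult.assoc)
    finally show ?thesis by blast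
  qed
  then have "\<forall>t. \<exists>s. e t = d s" by blast
  then obtain u where "\<forall>t. e t = d (u t)"
    using choice[of "\<lambda>t s. e t = d s"] by blast
  then have u: "\<And>t. e t = d (u t)" by blast
  have "d (u (t + int n + 1)) = d (u t + k * (int p + 1))" for t
    by (simp only: per dsh flip: u)
  then have "u (t + int n + 1) = u t + k * (int p + 1)" for t
    using inj by blast
  moreover have "u s \<le> u t" if "s \<le> t" for s t
    using periodic_mono[OF e that] ord[of "u s" "u t"] by (simp only: u)
  ultimately have "epicyclic_map n p u"
    unfolding epicyclic_map_def mono_def using k by blast
  moreover have "e = d \<circ> u"
    by (rule ext) (simp only: u o_apply)
  ultimately show ?thesis by blast
qed

text \<open>The filteredness arguments on the side of actions rest on this statement. The points of
  both fundamental domains are enumerated with a step that divides both periods and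
  \<open>h\<close>; thereby a translation by \<open>h\<close> appears as a shift of the index by
  \<open>j * (p + 1)\<close>.\<close>

lemma joint_enumeration:
  assumes e1: "e1 \<in> periodic A n1" and e2: "e2 \<in> periodic A n2" and h: "h \<in> Grp A"
  shows "\<exists>p \<delta> d u v j. enumeration A p \<delta> d \<and> epicyclic_map n1 p u \<and> e1 = d \<circ> u \<and>
    epicyclic_map n2 p v \<and> e2 = d \<circ> v \<and> h = of_int j * \<delta>"
proof -
  obtain h1 where h1: "h1 \<in> Grp A" "0 < h1" "\<And>t. e1 (t + int n1 + 1) = Act A h1 (e1 t)"
    "\<And>t q. e1 (t + q * (int n1 + 1)) = Act A (of_int q * h1) (e1 t)"
    using e1 by (rule periodicE) (rule that)
  obtain h2 where h2: "h2 \<in> Grp A" "0 < h2" "\<And>t. e2 (t + int n2 + 1) = Act A h2 (e2 t)"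
    "\<And>t q. e2 (t + q * (int n2 + 1)) = Act A (of_int q * h2) (e2 t)"
    using e2 by (rule periodicE) (rule that)
  \<comment> \<open>A common divisor is taken twice, each time with a positive first argument, since
    \<open>h\<close> may be zero or negative.\<close>
  obtain dl i1 i2 where dl: "dl \<in> Grp A" "0 < dl" "h1 = of_int i1 * dl" "h2 = of_int i2 * dl"
    using common_divisor[OF h1(1) h2(1) h1(2)] by blast
  obtain \<delta> i j where de: "\<delta> \<in> Grp A" "0 < \<delta>" "dl = of_int i * \<delta>" "h = of_int j * \<delta>"
    using common_divisor[OF dl(1) h dl(2)] by blast
  have k1: "h1 = of_int (i1 * i) * \<delta>" and k2: "h2 = of_int (i2 * i) * \<delta>"
    using dl de by simp_all
  have pos: "i1 * i > 0" "i2 * i > 0"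
    using h1(2) h2(2) de(2) unfolding k1 k2 by (simp_all only: zero_less_mult_iff of_int_0_less_iff) auto
  have fin: "finite (e1 ` {0..int n1} \<union> e2 ` {0..int n2})" "e1 ` {0..int n1} \<union> e2 ` {0..int n2} \<noteq> {}"
    "e1 ` {0..int n1} \<union> e2 ` {0..int n2} \<subseteq> Pts A"
    using periodic_Pts e1 e2 by auto
  obtain p d where d: "enumeration A p \<delta> d" "e1 ` {0..int n1} \<union> e2 ` {0..int n2} \<subseteq> range d"
    using exists_enumeration[OF fin de(1,2)] by blast
  have "\<exists>u. epicyclic_map n1 p u \<and> e1 = d \<circ> u"
    by (rule enumeration_factor[OF d(1) e1 pos(1)]) (use h1(3) k1 d(2) in auto)
  moreover have "\<exists>u. epicyclic_map n2 p u \<and> e2 = d \<circ> u"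
    by (rule enumeration_factor[OF d(1) e2 pos(2)]) (use h2(3) k2 d(2) in auto)
  ultimately show ?thesis
    using d(1) de(4) by blast
qed

end

section \<open>Flat functors on the opposite of the epicyclic category\<close>

lemma infinite_arch_action:
  assumes "arch_action (A :: 'u action)"
  shows "infinite (UNIV :: 'u set)"
proof -
  interpret arch_action A by (rule assms)
  obtain x where x: "x \<in> Pts A"
    using Pts_nonempty by blast
  have "of_int t \<in> Grp A" for t
    using Ints_Grp by auto
  then have "inj (\<lambda>t::int. Act A (of_int t) x)"
    using Act_eq_iff[OF _ _ x] by (auto intro!: injI)
  then show ?thesis
    using finite_imageD infinite_UNIV_int finite_subset[OF subset_UNIV] by metis
qed

text \<open>An infinite set is in bijection with its square, so lists fold into single elements.
  Injectivity is claimed for each length separately, so that the empty list may have any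
  code.\<close>

lemma exists_list_code:
  assumes "infinite (UNIV :: 'u set)"
  shows "\<exists>c :: 'u list \<Rightarrow> 'u. \<forall>n. inj_on c {xs. length xs = n}"
proof -
  obtain q :: "'u \<times> 'u \<Rightarrow> 'u" where q: "inj q"
    using card_of_Times_same_infinite[OF assms] card_of_ordIso[of "UNIV \<times> UNIV" UNIV]
    by (auto simp: bij_betw_def)
  define c where "c = (\<lambda>xs :: 'u list. foldr (\<lambda>x y. q (x, y)) xs undefined)"
  have "inj_on c {xs. length xs = n}" for n
  proof (induction n)
    case 0
    then show ?case by (auto simp: inj_on_def)
  next
    case (Suc n)
    show ?case
    proof (rule inj_onI)
      fix xs ys assume "xs \<in> {xs. length xs = Suc n}" "ys \<in> {xs. length xs = Suc n}" and eq: "c xs = c ys"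
      then obtain x xs' y ys' where xy: "xs = x # xs'" "ys = y # ys'" "length xs' = n" "length ys' = n"
        by (auto simp: length_Suc_conv)
      then have "q (x, c xs') = q (y, c ys')"
        using eq by (simp add: c_def)
      then have "x = y" "c xs' = c ys'"
        using q by (auto dest: injD)
      then show "xs = ys"
        using Suc xy by (auto dest: inj_onD)
    qed
  qed
  then show ?thesis by blast
qed

text \<open>Classes are coded through representatives: \<open>SOME\<close> depends only on the
  predicate, and equivalent elements satisfy the same predicate, so they receive the same
  representative.\<close>

lemma exists_quotient_code:
  fixes j :: "'a \<Rightarrow> 'u"
  assumes j: "inj_on j S" and refl: "\<And>s. s \<in> S \<Longrightarrow> E s s"
    and sym: "\<And>s t. s \<in> S \<Longrightarrow> t \<in> S \<Longrightarrow> E s t \<Longrightarrow> E t s"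
    and trans: "\<And>r s t. r \<in> S \<Longrightarrow> s \<in> S \<Longrightarrow> t \<in> S \<Longrightarrow> E r s \<Longrightarrow> E s t \<Longrightarrow> E r t"
  shows "\<exists>q :: 'a \<Rightarrow> 'u. \<forall>s\<in>S. \<forall>t\<in>S. q s = q t \<longleftrightarrow> E s t"
proof -
  define r where "r s = (SOME t. t \<in> S \<and> E s t)" for s
  have r: "r s \<in> S" "E s (r s)" if "s \<in> S" for s
    using someI_ex[of "\<lambda>t. t \<in> S \<and> E s t"] refl[OF that] that by (auto simp: r_def)
  have "j (r s) = j (r t) \<longleftrightarrow> E s t" if "s \<in> S" "t \<in> S" for s t
  proof
    assume "j (r s) = j (r t)"
    then have "r s = r t"
      using inj_onD[OF j] r that by blast
    then show "E s t"
      using r[OF that(1)] r[OF that(2)] sym trans that by metis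
  next
    assume "E s t"
    then have "E s k \<longleftrightarrow> E t k" if "k \<in> S" for k
      using sym[OF \<open>s \<in> S\<close> \<open>t \<in> S\<close>] trans[OF \<open>s \<in> S\<close> \<open>t \<in> S\<close> that]
        trans[OF \<open>t \<in> S\<close> \<open>s \<in> S\<close> that] by blast
    then have "(\<lambda>k. k \<in> S \<and> E s k) = (\<lambda>k. k \<in> S \<and> E t k)"
      by (intro ext) metis
    then show "j (r s) = j (r t)"
      by (simp only: r_def)
  qed
  then show ?thesis by (intro exI[of _ "\<lambda>s. j (r s)"]) simp
qed

text \<open>A functor to \<open>Sets\<close> has subsets of \<open>'u\<close> as values, so
  translation classes need names in \<open>'u\<close>. Any function that separates exactly the
  classes will do.\<close>

definition code :: "'u action \<Rightarrow> nat \<Rightarrow> (int \<Rightarrow> 'u) \<Rightarrow> 'u" where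
  "code A n = (SOME q. \<forall>e\<in>periodic A n. \<forall>e'\<in>periodic A n. q e = q e' \<longleftrightarrow> translates A e e')"

text \<open>A periodic map is determined by its values at 0, ..., \<open>n + 1\<close>: the first
  \<open>n + 1\<close> of them fill a period, and the last one reveals the period by freeness. Hence
  it has a code as a list of fixed length, and its class has one by
  \<open>exists_quotient_code\<close>.\<close>

lemma code_eq_iff:
  fixes A :: "'u action"
  assumes A: "arch_action A" and e: "e \<in> periodic A n" "e' \<in> periodic A n"
  shows "code A n e = code A n e' \<longleftrightarrow> translates A e e'"
proof -
  interpret arch_action A by (rule A)
  obtain c :: "'u list \<Rightarrow> 'u" where c: "\<And>n. inj_on c {xs. length xs = n}"
    using exists_list_code[OF infinite_arch_action[OF A]] by blast
  define vals where "vals e = map (\<lambda>i. e (int i)) [0..<n + 2]" for e :: "int \<Rightarrow> 'u"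
  have "inj_on (c \<circ> vals) (periodic A n)"
  proof (rule inj_onI)
    fix e e' assume e: "e \<in> periodic A n" and e': "e' \<in> periodic A n" and "(c \<circ> vals) e = (c \<circ> vals) e'"
    then have "vals e = vals e'"
      using inj_onD[OF c[of "n + 2"], of "vals e" "vals e'"] by (simp add: vals_def)
    then have eq: "e (int i) = e' (int i)" if "i < n + 2" for i
      using that unfolding vals_def by (simp only: map_eq_conv set_upt) auto
    obtain h where h: "h \<in> Grp A" "0 < h" "\<And>t. e (t + int n + 1) = Act A h (e t)"
      "\<And>t q. e (t + q * (int n + 1)) = Act A (of_int q * h) (e t)"
      using e by (rule periodicE) (rule that)
    obtain h' where h': "h' \<in> Grp A" "0 < h'" "\<And>t. e' (t + int n + 1) = Act A h' (e' t)"
      "\<And>t q. e' (t + q * (int n + 1)) = Act A (of_int q * h') (e' t)"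
      using e' by (rule periodicE) (rule that)
    have "Act A h (e 0) = Act A h' (e 0)"
      using h(3)[of 0] h'(3)[of 0] eq[of 0] eq[of "n + 1"] by (simp add: add.commute)
    then have hh: "h = h'"
      using Act_eq_iff[OF h(1) h'(1) periodic_Pts[OF e]] by blast
    show "e = e'"
    proof
      fix t
      let ?r = "t mod (int n + 1)" and ?q = "t div (int n + 1)"
      have r: "0 \<le> ?r" "?r < int n + 1"
        by (rule pos_mod_sign, simp) (rule pos_mod_bound, simp)
      have t: "t = ?r + ?q * (int n + 1)"
        by (metis add.commute div_mult_mod_eq)
      have "e ?r = e' ?r"
        using eq[of "nat ?r"] r by simp
      then have "e (?r + ?q * (int n + 1)) = e' (?r + ?q * (int n + 1))"
        by (simp only: h(4) h'(4) hh)
      then show "e t = e' t"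
        by (simp only: flip: t)
    qed
  qed
  then have "\<exists>q :: (int \<Rightarrow> 'u) \<Rightarrow> 'u. \<forall>e\<in>periodic A n. \<forall>e'\<in>periodic A n. q e = q e' \<longleftrightarrow> translates A e e'"
    by (rule exists_quotient_code)
      (use translates_refl translates_sym translates_trans periodic_Pts in \<open>blast+\<close>)
  from someI_ex[OF this] show ?thesis
    unfolding code_def using e by blast
qed

section \<open>Set-valued functors in terms of restriction maps\<close>

abbreviation epi_op where "epi_op \<equiv> opposite epicyclic"

text \<open>To be read as precomposition: a map \<open>f\<close> from \<open>m\<close> to
  \<open>n\<close> pulls an element \<open>x\<close> of \<open>F n\<close> back to
  \<open>F m\<close>. This notation absorbs the contravariance of \<open>epi_op\<close>.\<close>

abbreviation restr ::
  "(nat, (int \<Rightarrow> int) set, 'u set, 'u \<Rightarrow> 'u) ftor \<Rightarrow> nat \<Rightarrow> nat \<Rightarrow> (int \<Rightarrow> int) \<Rightarrow> 'u \<Rightarrow> 'u" where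
  "restr F n m f x \<equiv> on_arr F n m (epicyclic_class n f) x"

lemma Ob_epi_op: "Ob epi_op = UNIV"
  by (simp add: opposite_def epicyclic_def)

lemma Hom_epi_op: "Hom epi_op n m = {epicyclic_class n f |f. epicyclic_map m n f}"
  by (simp add: opposite_def epicyclic_def)

lemma Id_epi_op: "Id epi_op n = epicyclic_class n (\<lambda>x. x)"
  by (simp add: opposite_def epicyclic_def)

lemma Comp_epi_op:
  "epicyclic_map m n f \<Longrightarrow>
   Comp epi_op n m p (epicyclic_class m g) (epicyclic_class n f) = epicyclic_class n (f \<circ> g)"
  using epicyclic_class_comp[of m n f g] by (simp add: opposite_def epicyclic_def)

lemma Sets_simps:
  "Ob Sets = UNIV" "Hom Sets S T = (S \<rightarrow>\<^sub>E T)" "Id Sets S = (\<lambda>x\<in>S. x)" "Comp Sets S T U g f = compose S g f"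
  by (simp_all add: Sets_def)

lemma is_ftor_epi_op_iff:
  "is_ftor epi_op Sets F \<longleftrightarrow>
     (\<forall>n m f. epicyclic_map m n f \<longrightarrow> on_arr F n m (epicyclic_class n f) \<in> on_ob F n \<rightarrow>\<^sub>E on_ob F m) \<and>
     (\<forall>n. \<forall>x\<in>on_ob F n. restr F n n (\<lambda>x. x) x = x) \<and>
     (\<forall>n m p f g. epicyclic_map m n f \<longrightarrow> epicyclic_map p m g \<longrightarrow>
        (\<forall>x\<in>on_ob F n. restr F n p (f \<circ> g) x = restr F m p g (restr F n m f x)))"
    (is "?L \<longleftrightarrow> ?R1 \<and> ?R2 \<and> ?R3")
proof
  assume L: ?L
  have 1: ?R1
    using ftor_Hom[OF L] by (auto simp: Ob_epi_op Hom_epi_op Sets_simps)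
  moreover have ?R2
    using ftor_Id[OF L] by (auto simp: Ob_epi_op Id_epi_op Sets_simps)
  moreover have ?R3
  proof (intro allI impI ballI)
    fix n m p f g x assume f: "epicyclic_map m n f" and g: "epicyclic_map p m g" and x: "x \<in> on_ob F n"
    have "on_arr F n p (Comp epi_op n m p (epicyclic_class m g) (epicyclic_class n f)) =
      compose (on_ob F n) (on_arr F m p (epicyclic_class m g)) (on_arr F n m (epicyclic_class n f))"
      using ftor_Comp[OF L, of n m p "epicyclic_class n f" "epicyclic_class m g"] f g
      by (auto simp: Ob_epi_op Hom_epi_op Sets_simps)
    then show "restr F n p (f \<circ> g) x = restr F m p g (restr F n m f x)"
      using x by (simp add: Comp_epi_op[OF f] compose_eq)
  qed
  ultimately show "?R1 \<and> ?R2 \<and> ?R3" by blast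
next
  assume R: "?R1 \<and> ?R2 \<and> ?R3"
  show ?L
    unfolding is_ftor_def
  proof (intro conjI ballI)
    show "on_arr F a b f \<in> Hom Sets (on_ob F a) (on_ob F b)" if "f \<in> Hom epi_op a b" for a b f
      using that R by (auto simp: Hom_epi_op Sets_simps)
    fix a
    have "on_arr F a a (epicyclic_class a (\<lambda>x. x)) \<in> on_ob F a \<rightarrow>\<^sub>E on_ob F a"
      using R epicyclic_map_id by blast
    then show "on_arr F a a (Id epi_op a) = Id Sets (on_ob F a)"
      using R by (auto simp: Id_epi_op Sets_simps fun_eq_iff PiE_def extensional_def)
  next
    fix a b c f g assume "f \<in> Hom epi_op a b" "g \<in> Hom epi_op b c"
    then obtain f' g' where fg: "f = epicyclic_class a f'" "epicyclic_map b a f'"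
      "g = epicyclic_class b g'" "epicyclic_map c b g'"
      by (auto simp: Hom_epi_op)
    have "on_arr F a c (epicyclic_class a (f' \<circ> g')) \<in> on_ob F a \<rightarrow>\<^sub>E on_ob F c"
      using R epicyclic_map_comp fg by blast
    then have "on_arr F a c (epicyclic_class a (f' \<circ> g')) x =
      compose (on_ob F a) (on_arr F b c g) (on_arr F a b f) x" for x
      using R fg by (cases "x \<in> on_ob F a") (auto simp: compose_def PiE_def extensional_def)
    then show "on_arr F a c (Comp epi_op a b c g f) =
        Comp Sets (on_ob F a) (on_ob F b) (on_ob F c) (on_arr F b c g) (on_arr F a b f)"
      using fg by (auto simp: Comp_epi_op Sets_simps)
  qed (auto simp: Sets_simps)
qed

text \<open>A translation from classes to representatives. As \<open>F\<close> is not assumed to be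
  a functor, the third clause carries the membership that makes the common target an object of the
  category of elements.\<close>

lemma cofiltered_elements_iff:
  "cofiltered (elements_category epi_op F) \<longleftrightarrow>
     (\<exists>n. on_ob F n \<noteq> {}) \<and>
     (\<forall>n m. \<forall>x\<in>on_ob F n. \<forall>y\<in>on_ob F m. \<exists>p u v. \<exists>z\<in>on_ob F p.
        epicyclic_map n p u \<and> epicyclic_map m p v \<and> restr F p n u z = x \<and> restr F p m v z = y) \<and>
     (\<forall>n m f g. \<forall>x\<in>on_ob F n. epicyclic_map m n f \<longrightarrow> epicyclic_map m n g \<longrightarrow>
        restr F n m f x = restr F n m g x \<longrightarrow> restr F n m f x \<in> on_ob F m \<longrightarrow>
        (\<exists>p w. \<exists>z\<in>on_ob F p. epicyclic_map n p w \<and> restr F p n w z = x \<and>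
           epicyclic_class p (w \<circ> f) = epicyclic_class p (w \<circ> g)))"
    (is "?L \<longleftrightarrow> ?R1 \<and> ?R2 \<and> ?R3")
proof -
  let ?C = "elements_category epi_op F"
  have Ob: "(n, x) \<in> Ob ?C \<longleftrightarrow> x \<in> on_ob F n" for n x
    by (simp add: elements_category_def Ob_epi_op)
  have Hom: "u \<in> Hom ?C (p, z) (n, x) \<longleftrightarrow>
      (\<exists>f. u = epicyclic_class p f \<and> epicyclic_map n p f \<and> restr F p n f z = x)" for u p z n x
    by (auto simp: elements_category_def Hom_epi_op)
  have Comp: "Comp ?C (p, z) (n, x) (m, y) (epicyclic_class n f) (epicyclic_class p w) = epicyclic_class p (w \<circ> f)"
    if "epicyclic_map n p w" for p z n x m y f w
    using Comp_epi_op[OF that] by (simp add: elements_category_def)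
  have ex: "(\<exists>c\<in>Ob ?C. P c) \<longleftrightarrow> (\<exists>p. \<exists>z\<in>on_ob F p. P (p, z))" for P
    using Ob by auto
  have all: "(\<forall>c\<in>Ob ?C. P c) \<longleftrightarrow> (\<forall>p. \<forall>z\<in>on_ob F p. P (p, z))" for P
    using Ob by auto
  have 1: "Ob ?C \<noteq> {} \<longleftrightarrow> ?R1"
    using Ob by auto
  have 2: "(\<forall>a\<in>Ob ?C. \<forall>b\<in>Ob ?C. \<exists>c\<in>Ob ?C. Hom ?C c a \<noteq> {} \<and> Hom ?C c b \<noteq> {}) \<longleftrightarrow> ?R2"
    unfolding all ex ex_in_conv[symmetric] Hom by blast
  have eq: "(\<exists>c\<in>Ob ?C. \<exists>h\<in>Hom ?C c (n, x). Comp ?C c (n, x) (m, y) (epicyclic_class n f) h =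
        Comp ?C c (n, x) (m, y) (epicyclic_class n g) h) \<longleftrightarrow>
      (\<exists>p w. \<exists>z\<in>on_ob F p. epicyclic_map n p w \<and> restr F p n w z = x \<and>
           epicyclic_class p (w \<circ> f) = epicyclic_class p (w \<circ> g))" for n x m y f g
  proof -
    have *: "(\<exists>h\<in>Hom ?C (p, z) (n, x). Comp ?C (p, z) (n, x) (m, y) (epicyclic_class n f) h =
        Comp ?C (p, z) (n, x) (m, y) (epicyclic_class n g) h) \<longleftrightarrow>
      (\<exists>w. epicyclic_map n p w \<and> restr F p n w z = x \<and>
           epicyclic_class p (w \<circ> f) = epicyclic_class p (w \<circ> g))" for p z
      unfolding Bex_def Hom using Comp by auto
    show ?thesis
      unfolding ex * by blast
  qed
  have 3: "(\<forall>a\<in>Ob ?C. \<forall>b\<in>Ob ?C. \<forall>f\<in>Hom ?C a b. \<forall>g\<in>Hom ?C a b.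
        \<exists>c\<in>Ob ?C. \<exists>h\<in>Hom ?C c a. Comp ?C c a b f h = Comp ?C c a b g h) \<longleftrightarrow> ?R3"
  proof -
    have *: "(\<forall>f\<in>Hom ?C (n, x) (m, y). \<forall>g\<in>Hom ?C (n, x) (m, y). Q f g) \<longleftrightarrow>
      (\<forall>f g. epicyclic_map m n f \<longrightarrow> restr F n m f x = y \<longrightarrow> epicyclic_map m n g \<longrightarrow> restr F n m g x = y \<longrightarrow>
        Q (epicyclic_class n f) (epicyclic_class n g))" for n x m y Q
      unfolding Ball_def Hom by blast
    show ?thesis
      unfolding all * eq by (intro iffI allI ballI impI) (metis, metis)
  qed
  show ?thesis
    unfolding cofiltered_def 1 2 3 ..
qed

section \<open>The flat functor of an archimedean action\<close>

text \<open>This is Hom(n, A), with translation classes replaced by their codes. Elements are codes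
  and arrows are classes, so a representative is chosen on either side;
  \<open>restr_points_ftor\<close> shows that the choices do not matter. The value
  \<open>undefined\<close> is the normalisation demanded by \<open>extensional_ftor\<close>.\<close>

definition points_ftor :: "'u action \<Rightarrow> (nat, (int \<Rightarrow> int) set, 'u set, 'u \<Rightarrow> 'u) ftor" where
  "points_ftor A =
     \<lparr>on_ob = (\<lambda>n. code A n ` periodic A n),
      on_arr = (\<lambda>n m F. if F \<in> Hom epi_op n m
        then (\<lambda>x\<in>code A n ` periodic A n.
          code A m ((SOME e. e \<in> periodic A n \<and> code A n e = x) \<circ> (SOME f. f \<in> F)))
        else undefined)\<rparr>"

definition points_arr :: "'u action \<Rightarrow> 'u action \<Rightarrow> ('u \<Rightarrow> 'u) set \<Rightarrow> nat \<Rightarrow> 'u \<Rightarrow> 'u" where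
  "points_arr A B G = (\<lambda>n. \<lambda>x\<in>code A n ` periodic A n.
     code B n ((SOME g. g \<in> G) \<circ> (SOME e. e \<in> periodic A n \<and> code A n e = x)))"

lemma code_rep:
  assumes "e \<in> periodic A n"
  shows "(SOME e'. e' \<in> periodic A n \<and> code A n e' = code A n e) \<in> periodic A n"
    "code A n (SOME e'. e' \<in> periodic A n \<and> code A n e' = code A n e) = code A n e"
  using someI_ex[of "\<lambda>e'. e' \<in> periodic A n \<and> code A n e' = code A n e"] assms by blast+

lemma on_ob_points_ftor: "on_ob (points_ftor A) n = code A n ` periodic A n"
  by (simp add: points_ftor_def)

text \<open>Two choices are undone. The chosen representative of the element differs from
  \<open>e\<close> by a translation \<open>k\<close>, that of the arrow differs from
  \<open>f\<close> by \<open>a * (n + 1)\<close>, which \<open>e\<close> turns into the translation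
  by \<open>a * h\<close>. The total is a translation and does not change the code.\<close>

lemma restr_points_ftor:
  assumes A: "arch_action A" and e: "e \<in> periodic A n" and f: "epicyclic_map m n f"
  shows "restr (points_ftor A) n m f (code A n e) = code A m (e \<circ> f)"
proof -
  interpret arch_action A by (rule A)
  define e' where "e' = (SOME e'. e' \<in> periodic A n \<and> code A n e' = code A n e)"
  have e': "e' \<in> periodic A n" "code A n e' = code A n e"
    using code_rep[OF e] by (auto simp: e'_def)
  define f' where "f' = (SOME f'. f' \<in> epicyclic_class n f)"
  have "f' \<in> epicyclic_class n f"
    using someI_ex[of "\<lambda>f'. f' \<in> epicyclic_class n f"] epicyclic_class_self by (auto simp: f'_def)
  then obtain a where a: "f' = (\<lambda>x. f x + a * (int n + 1))"
    by (auto simp: epicyclic_class_def)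
  have f'm: "epicyclic_map m n f'"
    unfolding a using epicyclic_map_shift[OF f] .
  obtain k where k: "k \<in> Grp A" "\<And>t. e' t = Act A k (e t)"
    using e' code_eq_iff[OF A e e'(1)] by (auto simp: translates_def)
  obtain h where h: "h \<in> Grp A" "0 < h" "\<And>t. e (t + int n + 1) = Act A h (e t)"
    "\<And>t q. e (t + q * (int n + 1)) = Act A (of_int q * h) (e t)"
    using e by (rule periodicE) (rule that)
  have "(e' \<circ> f') t = Act A (k + of_int a * h) ((e \<circ> f) t)" for t
    using k h(4)[of "f t" a] Act_add[OF k(1) Grp_mult[OF h(1)] periodic_Pts[OF e]] by (simp add: a)
  moreover have "k + of_int a * h \<in> Grp A"
    using k h Grp_add Grp_mult by blast
  ultimately have "translates A (e \<circ> f) (e' \<circ> f')"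
    unfolding translates_def by blast
  then have "code A m (e' \<circ> f') = code A m (e \<circ> f)"
    using code_eq_iff[OF A periodic_comp[OF e f] periodic_comp[OF e'(1) f'm]] by simp
  then show ?thesis
    using f e by (auto simp: points_ftor_def Hom_epi_op e'_def f'_def)
qed

lemma is_ftor_points_ftor:
  assumes A: "arch_action A"
  shows "is_ftor epi_op Sets (points_ftor A)"
  unfolding is_ftor_epi_op_iff
proof (intro conjI allI impI ballI)
  interpret arch_action A by (rule A)
  fix n m f assume f: "epicyclic_map m n f"
  have "restr (points_ftor A) n m f \<in> extensional (code A n ` periodic A n)"
    using f by (auto simp: points_ftor_def Hom_epi_op)
  then show "on_arr (points_ftor A) n m (epicyclic_class n f) \<in>
      on_ob (points_ftor A) n \<rightarrow>\<^sub>E on_ob (points_ftor A) m"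
    using restr_points_ftor[OF A _ f] periodic_comp[OF _ f] by (auto simp: PiE_def on_ob_points_ftor)
next
  interpret arch_action A by (rule A)
  fix n x assume "x \<in> on_ob (points_ftor A) n"
  then show "restr (points_ftor A) n n (\<lambda>x. x) x = x"
    using restr_points_ftor[OF A _ epicyclic_map_id] by (auto simp: on_ob_points_ftor o_def)
next
  interpret arch_action A by (rule A)
  fix n m p f g x assume f: "epicyclic_map m n f" and g: "epicyclic_map p m g"
    and "x \<in> on_ob (points_ftor A) n"
  then show "restr (points_ftor A) n p (f \<circ> g) x =
      restr (points_ftor A) m p g (restr (points_ftor A) n m f x)"
    using restr_points_ftor[OF A] epicyclic_map_comp[OF g f] periodic_comp
    by (auto simp: on_ob_points_ftor o_assoc)
qed

lemma enumeration_inj: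
  assumes "arch_action A" "enumeration A p \<delta> d"
  shows "d s = d t \<longleftrightarrow> s = t"
  using assms arch_action.Leq_refl unfolding enumeration_def by (metis order_antisym order_refl)

text \<open>Both filtering conditions come from \<open>joint_enumeration\<close>. Two elements
  factor through one enumeration \<open>d\<close>. Parallel arrows \<open>f\<close> and
  \<open>g\<close> with the same effect on \<open>e\<close> differ there by a translation
  \<open>h\<close>, and a step dividing \<open>h\<close> makes them equal as classes.\<close>

lemma flat_points_ftor:
  assumes A: "arch_action A"
  shows "flat epi_op (points_ftor A)"
  unfolding flat_def cofiltered_elements_iff
proof (intro conjI allI impI ballI)
  interpret arch_action A by (rule A)
  show "is_ftor epi_op Sets (points_ftor A)"
    using is_ftor_points_ftor[OF A] .
  obtain x where "x \<in> Pts A"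
    using Pts_nonempty by blast
  from orbit_periodic[OF this] show "\<exists>n. on_ob (points_ftor A) n \<noteq> {}"
    by (auto simp: on_ob_points_ftor)
next
  interpret arch_action A by (rule A)
  fix n m x y assume "x \<in> on_ob (points_ftor A) n" "y \<in> on_ob (points_ftor A) m"
  then obtain e e' where e: "e \<in> periodic A n" "x = code A n e" "e' \<in> periodic A m" "y = code A m e'"
    by (auto simp: on_ob_points_ftor)
  \<comment> \<open>No translation has to be resolved here, hence the third argument 0.\<close>
  obtain p \<delta> d u v j where d: "enumeration A p \<delta> d" "epicyclic_map n p u" "e = d \<circ> u"
    "epicyclic_map m p v" "e' = d \<circ> v" "(0::rat) = of_int j * \<delta>"
    using joint_enumeration[OF e(1,3) Grp_0] by metis
  have "restr (points_ftor A) p n u (code A p d) = x" "restr (points_ftor A) p m v (code A p d) = y"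
    using restr_points_ftor[OF A enumeration_periodic[OF d(1)] d(2)]
      restr_points_ftor[OF A enumeration_periodic[OF d(1)] d(4)] e d(3,5) by simp_all
  moreover have "code A p d \<in> on_ob (points_ftor A) p"
    using enumeration_periodic[OF d(1)] by (simp add: on_ob_points_ftor)
  ultimately show "\<exists>p u v. \<exists>z\<in>on_ob (points_ftor A) p. epicyclic_map n p u \<and> epicyclic_map m p v \<and>
      restr (points_ftor A) p n u z = x \<and> restr (points_ftor A) p m v z = y"
    using d(2,4) by blast
next
  interpret arch_action A by (rule A)
  fix n m f g x assume "x \<in> on_ob (points_ftor A) n" and f: "epicyclic_map m n f" and g: "epicyclic_map m n g"
    and eq: "restr (points_ftor A) n m f x = restr (points_ftor A) n m g x"
  then obtain e where e: "e \<in> periodic A n" "x = code A n e"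
    by (auto simp: on_ob_points_ftor)
  have "code A m (e \<circ> f) = code A m (e \<circ> g)"
    using eq restr_points_ftor[OF A e(1)] f g e(2) by simp
  then obtain h where h: "h \<in> Grp A" "\<And>t. e (g t) = Act A h (e (f t))"
    using code_eq_iff[OF A periodic_comp[OF e(1) f] periodic_comp[OF e(1) g]] by (auto simp: translates_def)
  obtain p \<delta> d u v j where d: "enumeration A p \<delta> d" "epicyclic_map n p u" "e = d \<circ> u"
    "epicyclic_map n p v" "e = d \<circ> v" "h = of_int j * \<delta>"
    using joint_enumeration[OF e(1,1) h(1)] by metis
  have dd: "\<And>t. d t \<in> Pts A" "\<delta> \<in> Grp A" "\<And>t. d (t + int p + 1) = Act A \<delta> (d t)"
    using d(1) by (auto simp: enumeration_def)
  \<comment> \<open>The translation of points by \<open>h\<close> has become a shift of indices by a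
    multiple of \<open>p + 1\<close>, and such a shift is invisible in the epicyclic
    category.\<close>
  have "d (u (g t)) = d (u (f t) + j * (int p + 1))" for t
    using h(2)[of t] period_shift[of d, OF dd, of "u (f t)" j] d(6) by (simp add: d(3))
  then have "u (g t) = u (f t) + j * (int p + 1)" for t
    using enumeration_inj[OF A d(1)] by blast
  then have "epicyclic_class p (u \<circ> f) = epicyclic_class p (u \<circ> g)"
    by (auto simp: epicyclic_class_eq_iff)
  moreover have "restr (points_ftor A) p n u (code A p d) = x"
    using restr_points_ftor[OF A enumeration_periodic[OF d(1)] d(2)] e d(3) by simp
  moreover have "code A p d \<in> on_ob (points_ftor A) p"
    using enumeration_periodic[OF d(1)] by (simp add: on_ob_points_ftor)
  ultimately show "\<exists>p w. \<exists>z\<in>on_ob (points_ftor A) p. epicyclic_map n p w \<and> restr (points_ftor A) p n w z = x \<and>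
      epicyclic_class p (w \<circ> f) = epicyclic_class p (w \<circ> g)"
    using d(2) by blast
qed

section \<open>Morphisms of points and functoriality in the action\<close>

lemma Ob_points: "F \<in> Ob (presheaf_topos_points C) \<longleftrightarrow> flat C F \<and> extensional_ftor C F"
  by (auto simp: presheaf_topos_points_def full_subcategory_def functor_category_def flat_def)

lemma Hom_points: "Hom (presheaf_topos_points C) F G = {\<tau>. is_nat_trans C Sets F G \<tau> \<and> \<tau> \<in> extensional (Ob C)}"
  by (simp add: presheaf_topos_points_def full_subcategory_def functor_category_def)

lemma Id_points: "Id (presheaf_topos_points C) F = (\<lambda>a\<in>Ob C. \<lambda>x\<in>on_ob F a. x)"
  by (simp add: presheaf_topos_points_def full_subcategory_def functor_category_def Sets_simps)

lemma Comp_points: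
  "Comp (presheaf_topos_points C) F G H \<tau> \<rho> = (\<lambda>a\<in>Ob C. compose (on_ob F a) (\<tau> a) (\<rho> a))"
  by (simp add: presheaf_topos_points_def full_subcategory_def functor_category_def Sets_simps)

lemma is_nat_trans_epi_op_iff:
  assumes F: "is_ftor epi_op Sets F" and G: "is_ftor epi_op Sets G"
  shows "is_nat_trans epi_op Sets F G \<tau> \<longleftrightarrow> (\<forall>n. \<tau> n \<in> on_ob F n \<rightarrow>\<^sub>E on_ob G n) \<and>
    (\<forall>n m f. epicyclic_map m n f \<longrightarrow> (\<forall>x\<in>on_ob F n. \<tau> m (restr F n m f x) = restr G n m f (\<tau> n x)))"
proof -
  have "compose (on_ob F n) (\<tau> m) (on_arr F n m (epicyclic_class n f)) =
      compose (on_ob F n) (on_arr G n m (epicyclic_class n f)) (\<tau> n) \<longleftrightarrow>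
      (\<forall>x\<in>on_ob F n. \<tau> m (restr F n m f x) = restr G n m f (\<tau> n x))" for n m f
    by (auto simp: compose_def fun_eq_iff restrict_def)
  then show ?thesis
    unfolding is_nat_trans_def Ob_epi_op Sets_simps by (simp add: Hom_epi_op) blast
qed

lemma extensional_points_ftor: "extensional_ftor epi_op (points_ftor A)"
  by (auto simp: extensional_ftor_def Ob_epi_op points_ftor_def)

lemma points_ftor_Ob: "arch_action A \<Longrightarrow> points_ftor A \<in> Ob (presheaf_topos_points epi_op)"
  by (simp add: Ob_points flat_points_ftor extensional_points_ftor)

lemma act_maps_periodic:
  assumes A: "arch_action A" and B: "arch_action B" and g: "g \<in> act_maps A B" and e: "e \<in> periodic A n"
  shows "g \<circ> e \<in> periodic B n"
proof -
  obtain c where c: "c > 0" "\<And>h. h \<in> Grp A \<Longrightarrow> c * h \<in> Grp B"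
    "\<And>h x. h \<in> Grp A \<Longrightarrow> x \<in> Pts A \<Longrightarrow> g (Act A h x) = Act B (c * h) (g x)"
    using act_mapsE[OF g] by blast
  obtain h where h: "h \<in> Grp A" "0 < h" "\<And>t. e (t + int n + 1) = Act A h (e t)"
    "\<And>t q. e (t + q * (int n + 1)) = Act A (of_int q * h) (e t)"
    using e by (rule arch_action.periodicE[OF A]) (rule that)
  have "c * h \<in> Grp B" "0 < c * h" "\<And>t. (g \<circ> e) (t + int n + 1) = Act B (c * h) ((g \<circ> e) t)"
    using c h(1-3) periodic_Pts[OF e] by auto
  then show ?thesis
    unfolding periodic_def
    using act_maps_Pts[OF g] act_maps_mono[OF g] periodic_Pts[OF e] periodic_mono[OF e] by auto
qed

text \<open>As in \<open>restr_points_ftor\<close>, the choices only add a translation: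
  \<open>h\<close> from the class of \<open>g\<close> and \<open>c * k\<close> from the class of
  \<open>e\<close>.\<close>

lemma points_arr_apply:
  assumes A: "arch_action A" and B: "arch_action B" and g: "g \<in> act_maps A B" and e: "e \<in> periodic A n"
  shows "points_arr A B (act_class A B g) n (code A n e) = code B n (g \<circ> e)"
proof -
  interpret A: arch_action A by (rule A)
  interpret B: arch_action B by (rule B)
  obtain c where c: "c > 0" "\<And>h. h \<in> Grp A \<Longrightarrow> c * h \<in> Grp B"
    "\<And>h x. h \<in> Grp A \<Longrightarrow> x \<in> Pts A \<Longrightarrow> g (Act A h x) = Act B (c * h) (g x)"
    using act_mapsE[OF g] by blast
  define e' where "e' = (SOME e'. e' \<in> periodic A n \<and> code A n e' = code A n e)"
  have e': "e' \<in> periodic A n" "code A n e' = code A n e"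
    using code_rep[OF e] by (auto simp: e'_def)
  obtain k where k: "k \<in> Grp A" "\<And>t. e' t = Act A k (e t)"
    using e' code_eq_iff[OF A e e'(1)] by (auto simp: translates_def)
  define g' where "g' = (SOME g'. g' \<in> act_class A B g)"
  have "g' \<in> act_class A B g"
    using someI_ex[of "\<lambda>g'. g' \<in> act_class A B g"] act_class_self[OF B g] by (auto simp: g'_def)
  then obtain h where h: "h \<in> Grp B" "g' = (\<lambda>x\<in>Pts A. Act B h (g x))"
    by (auto simp: act_class_def)
  have g'm: "g' \<in> act_maps A B"
    unfolding h(2) using act_maps_Act[OF B A g h(1)] .
  have "(g' \<circ> e') t = Act B (h + c * k) ((g \<circ> e) t)" for t
    using k c h periodic_Pts[OF e] A.Act_closed B.Act_add act_maps_Pts[OF g] by simp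
  moreover have "h + c * k \<in> Grp B"
    using k h c B.Grp_add by blast
  ultimately have "translates B (g \<circ> e) (g' \<circ> e')"
    unfolding translates_def by blast
  then have "code B n (g' \<circ> e') = code B n (g \<circ> e)"
    using code_eq_iff[OF B act_maps_periodic[OF A B g e] act_maps_periodic[OF A B g'm e'(1)]] by simp
  then show ?thesis
    using e by (simp add: points_arr_def g'_def e'_def)
qed

lemma points_arr_Hom:
  assumes A: "arch_action A" and B: "arch_action B" and G: "G \<in> Hom arch_actions A B"
  shows "points_arr A B G \<in> Hom (presheaf_topos_points epi_op) (points_ftor A) (points_ftor B)"
proof -
  interpret A: arch_action A by (rule A)
  obtain g where g: "g \<in> act_maps A B" "G = act_class A B g"
    using G by (rule arch_actions_HomE)
  note * = points_arr_apply[OF A B g(1), folded g(2)] act_maps_periodic[OF A B g(1)]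
  have "points_arr A B G n \<in> extensional (code A n ` periodic A n)" for n
    by (simp add: points_arr_def)
  then have 1: "points_arr A B G n \<in> on_ob (points_ftor A) n \<rightarrow>\<^sub>E on_ob (points_ftor B) n" for n
    using * by (auto simp: PiE_def on_ob_points_ftor)
  have 2: "points_arr A B G m (restr (points_ftor A) n m f x) = restr (points_ftor B) n m f (points_arr A B G n x)"
    if f: "epicyclic_map m n f" and x: "x \<in> on_ob (points_ftor A) n" for n m f x
  proof -
    obtain e where e: "e \<in> periodic A n" "x = code A n e"
      using x by (auto simp: on_ob_points_ftor)
    show ?thesis
      using e * f restr_points_ftor[OF A e(1) f] restr_points_ftor[OF B _ f] A.periodic_comp[OF e(1) f]
      by (simp add: comp_assoc)
  qed
  show ?thesis
    using 1 2 by (simp add: Hom_points Ob_epi_op is_nat_trans_epi_op_iff is_ftor_points_ftor A B)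
qed

definition points_functor ::
  "('u action, ('u \<Rightarrow> 'u) set, (nat, (int \<Rightarrow> int) set, 'u set, 'u \<Rightarrow> 'u) ftor, nat \<Rightarrow> 'u \<Rightarrow> 'u) ftor" where
  "points_functor = \<lparr>on_ob = points_ftor, on_arr = points_arr\<rparr>"

lemma is_ftor_points_functor: "is_ftor arch_actions (presheaf_topos_points epi_op) points_functor"
  unfolding is_ftor_def
proof (intro conjI ballI)
  fix A :: "'a action" assume "A \<in> Ob arch_actions"
  then have A: "arch_action A" by (simp add: Ob_arch_actions)
  show "on_ob points_functor A \<in> Ob (presheaf_topos_points epi_op)"
    using points_ftor_Ob[OF A] by (simp add: points_functor_def)
  have "points_arr A A (act_class A A (\<lambda>x\<in>Pts A. x)) n = (\<lambda>x\<in>on_ob (points_ftor A) n. x)" for n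
  proof
    fix x
    show "points_arr A A (act_class A A (\<lambda>x\<in>Pts A. x)) n x = (\<lambda>x\<in>on_ob (points_ftor A) n. x) x"
    proof (cases "x \<in> on_ob (points_ftor A) n")
      case True
      then obtain e where e: "e \<in> periodic A n" "x = code A n e"
        by (auto simp: on_ob_points_ftor)
      have "(\<lambda>x\<in>Pts A. x) \<circ> e = e"
        using periodic_Pts[OF e(1)] by auto
      then show ?thesis
        using points_arr_apply[OF A A act_maps_id[OF A] e(1)] e by (simp add: on_ob_points_ftor)
    qed (auto simp: points_arr_def on_ob_points_ftor)
  qed
  then show "on_arr points_functor A A (Id arch_actions A) = Id (presheaf_topos_points epi_op) (on_ob points_functor A)"
    by (simp add: points_functor_def Id_arch_actions Id_points Ob_epi_op fun_eq_iff)
next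
  fix A B :: "'a action" and F assume "A \<in> Ob arch_actions" "B \<in> Ob arch_actions" "F \<in> Hom arch_actions A B"
  then show "on_arr points_functor A B F \<in>
      Hom (presheaf_topos_points epi_op) (on_ob points_functor A) (on_ob points_functor B)"
    using points_arr_Hom by (simp add: points_functor_def Ob_arch_actions)
next
  fix A B C :: "'a action" and F G
  assume "A \<in> Ob arch_actions" "B \<in> Ob arch_actions" "C \<in> Ob arch_actions"
    and FG: "F \<in> Hom arch_actions A B" "G \<in> Hom arch_actions B C"
  then have A: "arch_action A" and B: "arch_action B" and C: "arch_action C"
    by (auto simp: Ob_arch_actions)
  obtain f where f: "f \<in> act_maps A B" "F = act_class A B f"
    using FG(1) by (rule arch_actions_HomE)
  obtain g where g: "g \<in> act_maps B C" "G = act_class B C g"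
    using FG(2) by (rule arch_actions_HomE)
  have "points_arr A C (act_class A C (compose (Pts A) g f)) n x =
      compose (on_ob (points_ftor A) n) (points_arr B C G n) (points_arr A B F n) x" for n x
  proof (cases "x \<in> on_ob (points_ftor A) n")
    case True
    then obtain e where e: "e \<in> periodic A n" "x = code A n e"
      by (auto simp: on_ob_points_ftor)
    have "compose (Pts A) g f \<circ> e = g \<circ> (f \<circ> e)"
      using periodic_Pts[OF e(1)] by (auto simp: compose_def)
    then show ?thesis
      using points_arr_apply[OF A C act_maps_compose[OF A f(1) g(1)] e(1)]
        points_arr_apply[OF A B f(1) e(1)] points_arr_apply[OF B C g(1) act_maps_periodic[OF A B f(1) e(1)]]
        True e f(2) g(2)
      by (simp add: compose_eq)
  qed (auto simp: points_arr_def on_ob_points_ftor compose_def)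
  then show "on_arr points_functor A C (Comp arch_actions A B C G F) =
      Comp (presheaf_topos_points epi_op) (on_ob points_functor A) (on_ob points_functor B)
       (on_ob points_functor C) (on_arr points_functor B C G) (on_arr points_functor A B F)"
    using arch_actions_Comp[OF A B C f(1) g(1)] f(2) g(2)
    by (auto simp: points_functor_def Comp_points Ob_epi_op fun_eq_iff)
qed

text \<open>For each periodic map \<open>e\<close>, equality of codes gives a translation from
  \<open>g \<circ> e\<close> to \<open>g' \<circ> e\<close>, which may depend on \<open>e\<close>.
  Enumerating the base orbit jointly with the orbit of \<open>x\<close> makes the translations
  comparable at \<open>g x0\<close>, and freeness makes them equal.\<close>

lemma points_faithful:
  assumes A: "arch_action A" and B: "arch_action B" and G: "G \<in> Hom arch_actions A B"
    and G': "G' \<in> Hom arch_actions A B" and eq: "points_arr A B G = points_arr A B G'"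
  shows "G = G'"
proof -
  interpret A: arch_action A by (rule A)
  interpret B: arch_action B by (rule B)
  obtain g where g: "g \<in> act_maps A B" "G = act_class A B g"
    using G by (rule arch_actions_HomE)
  obtain g' where g': "g' \<in> act_maps A B" "G' = act_class A B g'"
    using G' by (rule arch_actions_HomE)
  have tr: "\<exists>h\<in>Grp B. \<forall>t. g' (e t) = Act B h (g (e t))" if "e \<in> periodic A n" for e n
  proof -
    have "code B n (g \<circ> e) = code B n (g' \<circ> e)"
      using eq points_arr_apply[OF A B g(1) that] points_arr_apply[OF A B g'(1) that] g g' by metis
    then show ?thesis
      using code_eq_iff[OF B act_maps_periodic[OF A B g(1) that] act_maps_periodic[OF A B g'(1) that]]
      by (simp add: translates_def)
  qed
  obtain x0 where x0: "x0 \<in> Pts A"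
    using A.Pts_nonempty by blast
  have e0: "(\<lambda>t. Act A (of_int t) x0) \<in> periodic A 0"
    using A.orbit_periodic[OF x0] .
  obtain h where h: "h \<in> Grp B" "\<And>t. g' (Act A (of_int t) x0) = Act B h (g (Act A (of_int t) x0))"
    using tr[OF e0] by blast
  have gx0: "g' x0 = Act B h (g x0)"
    using h(2)[of 0] A.Act_0[OF x0] by simp
  have "g' x = Act B h (g x)" if x: "x \<in> Pts A" for x
  proof -
    obtain p \<delta> d u v j where d: "enumeration A p \<delta> d" "epicyclic_map 0 p u" "(\<lambda>t. Act A (of_int t) x0) = d \<circ> u"
      "epicyclic_map 0 p v" "(\<lambda>t. Act A (of_int t) x) = d \<circ> v" "(0::rat) = of_int j * \<delta>"
      using A.joint_enumeration[OF e0 A.orbit_periodic[OF x] A.Grp_0] by metis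
    have dx0: "d (u 0) = x0" and dx: "d (v 0) = x"
      using fun_cong[OF d(3), of 0] fun_cong[OF d(5), of 0] A.Act_0 x0 x by auto
    obtain k where k: "k \<in> Grp B" "\<And>t. g' (d t) = Act B k (g (d t))"
      using tr[OF enumeration_periodic[OF d(1)]] by blast
    have "Act B k (g x0) = Act B h (g x0)"
      using k(2)[of "u 0"] gx0 dx0 by simp
    then have "k = h"
      using B.Act_eq_iff[OF k(1) h(1)] act_maps_Pts[OF g(1) x0] by blast
    then show ?thesis
      using k(2)[of "v 0"] dx by simp
  qed
  then show ?thesis
    using act_class_eqI[OF B g(1) h(1), of g'] g(2) g'(2) by simp
qed

section \<open>Fullness: from natural transformations to maps of actions\<close>

text \<open>
  A morphism is recovered from a natural transformation \<open>\<tau>\<close> on periodic maps through a fixed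
  orbit: the lift \<open>e'\<close> of \<open>\<tau> (code e)\<close> with prescribed restriction to this orbit is unique,
  because the action is free.
\<close>

locale points_transformation =
  A: arch_action A + B: arch_action B for A B :: "'u action" +
  fixes \<tau> :: "nat \<Rightarrow> 'u \<Rightarrow> 'u" and e0 e0' :: "int \<Rightarrow> 'u"
  assumes \<tau>_closed: "e \<in> periodic A n \<Longrightarrow> \<tau> n (code A n e) \<in> code B n ` periodic B n"
    and \<tau>_natural: "e \<in> periodic A n \<Longrightarrow> epicyclic_map m n f \<Longrightarrow>
      \<tau> m (code A m (e \<circ> f)) = restr (points_ftor B) n m f (\<tau> n (code A n e))"
    and e0: "e0 \<in> periodic A 0" "\<And>t. e0 (t + 1) = Act A 1 (e0 t)"
    and e0': "e0' \<in> periodic B 0" "\<tau> 0 (code A 0 e0) = code B 0 e0'"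
begin

definition lift :: "nat \<Rightarrow> (int \<Rightarrow> 'u) \<Rightarrow> (int \<Rightarrow> int) \<Rightarrow> (int \<Rightarrow> 'u) \<Rightarrow> bool" where
  "lift n e f e' \<longleftrightarrow> e \<in> periodic A n \<and> epicyclic_map 0 n f \<and> e \<circ> f = e0 \<and>
     e' \<in> periodic B n \<and> \<tau> n (code A n e) = code B n e' \<and> e' \<circ> f = e0'"

text \<open>By naturality, any representative of \<open>\<tau> n (code A n e)\<close> restricts
  along \<open>f\<close> to a translate of \<open>e0'\<close>. Moving it by that translation makes
  the restriction exact.\<close>

lemma exists_lift:
  assumes e: "e \<in> periodic A n" and f: "epicyclic_map 0 n f" "e \<circ> f = e0"
  shows "\<exists>e'. lift n e f e'"
proof -
  obtain e'' where e'': "e'' \<in> periodic B n" "\<tau> n (code A n e) = code B n e''"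
    using \<tau>_closed[OF e] by blast
  have "code B 0 (e'' \<circ> f) = code B 0 e0'"
    using \<tau>_natural[OF e f(1)] f(2) e0'(2) e''(2)
      restr_points_ftor[OF B.arch_action_axioms e''(1) f(1)] by simp
  then have "translates B (e'' \<circ> f) e0'"
    using code_eq_iff[OF B.arch_action_axioms B.periodic_comp[OF e''(1) f(1)] e0'(1)] by blast
  then obtain h where h: "h \<in> Grp B" "\<And>t. e0' t = Act B h (e'' (f t))"
    by (auto simp: translates_def)
  define e' where "e' = (\<lambda>t. Act B h (e'' t))"
  have e': "e' \<in> periodic B n"
    using B.periodic_Act[OF e''(1) h(1)] by (simp add: e'_def)
  have "translates B e'' e'"
    using h(1) by (auto simp: translates_def e'_def)
  then have "\<tau> n (code A n e) = code B n e'"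
    using code_eq_iff[OF B.arch_action_axioms e''(1) e'] e''(2) by simp
  moreover have "e' \<circ> f = e0'"
    using h(2) by (auto simp: e'_def)
  ultimately show ?thesis
    using e f e' by (auto simp: lift_def)
qed

lemma lift_comp:
  assumes l: "lift p d (u \<circ> f) d'" and u: "epicyclic_map n p u" and f: "epicyclic_map 0 n f"
  shows "lift n (d \<circ> u) f (d' \<circ> u)"
proof -
  have d: "d \<in> periodic A p" "d' \<in> periodic B p" "\<tau> p (code A p d) = code B p d'"
    "d \<circ> (u \<circ> f) = e0" "d' \<circ> (u \<circ> f) = e0'"
    using l by (auto simp: lift_def)
  have "\<tau> n (code A n (d \<circ> u)) = code B n (d' \<circ> u)"
    using \<tau>_natural[OF d(1) u] d(3) restr_points_ftor[OF B.arch_action_axioms d(2) u] by simp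
  then show ?thesis
    using d u f A.periodic_comp[OF d(1) u] B.periodic_comp[OF d(2) u] by (simp add: lift_def comp_assoc)
qed

lemma lift_unique:
  assumes "lift n e f e'" "lift n e f e''"
  shows "e' = e''"
proof -
  have e': "e' \<in> periodic B n" "e'' \<in> periodic B n" "code B n e' = code B n e''" "e' \<circ> f = e'' \<circ> f"
    using assms by (auto simp: lift_def)
  obtain h where h: "h \<in> Grp B" "\<And>t. e'' t = Act B h (e' t)"
    using code_eq_iff[OF B.arch_action_axioms e'(1,2)] e'(3) by (auto simp: translates_def)
  have "Act B h (e' (f 0)) = Act B 0 (e' (f 0))"
    using h(2)[of "f 0"] fun_cong[OF e'(4), of 0] B.Act_0 periodic_Pts[OF e'(1)] by simp
  then have "h = 0"
    using B.Act_eq_iff[OF h(1) B.Grp_0 periodic_Pts[OF e'(1)]] by blast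
  then show ?thesis
    using h(2) B.Act_0 periodic_Pts[OF e'(1)] by (auto simp: fun_eq_iff)
qed

text \<open>\<open>e\<close> and \<open>g\<close> factor through one enumeration \<open>d\<close>.
  Both contain the base orbit and \<open>d\<close> is injective, so the two resulting maps from the
  object 0 into \<open>d\<close> coincide. A single lift of \<open>d\<close> then restricts to both
  given lifts, by uniqueness.\<close>

lemma joint_lift:
  assumes l1: "lift n e f e'" and l2: "lift m g k g'" and h: "h \<in> Grp A"
  shows "\<exists>p \<delta> d u v j d'. enumeration A p \<delta> d \<and> e = d \<circ> u \<and> g = d \<circ> v \<and> e' = d' \<circ> u \<and> g' = d' \<circ> v \<and>
    lift p d (u \<circ> f) d' \<and> h = of_int j * \<delta>"
proof -
  have l: "e \<in> periodic A n" "g \<in> periodic A m" "epicyclic_map 0 n f" "epicyclic_map 0 m k"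
    "e \<circ> f = e0" "g \<circ> k = e0"
    using l1 l2 by (auto simp: lift_def)
  obtain p \<delta> d u v j where d: "enumeration A p \<delta> d" "epicyclic_map n p u" "e = d \<circ> u"
    "epicyclic_map m p v" "g = d \<circ> v" "h = of_int j * \<delta>"
    using A.joint_enumeration[OF l(1,2) h] by metis
  have "d (u (f t)) = d (v (k t))" for t
    using l(5,6) d(3,5) by (metis comp_apply)
  then have uv: "u \<circ> f = v \<circ> k"
    using enumeration_inj[OF A.arch_action_axioms d(1)] by auto
  obtain d' where d': "lift p d (u \<circ> f) d'"
    using exists_lift[OF enumeration_periodic[OF d(1)] epicyclic_map_comp[OF l(3) d(2)]] l(5) d(3)
    by (auto simp: comp_assoc)
  have "e' = d' \<circ> u"
    using lift_unique[OF l1] lift_comp[OF d' d(2) l(3)] d(3) by blast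
  moreover have "g' = d' \<circ> v"
    using lift_unique[OF l2] lift_comp[OF d'[unfolded uv] d(4) l(4)] d(5) by blast
  ultimately show ?thesis
    using d d' by blast
qed

definition pmap :: "'u \<Rightarrow> 'u" where
  "pmap = (\<lambda>x\<in>Pts A. SOME y. \<exists>n e f e' i. lift n e f e' \<and> e i = x \<and> e' i = y)"

lemma exists_lift_point:
  assumes x: "x \<in> Pts A"
  shows "\<exists>n e f e' i. lift n e f e' \<and> e i = x"
proof -
  obtain p \<delta> d u v j where d: "enumeration A p \<delta> d" "epicyclic_map 0 p u" "e0 = d \<circ> u"
    "epicyclic_map 0 p v" "(\<lambda>t. Act A (of_int t) x) = d \<circ> v" "(0::rat) = of_int j * \<delta>"
    using A.joint_enumeration[OF e0(1) A.orbit_periodic[OF x] A.Grp_0] by metis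
  have "d (v 0) = x"
    using fun_cong[OF d(5), of 0] A.Act_0[OF x] by simp
  moreover obtain d' where "lift p d u d'"
    using exists_lift[OF enumeration_periodic[OF d(1)] d(2)] d(3) by blast
  ultimately show ?thesis by blast
qed

text \<open>The value does not depend on the lift: two lifts through the same point factor through a
  common \<open>d\<close>, in which the point has only one index.\<close>

lemma pmap_lift:
  assumes l: "lift n e f e'"
  shows "pmap (e i) = e' i"
proof -
  have *: "g' k = e' i" if l2: "lift m g q g'" "g k = e i" for m g q g' k
  proof -
    obtain p \<delta> d u v j d' where d: "enumeration A p \<delta> d" "e = d \<circ> u" "g = d \<circ> v" "e' = d' \<circ> u" "g' = d' \<circ> v"
      using joint_lift[OF l l2(1) A.Grp_0] by blast
    have "v k = u i"
      using l2(2) d(2,3) enumeration_inj[OF A.arch_action_axioms d(1)] by simp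
    then show ?thesis
      using d(4,5) by simp
  qed
  have "e i \<in> Pts A"
    using l periodic_Pts by (auto simp: lift_def)
  moreover have "(SOME y. \<exists>m g q g' k. lift m g q g' \<and> g k = e i \<and> g' k = y) = e' i"
    by (rule some_equality) (use l * in blast)+
  ultimately show ?thesis
    by (simp add: pmap_def)
qed

lemma pmap_act_maps: "pmap \<in> act_maps A B"
proof -
  have pt: "pmap x \<in> Pts B" if "x \<in> Pts A" for x
  proof -
    obtain n e f e' i where l: "lift n e f e'" "e i = x"
      using exists_lift_point[OF \<open>x \<in> Pts A\<close>] by blast
    then show ?thesis
      using pmap_lift[OF l(1), of i] periodic_Pts by (auto simp: lift_def)
  qed
  have mono: "Leq B (pmap x) (pmap y)" if "x \<in> Pts A" "y \<in> Pts A" "Leq A x y" for x y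
  proof -
    obtain n e f e' i where l: "lift n e f e'" "e i = x"
      using exists_lift_point[OF \<open>x \<in> Pts A\<close>] by blast
    obtain m g q g' k where l2: "lift m g q g'" "g k = y"
      using exists_lift_point[OF \<open>y \<in> Pts A\<close>] by blast
    obtain p \<delta> d u v j d' where d: "enumeration A p \<delta> d" "e = d \<circ> u" "g = d \<circ> v" "lift p d (u \<circ> f) d'"
      using joint_lift[OF l(1) l2(1) A.Grp_0] by blast
    have xy: "x = d (u i)" "y = d (v k)"
      using l l2 d by auto
    then have "u i \<le> v k"
      using d(1) \<open>Leq A x y\<close> by (simp add: enumeration_def)
    moreover have "d' \<in> periodic B p"
      using d(4) by (simp add: lift_def)
    ultimately show ?thesis
      unfolding xy pmap_lift[OF d(4)] by (intro periodic_mono)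
  qed
  \<comment> \<open>The scaling factor is the period of \<open>e0'\<close>, because
    \<open>e0\<close> has period 1.\<close>
  obtain c where c: "c \<in> Grp B" "0 < c" "\<And>t. e0' (t + int 0 + 1) = Act B c (e0' t)"
    "\<And>t q. e0' (t + q * (int 0 + 1)) = Act B (of_int q * c) (e0' t)"
    using e0'(1) by (rule B.periodicE) (rule that)
  have sc: "c * h \<in> Grp B \<and> pmap (Act A h x) = Act B (c * h) (pmap x)"
    if h: "h \<in> Grp A" and x: "x \<in> Pts A" for h x
  proof -
    obtain n e f e' i where l: "lift n e f e'" "e i = x"
      using exists_lift_point[OF x] by blast
    \<comment> \<open>Joining the lift with itself makes \<open>h\<close> a multiple of the step
      \<open>\<delta>\<close>.\<close>
    obtain p \<delta> d u v j d' where d: "enumeration A p \<delta> d" "e = d \<circ> u" "lift p d (u \<circ> f) d'" "h = of_int j * \<delta>"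
      using joint_lift[OF l(1) l(1) h] by blast
    have dd: "\<And>t. d t \<in> Pts A" "\<delta> \<in> Grp A" "\<And>t. d (t + int p + 1) = Act A \<delta> (d t)"
      using d(1) by (auto simp: enumeration_def)
    note dsh = A.period_shift[of d, OF dd]
    have d': "d' \<in> periodic B p" "d \<circ> (u \<circ> f) = e0" "d' \<circ> (u \<circ> f) = e0'" and uf: "epicyclic_map 0 p (u \<circ> f)"
      using d(3) by (auto simp: lift_def)
    obtain \<epsilon> where ep: "\<epsilon> \<in> Grp B" "0 < \<epsilon>" "\<And>t. d' (t + int p + 1) = Act B \<epsilon> (d' t)"
      "\<And>t q. d' (t + q * (int p + 1)) = Act B (of_int q * \<epsilon>) (d' t)"
      using d'(1) by (rule B.periodicE) (rule that)
    define s where "s = u \<circ> f"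
    obtain k where k: "k > 0" "\<And>t. s (t + int 0 + 1) = s t + k * (int p + 1)"
      "\<And>t q. s (t + q * (int 0 + 1)) = s t + q * k * (int p + 1)"
      using uf[folded s_def] by (rule epicyclic_mapE) (rule that)
    \<comment> \<open>The base orbit advances by \<open>k\<close> periods of \<open>d\<close> at
      each step. So \<open>k * \<delta>\<close> equals 1 and \<open>k * \<epsilon>\<close> equals
      \<open>c\<close>; in other words \<open>\<epsilon>\<close> is \<open>c\<close> times
      \<open>\<delta>\<close>.\<close>
    have "Act A (of_int k * \<delta>) (e0 0) = Act A 1 (e0 0)"
      using fun_cong[OF d'(2), of 0] fun_cong[OF d'(2), of 1] k(2)[of 0] dsh[of "s 0" k] e0(2)[of 0]
      by (simp add: s_def)
    then have 1: "of_int k * \<delta> = 1"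
      using A.Act_eq_iff[OF A.Grp_mult[OF dd(2)] A.Grp_1 periodic_Pts[OF e0(1)]] by blast
    have "Act B (of_int k * \<epsilon>) (e0' 0) = Act B c (e0' 0)"
      using fun_cong[OF d'(3), of 0] fun_cong[OF d'(3), of 1] k(2)[of 0] ep(4)[of "s 0" k] c(3)[of 0]
      by (simp add: s_def)
    then have "of_int k * \<epsilon> = c"
      using B.Act_eq_iff[OF B.Grp_mult[OF ep(1)] c(1) periodic_Pts[OF e0'(1)]] by blast
    then have "c * h = of_int j * (of_int k * \<delta>) * \<epsilon>"
      unfolding d(4) by (simp add: algebra_simps)
    then have ch: "c * h = of_int j * \<epsilon>"
      using 1 by simp
    have x': "x = d (u i)"
      using l(2) d(2) by simp
    have "Act A h x = d (u i + j * (int p + 1))"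
      unfolding x' d(4) dsh ..
    then have "pmap (Act A h x) = d' (u i + j * (int p + 1))"
      using pmap_lift[OF d(3)] by simp
    also have "\<dots> = Act B (c * h) (pmap x)"
      unfolding ep(4) ch x' pmap_lift[OF d(3)] ..
    finally show ?thesis
      using ch B.Grp_mult[OF ep(1)] by simp
  qed
  have "\<forall>h\<in>Grp A. c * h \<in> Grp B \<and> (\<forall>x\<in>Pts A. pmap (Act A h x) = Act B (c * h) (pmap x))"
    using sc A.Pts_nonempty by blast
  moreover have "pmap \<in> extensional (Pts A)"
    by (simp add: pmap_def)
  ultimately show ?thesis
    using pt mono c(2) by (auto simp: act_maps_def PiE_def)
qed

text \<open>The base orbit need not factor through \<open>e\<close>, so \<open>e\<close> may have no
  lift of its own. It is a restriction of an enumeration \<open>d\<close> that also contains the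
  base orbit, and naturality carries the claim from \<open>d\<close> to \<open>e\<close>.\<close>

lemma code_pmap:
  assumes e: "e \<in> periodic A n"
  shows "\<tau> n (code A n e) = code B n (pmap \<circ> e)"
proof -
  obtain p \<delta> d u v j where d: "enumeration A p \<delta> d" "epicyclic_map 0 p u" "e0 = d \<circ> u"
    "epicyclic_map n p v" "e = d \<circ> v" "(0::rat) = of_int j * \<delta>"
    using A.joint_enumeration[OF e0(1) e A.Grp_0] by metis
  obtain d' where l: "lift p d u d'"
    using exists_lift[OF enumeration_periodic[OF d(1)] d(2)] d(3) by blast
  then have d': "d \<in> periodic A p" "d' \<in> periodic B p" "\<tau> p (code A p d) = code B p d'"
    by (auto simp: lift_def)
  have "pmap \<circ> e = d' \<circ> v"
    using pmap_lift[OF l] d(5) by auto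
  then show ?thesis
    using \<tau>_natural[OF d'(1) d(4)] restr_points_ftor[OF B.arch_action_axioms d'(2) d(4)] d'(3) d(5) by simp
qed

end

lemma points_full:
  assumes A: "arch_action A" and B: "arch_action B"
    and \<tau>: "\<tau> \<in> Hom (presheaf_topos_points epi_op) (points_ftor A) (points_ftor B)"
  shows "\<exists>G\<in>Hom arch_actions A B. points_arr A B G = \<tau>"
proof -
  interpret A: arch_action A by (rule A)
  interpret B: arch_action B by (rule B)
  have \<tau>1: "\<tau> n \<in> on_ob (points_ftor A) n \<rightarrow>\<^sub>E on_ob (points_ftor B) n"
    and \<tau>2: "epicyclic_map m n f \<Longrightarrow> x \<in> on_ob (points_ftor A) n \<Longrightarrow>
      \<tau> m (restr (points_ftor A) n m f x) = restr (points_ftor B) n m f (\<tau> n x)" for n m f x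
    using \<tau> by (auto simp: Hom_points is_nat_trans_epi_op_iff is_ftor_points_ftor A B)
  obtain x0 where x0: "x0 \<in> Pts A"
    using A.Pts_nonempty by blast
  define e0 where "e0 = (\<lambda>t. Act A (of_int t) x0)"
  have e0: "e0 \<in> periodic A 0"
    using A.orbit_periodic[OF x0] by (simp add: e0_def)
  have e01: "e0 (t + 1) = Act A 1 (e0 t)" for t
  proof -
    have "of_int t \<in> Grp A"
      using A.Ints_Grp by auto
    then show ?thesis
      using A.Act_add[OF A.Grp_1 _ x0, of "of_int t"] by (simp add: e0_def add.commute)
  qed
  have cl: "\<tau> n (code A n e) \<in> code B n ` periodic B n" if "e \<in> periodic A n" for n e
    using \<tau>1[of n] that by (auto simp: on_ob_points_ftor)
  obtain e0' where e0': "e0' \<in> periodic B 0" "\<tau> 0 (code A 0 e0) = code B 0 e0'"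
    using cl[OF e0] by blast
  have nat: "\<tau> m (code A m (e \<circ> f)) = restr (points_ftor B) n m f (\<tau> n (code A n e))"
    if "e \<in> periodic A n" "epicyclic_map m n f" for n m e f
    using \<tau>2[OF that(2), of "code A n e"] restr_points_ftor[OF A that] that(1)
    by (simp add: on_ob_points_ftor)
  interpret points_transformation A B \<tau> e0 e0'
    by unfold_locales (use cl nat e0 e01 e0' in auto)
  have "points_arr A B (act_class A B pmap) n x = \<tau> n x" for n x
  proof (cases "x \<in> on_ob (points_ftor A) n")
    case True
    then obtain e where e: "e \<in> periodic A n" "x = code A n e"
      by (auto simp: on_ob_points_ftor)
    then show ?thesis
      using points_arr_apply[OF A B pmap_act_maps e(1)] code_pmap[OF e(1)] by simp
  next
    case False
    then show ?thesis
      using \<tau>1[of n] by (auto simp: points_arr_def on_ob_points_ftor PiE_def extensional_def)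
  qed
  then have "points_arr A B (act_class A B pmap) = \<tau>"
    by (simp add: fun_eq_iff)
  then show ?thesis
    using arch_actions_Hom[OF pmap_act_maps] by blast
qed

section \<open>The archimedean action of a flat functor\<close>

lemma epicyclic_map_const: "epicyclic_map 0 n (\<lambda>t. t * (int n + 1))"
  using epicyclic_map_slope[of 1 n 0] by (simp add: mult.commute)

text \<open>The values at 0 and \<open>n + 1\<close> determine the degree; with it one period
  determines the map.\<close>

lemma epicyclic_map_eqI:
  assumes f: "epicyclic_map n m f" and g: "epicyclic_map n m g"
    and eq: "\<And>t. 0 \<le> t \<Longrightarrow> t \<le> int n + 1 \<Longrightarrow> f t = g t"
  shows "f = g"
proof
  fix t
  obtain k where k: "k > 0" "\<And>t. f (t + int n + 1) = f t + k * (int m + 1)"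
    "\<And>t q. f (t + q * (int n + 1)) = f t + q * k * (int m + 1)"
    using f by (rule epicyclic_mapE) (rule that)
  obtain l where l: "l > 0" "\<And>t. g (t + int n + 1) = g t + l * (int m + 1)"
    "\<And>t q. g (t + q * (int n + 1)) = g t + q * l * (int m + 1)"
    using g by (rule epicyclic_mapE) (rule that)
  have "k * (int m + 1) = l * (int m + 1)"
    using k(2)[of 0] l(2)[of 0] eq[of 0] eq[of "int n + 1"] by (simp add: add.commute)
  then have kl: "k = l"
    by simp
  let ?r = "t mod (int n + 1)" and ?q = "t div (int n + 1)"
  have "0 \<le> ?r"
    by (rule pos_mod_sign) simp
  moreover have "?r \<le> int n + 1"
    using pos_mod_bound[of "int n + 1" t] by simp
  ultimately have "f (?r + ?q * (int n + 1)) = g (?r + ?q * (int n + 1))"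
    using eq[of ?r] by (simp only: k(3) l(3) kl)
  moreover have "?r + ?q * (int n + 1) = t"
    by (metis add.commute div_mult_mod_eq)
  ultimately show "f t = g t"
    by simp
qed

text \<open>Represents a point of the colimit: an element of \<open>F n\<close>, a map from the base
  into it, and an index in the copy of \<int> that belongs to this element.\<close>

type_synonym 'u cpt = "nat \<times> 'u \<times> (int \<Rightarrow> int) \<times> int"

locale flat_functor =
  fixes F :: "(nat, (int \<Rightarrow> int) set, 'u set, 'u \<Rightarrow> 'u) ftor" and x0 :: 'u
  assumes ftor: "is_ftor epi_op Sets F"
    and cofiltered: "cofiltered (elements_category epi_op F)"
    and x0: "x0 \<in> on_ob F 0"
begin

lemma R_closed: "epicyclic_map m n f \<Longrightarrow> x \<in> on_ob F n \<Longrightarrow> restr F n m f x \<in> on_ob F m"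
  using ftor unfolding is_ftor_epi_op_iff by blast

lemma R_id: "x \<in> on_ob F n \<Longrightarrow> restr F n n (\<lambda>x. x) x = x"
  using ftor unfolding is_ftor_epi_op_iff by blast

lemma R_comp:
  "epicyclic_map m n f \<Longrightarrow> epicyclic_map p m g \<Longrightarrow> x \<in> on_ob F n \<Longrightarrow>
   restr F n p (f \<circ> g) x = restr F m p g (restr F n m f x)"
  using ftor unfolding is_ftor_epi_op_iff by blast

lemma R_shift: "restr F n m (\<lambda>t. f t + a * (int n + 1)) x = restr F n m f x"
proof -
  have "epicyclic_class n f = epicyclic_class n (\<lambda>t. f t + a * (int n + 1))"
    unfolding epicyclic_class_eq_iff by blast
  then show ?thesis by simp
qed

lemma R_joint:
  assumes "x \<in> on_ob F n" "y \<in> on_ob F m"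
  obtains p u v z where "z \<in> on_ob F p" "epicyclic_map n p u" "epicyclic_map m p v"
    "restr F p n u z = x" "restr F p m v z = y"
  using cofiltered assms unfolding cofiltered_elements_iff by blast

lemma R_equalize:
  assumes "x \<in> on_ob F n" "epicyclic_map m n f" "epicyclic_map m n g" "restr F n m f x = restr F n m g x"
  obtains p w z a where "z \<in> on_ob F p" "epicyclic_map n p w" "restr F p n w z = x"
    "\<And>t. w (g t) = w (f t) + a * (int p + 1)"
proof -
  have "\<exists>p w. \<exists>z\<in>on_ob F p. epicyclic_map n p w \<and> restr F p n w z = x \<and>
           epicyclic_class p (w \<circ> f) = epicyclic_class p (w \<circ> g)"
    using cofiltered assms R_closed[OF assms(2,1)] unfolding cofiltered_elements_iff by blast
  then obtain p w z where w: "z \<in> on_ob F p" "epicyclic_map n p w" "restr F p n w z = x"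
    "epicyclic_class p (w \<circ> f) = epicyclic_class p (w \<circ> g)"
    by blast
  then obtain a where "\<And>t. w (g t) = w (f t) + a * (int p + 1)"
    unfolding epicyclic_class_eq_iff by auto
  then show ?thesis
    using that w(1,2,3) by blast
qed

text \<open>
  Morphisms of the epicyclic category are classes of maps. A chart fixes a representative of a
  morphism to the base point \<open>x0\<close>, so that morphisms of charts have canonical representatives.
\<close>

definition chart :: "nat \<Rightarrow> 'u \<Rightarrow> (int \<Rightarrow> int) \<Rightarrow> bool" where
  "chart n x f \<longleftrightarrow> x \<in> on_ob F n \<and> epicyclic_map 0 n f \<and> restr F n 0 f x = x0"

text \<open>A morphism from \<open>(p, z)\<close> to \<open>(n, x)\<close> in the category of
  elements with a chosen representative \<open>u\<close>, which maps the copy of \<int> at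
  \<open>x\<close> to the one at \<open>z\<close>.\<close>

definition refines :: "nat \<Rightarrow> 'u \<Rightarrow> nat \<Rightarrow> 'u \<Rightarrow> (int \<Rightarrow> int) \<Rightarrow> bool" where
  "refines n x p z u \<longleftrightarrow> z \<in> on_ob F p \<and> epicyclic_map n p u \<and> restr F p n u z = x"

lemma chart_x0: "chart 0 x0 (\<lambda>t. t)"
  by (simp add: chart_def x0 epicyclic_map_id R_id)

lemma refines_id: "chart n x f \<Longrightarrow> refines n x n x (\<lambda>t. t)"
  by (simp add: refines_def chart_def R_id epicyclic_map_id)

lemma refines_comp:
  assumes "refines n x p z u" "refines p z q y w"
  shows "refines n x q y (w \<circ> u)"
  using assms R_comp[of p q w n u y] epicyclic_map_comp[of n p u q w] by (simp add: refines_def)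

lemma chart_refines:
  assumes "chart n x f" "refines n x p z u"
  shows "chart p z (u \<circ> f)"
  using assms R_comp[of n p u 0 f z] epicyclic_map_comp[of 0 n f p u] by (simp add: refines_def chart_def)

text \<open>Cofilteredness gives a common refinement, but there the two maps from the base agree
  only in their effect on the element. Equalising them leaves a shift by \<open>a * (p + 1)\<close>,
  and this is absorbed into \<open>u\<close>, whose class does not change.\<close>

lemma chart_joint:
  assumes c: "chart n x f" "chart m y g"
  shows "\<exists>p z u v. refines n x p z u \<and> refines m y p z v \<and> u \<circ> f = v \<circ> g"
proof -
  obtain p0 u0 v0 z0 where z0: "z0 \<in> on_ob F p0" "epicyclic_map n p0 u0" "epicyclic_map m p0 v0"
    "restr F p0 n u0 z0 = x" "restr F p0 m v0 z0 = y"
    using R_joint c unfolding chart_def by metis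
  have r: "refines n x p0 z0 u0" "refines m y p0 z0 v0"
    using z0 by (auto simp: refines_def)
  have "epicyclic_map 0 p0 (u0 \<circ> f)" "epicyclic_map 0 p0 (v0 \<circ> g)"
    "restr F p0 0 (u0 \<circ> f) z0 = restr F p0 0 (v0 \<circ> g) z0"
    using chart_refines[OF c(1) r(1)] chart_refines[OF c(2) r(2)] by (auto simp: chart_def)
  then obtain p w z a where w: "z \<in> on_ob F p" "epicyclic_map p0 p w" "restr F p p0 w z = z0"
    "\<And>t. w ((v0 \<circ> g) t) = w ((u0 \<circ> f) t) + a * (int p + 1)"
    using R_equalize[OF z0(1)] by metis
  define u where "u = (\<lambda>t. (w \<circ> u0) t + a * (int p + 1))"
  have rw: "refines p0 z0 p z w"
    using w by (simp add: refines_def)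
  have "refines n x p z (w \<circ> u0)"
    using refines_comp[OF r(1) rw] .
  then have "refines n x p z u"
    using epicyclic_map_shift[of n p "w \<circ> u0" a] R_shift[of p n "w \<circ> u0" a z]
    unfolding refines_def u_def by (simp only:)
  moreover have "refines m y p z (w \<circ> v0)"
    using refines_comp[OF r(2) rw] .
  moreover have "u \<circ> f = (w \<circ> v0) \<circ> g"
    using w(4) by (auto simp: u_def)
  ultimately show ?thesis by blast
qed

text \<open>Two refinements with the same restriction to \<open>x\<close> are equalised up to a
  shift. As they agree on the base, the shift vanishes at the index \<open>f 0\<close> and therefore
  everywhere.\<close>

lemma chart_equalize:
  assumes c: "chart n x f" and u: "refines n x p z u" and v: "refines n x p z v" and uv: "u \<circ> f = v \<circ> f"
  shows "\<exists>q y w. refines p z q y w \<and> w \<circ> u = w \<circ> v"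
proof -
  obtain q w y a where w: "y \<in> on_ob F q" "epicyclic_map p q w" "restr F q p w y = z"
    "\<And>t. w (v t) = w (u t) + a * (int q + 1)"
    using R_equalize[of z p n u v] u v unfolding refines_def by metis
  have "a * (int q + 1) = 0"
    using w(4)[of "f 0"] fun_cong[OF uv, of 0] by simp
  then have "w \<circ> u = w \<circ> v"
    using w(4) by auto
  then show ?thesis
    using w(1,2,3) by (auto simp: refines_def)
qed

section \<open>The ordered colimit over the charts\<close>

definition cpts :: "'u cpt set" where
  "cpts = {(n, x, f, i). chart n x f}"

text \<open>The preorder of the filtered colimit: an inequality counts when it holds in some common
  refinement. Antisymmetry is gained only by passing to \<open>cls\<close>.\<close>

definition le :: "'u cpt \<Rightarrow> 'u cpt \<Rightarrow> bool" where
  "le = (\<lambda>(n, x, f, i) (m, y, g, j).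
     \<exists>p z u v. refines n x p z u \<and> refines m y p z v \<and> u \<circ> f = v \<circ> g \<and> u i \<le> v j)"

lemma le_chart: "chart n x f \<Longrightarrow> i \<le> j \<Longrightarrow> le (n, x, f, i) (n, x, f, j)"
  using refines_id[of n x f] unfolding le_def by fastforce

text \<open>The comparison may use two different refinements of the chart. They agree on the base,
  so a further refinement makes them equal.\<close>

lemma le_chartD:
  assumes c: "chart n x f" and le: "le (n, x, f, i) (n, x, f, j)"
  shows "\<exists>p z w. refines n x p z w \<and> w i \<le> w j"
proof -
  obtain p z u v where uv: "refines n x p z u" "refines n x p z v" "u \<circ> f = v \<circ> f" "u i \<le> v j"
    using le unfolding le_def by blast
  obtain q y w where w: "refines p z q y w" "w \<circ> u = w \<circ> v"
    using chart_equalize[OF c uv(1,2,3)] by blast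
  have "w (u i) \<le> w (v j)"
    using uv(4) w(1) epicyclic_map_mono by (auto simp: refines_def)
  then have "(w \<circ> u) i \<le> (w \<circ> u) j"
    using fun_cong[OF w(2), of j] by simp
  then show ?thesis
    using refines_comp[OF uv(1) w(1)] by blast
qed

lemma le_total:
  assumes "chart n x f" "chart m y g"
  shows "le (n, x, f, i) (m, y, g, j) \<or> le (m, y, g, j) (n, x, f, i)"
proof -
  obtain p z u v where "refines n x p z u" "refines m y p z v" "u \<circ> f = v \<circ> g"
    using chart_joint[OF assms] by blast
  moreover have "u i \<le> v j \<or> v j \<le> u i"
    by linarith
  ultimately show ?thesis
    unfolding le_def by fastforce
qed

text \<open>The two refinements that witness the inequalities are joined over the middle chart. The
  resulting two maps out of that chart are only known to agree on the base, so they are equalised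
  before the inequalities are chained.\<close>

lemma le_trans:
  assumes c: "chart n x f" "chart m y g" "chart l a b"
    and le1: "le (n, x, f, i) (m, y, g, j)" and le2: "le (m, y, g, j) (l, a, b, k)"
  shows "le (n, x, f, i) (l, a, b, k)"
proof -
  obtain p z u v where u: "refines n x p z u" "refines m y p z v" "u \<circ> f = v \<circ> g" "u i \<le> v j"
    using le1 unfolding le_def by blast
  obtain p' z' u' v' where v: "refines m y p' z' u'" "refines l a p' z' v'" "u' \<circ> g = v' \<circ> b" "u' j \<le> v' k"
    using le2 unfolding le_def by blast
  obtain P Z U V where U: "refines p z P Z U" "refines p' z' P Z V" "U \<circ> (v \<circ> g) = V \<circ> (u' \<circ> g)"
    using chart_joint[OF chart_refines[OF c(2) u(2)] chart_refines[OF c(2) v(1)]] by blast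
  obtain Q Y W where W: "refines P Z Q Y W" "W \<circ> (U \<circ> v) = W \<circ> (V \<circ> u')"
    using chart_equalize[OF c(2) refines_comp[OF u(2) U(1)] refines_comp[OF v(1) U(2)]] U(3)
    by (auto simp: comp_assoc)
  have "refines n x Q Y (W \<circ> U \<circ> u)" "refines l a Q Y (W \<circ> V \<circ> v')"
    using refines_comp[OF u(1) refines_comp[OF U(1) W(1)]] refines_comp[OF v(2) refines_comp[OF U(2) W(1)]]
    by auto
  moreover have "(W \<circ> U \<circ> u) \<circ> f = (W \<circ> V \<circ> v') \<circ> b"
    using u(3) v(3) W(2) by (metis comp_assoc)
  moreover have "(W \<circ> U \<circ> u) i \<le> (W \<circ> V \<circ> v') k"
  proof -
    have m: "W (U s) \<le> W (U t)" "W (V s) \<le> W (V t)" if "s \<le> t" for s t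
      using that U(1,2) W(1) epicyclic_map_mono by (auto simp: refines_def)
    have "W (U (u i)) \<le> W (U (v j))"
      using m(1)[OF u(4)] .
    also have "\<dots> = W (V (u' j))"
      using fun_cong[OF W(2), of j] by simp
    also have "\<dots> \<le> W (V (v' k))"
      using m(2)[OF v(4)] .
    finally show ?thesis by simp
  qed
  ultimately show ?thesis
    unfolding le_def by blast
qed

text \<open>The endomorphisms of the object 0 of degrees 1, 2, 3, ... pull \<open>x0\<close> back to
  distinct elements: a coincidence would be equalised by a map \<open>w\<close> of positive slope,
  and such a map separates them. So a flat functor guarantees enough codes for its own
  colimit.\<close>

lemma infinite_universe: "infinite (UNIV :: 'u set)"
proof -
  define \<phi> where "\<phi> k = restr F 0 0 (\<lambda>t. (int k + 1) * t) x0" for k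
  have em: "epicyclic_map 0 0 (\<lambda>t. (int k + 1) * t)" for k
    using epicyclic_map_slope[of "int k + 1" 0 0] by simp
  have "k = l" if kl: "\<phi> k = \<phi> l" for k l
  proof -
    obtain p w z a where w: "z \<in> on_ob F p" "epicyclic_map 0 p w" "restr F p 0 w z = x0"
      "\<And>t. w ((int l + 1) * t) = w ((int k + 1) * t) + a * (int p + 1)"
      by (rule R_equalize[OF x0 em[of k] em[of l] kl[unfolded \<phi>_def]]) (rule that)
    obtain s where s: "s > 0" "\<And>t. w (t + int 0 + 1) = w t + s * (int p + 1)"
      "\<And>t q. w (t + q * (int 0 + 1)) = w t + q * s * (int p + 1)"
      using w(2) by (rule epicyclic_mapE) (rule that)
    have "a * (int p + 1) = 0"
      using w(4)[of 0] by simp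
    then have "w (int l + 1) = w (int k + 1)"
      using w(4)[of 1] by simp
    then have "(int l + 1) * s * (int p + 1) = (int k + 1) * s * (int p + 1)"
      using s(3)[of 0 "int l + 1"] s(3)[of 0 "int k + 1"] by simp
    then show "k = l"
      using s(1) by simp
  qed
  then have "inj \<phi>"
    by (auto intro: injI)
  then show ?thesis
    using finite_imageD infinite_UNIV_nat finite_subset[OF subset_UNIV] by metis
qed

definition cls :: "'u cpt \<Rightarrow> 'u" where
  "cls = (SOME q. \<forall>s\<in>cpts. \<forall>t\<in>cpts. q s = q t \<longleftrightarrow> le s t \<and> le t s)"

text \<open>A map from the object 0 is determined by its values at 0 and 1. So a representative is
  coded by a list of five elements, and its class by \<open>exists_quotient_code\<close>.\<close>

lemma cls_eq_iff:
  assumes "chart n x f" "chart m y g"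
  shows "cls (n, x, f, i) = cls (m, y, g, j) \<longleftrightarrow> le (n, x, f, i) (m, y, g, j) \<and> le (m, y, g, j) (n, x, f, i)"
proof -
  obtain c :: "'u list \<Rightarrow> 'u" where c: "\<And>n. inj_on c {xs. length xs = n}"
    using exists_list_code[OF infinite_universe] by blast
  obtain \<nu> :: "nat \<Rightarrow> 'u" where nu: "inj \<nu>"
    using infinite_countable_subset[OF infinite_universe] by blast
  define \<mu> :: "int \<Rightarrow> 'u" where "\<mu> i = \<nu> (to_nat i)" for i
  have mu: "\<mu> i = \<mu> j \<longleftrightarrow> i = j" for i j
    using nu by (auto simp: \<mu>_def inj_eq)
  define L where "L = (\<lambda>(n, x, f :: int \<Rightarrow> int, i). [\<nu> n, x, \<mu> (f 0), \<mu> (f 1), \<mu> i])"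
  have "inj_on (c \<circ> L) cpts"
  proof (rule inj_onI)
    fix s t assume s: "s \<in> cpts" and t: "t \<in> cpts" and "(c \<circ> L) s = (c \<circ> L) t"
    then have L: "L s = L t"
      using inj_onD[OF c[of 5], of "L s" "L t"] by (auto simp: L_def split: prod.splits)
    obtain n x f i where s': "s = (n, x, f, i)" by (cases s)
    obtain m y g j where t': "t = (m, y, g, j)" by (cases t)
    have e: "n = m" "x = y" "f 0 = g 0" "f 1 = g 1" "i = j"
      using L nu mu by (auto simp: L_def s' t' inj_eq)
    have "epicyclic_map 0 n f" "epicyclic_map 0 n g"
      using s t e by (auto simp: s' t' cpts_def chart_def)
    then have "f = g"
    proof (rule epicyclic_map_eqI)
      fix t :: int assume "0 \<le> t" "t \<le> int 0 + 1"
      then have "t = 0 \<or> t = 1" by auto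
      then show "f t = g t"
        using e by auto
    qed
    then show "s = t"
      using e by (simp add: s' t')
  qed
  then have "\<exists>q :: 'u cpt \<Rightarrow> 'u. \<forall>s\<in>cpts. \<forall>t\<in>cpts. q s = q t \<longleftrightarrow> le s t \<and> le t s"
  proof (rule exists_quotient_code)
    show "le s s \<and> le s s" if "s \<in> cpts" for s
      using that le_chart by (auto simp: cpts_def)
    show "le t s \<and> le s t" if "le s t \<and> le t s" for s t
      using that by (rule conj_commute[THEN iffD1])
    fix r s t assume r: "r \<in> cpts" and s: "s \<in> cpts" and t: "t \<in> cpts"
      and "le r s \<and> le s r" "le s t \<and> le t s"
    moreover obtain n x f i where "r = (n, x, f, i)" by (cases r)
    moreover obtain m y g j where "s = (m, y, g, j)" by (cases s)
    moreover obtain l a b k where "t = (l, a, b, k)" by (cases t)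
    ultimately show "le r t \<and> le t r"
      using le_trans[of n x f m y g l a b i j k] le_trans[of l a b m y g n x f k j i]
      by (simp add: cpts_def)
  qed
  from someI_ex[OF this] show ?thesis
    using assms unfolding cls_def[symmetric] by (auto simp: cpts_def)
qed

end

section \<open>Degrees of charts and the action on the colimit\<close>

definition deg :: "nat \<Rightarrow> (int \<Rightarrow> int) \<Rightarrow> int" where
  "deg n f = (f 1 - f 0) div (int n + 1)"

text \<open>The base orbit advances by \<open>deg n f\<close> periods of the chart, a period being
  the shift by \<open>n + 1\<close>. If the base orbit is to have period 1, then the shift by
  \<open>j * (n + 1)\<close> is this rational number.\<close>

definition deg_frac :: "nat \<Rightarrow> (int \<Rightarrow> int) \<Rightarrow> int \<Rightarrow> rat" where
  "deg_frac n f j = of_int j / of_int (deg n f)"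

lemma epicyclic_map_deg:
  assumes "epicyclic_map 0 n f"
  shows "deg n f > 0" "f (t + q) = f t + q * deg n f * (int n + 1)"
proof -
  obtain s where s: "s > 0" "\<And>t. f (t + int 0 + 1) = f t + s * (int n + 1)"
    "\<And>t q. f (t + q * (int 0 + 1)) = f t + q * s * (int n + 1)"
    using assms by (rule epicyclic_mapE) (rule that)
  have "deg n f = s"
    using s(2)[of 0] by (simp add: deg_def)
  then show "deg n f > 0" "f (t + q) = f t + q * deg n f * (int n + 1)"
    using s(1) s(3)[of t q] by simp_all
qed

context flat_functor
begin

lemma chart_deg: "chart n x f \<Longrightarrow> deg n f > 0"
  using epicyclic_map_deg(1) by (simp add: chart_def)

lemma deg_frac_eq_iff: "chart n x f \<Longrightarrow> deg_frac n f i = deg_frac n f j \<longleftrightarrow> i = j"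
  using chart_deg[of n x f] by (simp add: deg_frac_def)

text \<open>A refinement of slope \<open>s\<close> multiplies the degree of the chart and the number
  of shifts alike, so the fraction is independent of the chart.\<close>

lemma refines_slope:
  assumes c: "chart n x f" and w: "refines n x p z w"
  obtains s where "s > 0" "\<And>t q. w (t + q * (int n + 1)) = w t + q * s * (int p + 1)"
    "\<And>j. deg_frac n f j = deg_frac p (w \<circ> f) (j * s)"
proof -
  obtain s where s: "s > 0" "\<And>t. w (t + int n + 1) = w t + s * (int p + 1)"
    "\<And>t q. w (t + q * (int n + 1)) = w t + q * s * (int p + 1)"
    using w[unfolded refines_def, THEN conjunct2, THEN conjunct1] by (rule epicyclic_mapE) (rule that)
  have "f 1 = f 0 + deg n f * (int n + 1)"
    using epicyclic_map_deg(2)[of n f 0 1] c by (simp add: chart_def)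
  then have "deg p (w \<circ> f) = deg n f * s"
    using s(3)[of "f 0" "deg n f"] by (simp add: deg_def)
  then have "deg_frac n f j = deg_frac p (w \<circ> f) (j * s)" for j
    using s(1) by (simp add: deg_frac_def)
  then show ?thesis
    by (rule that[OF s(1) s(3)])
qed

lemma cls_refines:
  assumes c: "chart n x f" and w: "refines n x p z w"
  shows "cls (p, z, w \<circ> f, w i) = cls (n, x, f, i)"
proof -
  note c' = chart_refines[OF c w]
  have "le (n, x, f, i) (p, z, w \<circ> f, w i)" "le (p, z, w \<circ> f, w i) (n, x, f, i)"
    using w refines_id[OF c'] unfolding le_def by fastforce+
  then show ?thesis
    using cls_eq_iff[OF c' c] by blast
qed

lemma chart_common:
  assumes c: "chart n x f" "chart m y g"
  shows "\<exists>p z u v. refines n x p z u \<and> refines m y p z v \<and> u \<circ> f = v \<circ> g \<and> chart p z (u \<circ> f) \<and>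
    (\<forall>i. cls (n, x, f, i) = cls (p, z, u \<circ> f, u i)) \<and> (\<forall>i. cls (m, y, g, i) = cls (p, z, u \<circ> f, v i)) \<and>
    range (deg_frac n f) \<subseteq> range (deg_frac p (u \<circ> f)) \<and> range (deg_frac m g) \<subseteq> range (deg_frac p (u \<circ> f))"
proof -
  obtain p z u v where u: "refines n x p z u" "refines m y p z v" "u \<circ> f = v \<circ> g"
    using chart_joint[OF c] by blast
  obtain s where s: "\<And>j. deg_frac n f j = deg_frac p (u \<circ> f) (j * s)"
    by (rule refines_slope[OF c(1) u(1)]) (rule that)
  obtain s' where s': "\<And>j. deg_frac m g j = deg_frac p (v \<circ> g) (j * s')"
    by (rule refines_slope[OF c(2) u(2)]) (rule that)
  have "cls (n, x, f, i) = cls (p, z, u \<circ> f, u i)" "cls (m, y, g, i) = cls (p, z, u \<circ> f, v i)" for i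
    using cls_refines[OF c(1) u(1)] cls_refines[OF c(2) u(2)] u(3) by simp_all
  moreover have "range (deg_frac n f) \<subseteq> range (deg_frac p (u \<circ> f))" "range (deg_frac m g) \<subseteq> range (deg_frac p (u \<circ> f))"
    using s s' u(3) by auto
  ultimately show ?thesis
    using u chart_refines[OF c(1) u(1)] by blast
qed

lemma le_chart_shift:
  assumes c: "chart n x f" and le: "le (n, x, f, i) (n, x, f, k)"
  shows "le (n, x, f, i + q * (int n + 1)) (n, x, f, k + q * (int n + 1))"
proof -
  obtain p z w where w: "refines n x p z w" "w i \<le> w k"
    using le_chartD[OF c le] by blast
  obtain s where s: "\<And>t q. w (t + q * (int n + 1)) = w t + q * s * (int p + 1)"
    by (rule refines_slope[OF c w(1)]) (rule that)
  have "w (i + q * (int n + 1)) \<le> w (k + q * (int n + 1))"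
    using s w(2) by simp
  then show ?thesis
    using w(1) unfolding le_def by blast
qed

lemma cls_chart_shift:
  assumes "chart n x f" "cls (n, x, f, i) = cls (n, x, f, k)"
  shows "cls (n, x, f, i + q * (int n + 1)) = cls (n, x, f, k + q * (int n + 1))"
  using assms(2) cls_eq_iff[OF assms(1,1)] le_chart_shift[OF assms(1)] by simp

text \<open>This makes the action well defined. In a common refinement equal fractions have equal
  numerators, so both points are shifted by the same integer.\<close>

lemma cls_shift_eq:
  assumes c: "chart n x f" "chart m y g" and eq: "cls (n, x, f, i) = cls (m, y, g, k)"
    and fr: "deg_frac n f j = deg_frac m g l"
  shows "cls (n, x, f, i + j * (int n + 1)) = cls (m, y, g, k + l * (int m + 1))"
proof -
  obtain p z u v where u: "refines n x p z u" "refines m y p z v" "u \<circ> f = v \<circ> g"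
    using chart_joint[OF c] by blast
  note c' = chart_refines[OF c(1) u(1)]
  obtain s where s: "\<And>t q. u (t + q * (int n + 1)) = u t + q * s * (int p + 1)"
      "\<And>j. deg_frac n f j = deg_frac p (u \<circ> f) (j * s)"
    by (rule refines_slope[OF c(1) u(1)]) (rule that)
  obtain s' where s': "\<And>t q. v (t + q * (int m + 1)) = v t + q * s' * (int p + 1)"
      "\<And>j. deg_frac m g j = deg_frac p (v \<circ> g) (j * s')"
    by (rule refines_slope[OF c(2) u(2)]) (rule that)
  have js: "j * s = l * s'"
    using fr unfolding s(2) s'(2) u(3)[symmetric] deg_frac_eq_iff[OF c'] .
  have "cls (n, x, f, i + j * (int n + 1)) = cls (p, z, u \<circ> f, u i + j * s * (int p + 1))"
    using cls_refines[OF c(1) u(1)] by (simp only: flip: s(1))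
  also have "\<dots> = cls (p, z, u \<circ> f, v k + j * s * (int p + 1))"
    by (rule cls_chart_shift[OF c'])
      (use cls_refines[OF c(1) u(1)] cls_refines[OF c(2) u(2)] eq u(3) in simp)
  also have "\<dots> = cls (m, y, g, k + l * (int m + 1))"
    unfolding js u(3) using cls_refines[OF c(2) u(2)] by (simp only: flip: s'(1))
  finally show ?thesis .
qed

text \<open>The group is the union of the cyclic groups generated by 1 / \<open>deg n f\<close> over
  all charts. Order and action refer to every chart that shows their arguments;
  \<open>Leq_cls\<close> and \<open>Act_cls\<close> reduce them to any single one.\<close>

definition point_action :: "'u action" where
  "point_action =
     \<lparr>Grp = {deg_frac n f j |n x f j. chart n x f},
      Pts = {cls (n, x, f, i) |n x f i. chart n x f},
      Leq = (\<lambda>\<xi> \<eta>. \<exists>s\<in>cpts. \<exists>t\<in>cpts. cls s = \<xi> \<and> cls t = \<eta> \<and> le s t),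
      Act = (\<lambda>h \<xi>. SOME \<eta>. \<exists>n x f i j. chart n x f \<and> cls (n, x, f, i) = \<xi> \<and> deg_frac n f j = h \<and>
        cls (n, x, f, i + j * (int n + 1)) = \<eta>)\<rparr>"

lemma Grp_point_action: "h \<in> Grp point_action \<longleftrightarrow> (\<exists>n x f. chart n x f \<and> h \<in> range (deg_frac n f))"
  unfolding point_action_def by fastforce

lemma Pts_point_action: "\<xi> \<in> Pts point_action \<longleftrightarrow> (\<exists>n x f. chart n x f \<and> \<xi> \<in> range (\<lambda>i. cls (n, x, f, i)))"
  unfolding point_action_def by fastforce

lemma cls_Pts: "chart n x f \<Longrightarrow> cls (n, x, f, i) \<in> Pts point_action"
  and deg_frac_Grp: "chart n x f \<Longrightarrow> deg_frac n f j \<in> Grp point_action"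
  by (auto simp: point_action_def)

lemma Leq_cls:
  assumes c: "chart n x f" "chart m y g"
  shows "Leq point_action (cls (n, x, f, i)) (cls (m, y, g, j)) \<longleftrightarrow> le (n, x, f, i) (m, y, g, j)"
proof
  assume "Leq point_action (cls (n, x, f, i)) (cls (m, y, g, j))"
  then obtain s t where st: "s \<in> cpts" "t \<in> cpts" "cls s = cls (n, x, f, i)" "cls t = cls (m, y, g, j)" "le s t"
    by (auto simp: point_action_def)
  obtain n' x' f' i' where s: "s = (n', x', f', i')" by (cases s)
  obtain m' y' g' j' where t: "t = (m', y', g', j')" by (cases t)
  have c': "chart n' x' f'" "chart m' y' g'"
    using st(1,2) by (auto simp: s t cpts_def)
  have "le (n, x, f, i) s" "le t (m, y, g, j)"
    using st(3,4) cls_eq_iff[OF c'(1) c(1)] cls_eq_iff[OF c'(2) c(2)] by (auto simp: s t)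
  then show "le (n, x, f, i) (m, y, g, j)"
    using le_trans[OF c(1) c'(1) c'(2), of i i' j'] le_trans[OF c(1) c'(2) c(2), of i j' j] st(5)
    by (simp add: s t)
next
  assume "le (n, x, f, i) (m, y, g, j)"
  moreover have "(n, x, f, i) \<in> cpts" "(m, y, g, j) \<in> cpts"
    using c by (simp_all add: cpts_def)
  ultimately show "Leq point_action (cls (n, x, f, i)) (cls (m, y, g, j))"
    unfolding point_action_def by auto
qed

lemma Act_cls:
  assumes c: "chart n x f"
  shows "Act point_action (deg_frac n f j) (cls (n, x, f, i)) = cls (n, x, f, i + j * (int n + 1))"
proof -
  have "(SOME \<eta>. \<exists>n' x' f' i' j'. chart n' x' f' \<and> cls (n', x', f', i') = cls (n, x, f, i) \<and>
      deg_frac n' f' j' = deg_frac n f j \<and> cls (n', x', f', i' + j' * (int n' + 1)) = \<eta>) =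
    cls (n, x, f, i + j * (int n + 1))"
  proof (rule some_equality)
    show "\<exists>n' x' f' i' j'. chart n' x' f' \<and> cls (n', x', f', i') = cls (n, x, f, i) \<and>
      deg_frac n' f' j' = deg_frac n f j \<and> cls (n', x', f', i' + j' * (int n' + 1)) = cls (n, x, f, i + j * (int n + 1))"
      using c by blast
  next
    fix \<eta> assume "\<exists>n' x' f' i' j'. chart n' x' f' \<and> cls (n', x', f', i') = cls (n, x, f, i) \<and>
      deg_frac n' f' j' = deg_frac n f j \<and> cls (n', x', f', i' + j' * (int n' + 1)) = \<eta>"
    then obtain n' x' f' i' j' where "chart n' x' f'" "cls (n', x', f', i') = cls (n, x, f, i)"
      "deg_frac n' f' j' = deg_frac n f j" "cls (n', x', f', i' + j' * (int n' + 1)) = \<eta>"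
      by blast
    then show "\<eta> = cls (n, x, f, i + j * (int n + 1))"
      using cls_shift_eq[of n' x' f' n x f i' i j' j] c by simp
  qed
  then show ?thesis
    by (simp add: point_action_def)
qed

text \<open>The charts are filtered: any two of them have a common refinement that shows the points
  and group elements of both. Induction extends this to finitely many.\<close>

lemma common_chart:
  assumes S: "finite S" "S \<subseteq> Pts point_action" and K: "finite K" "K \<subseteq> Grp point_action"
  obtains n x f where "chart n x f" "\<And>\<xi>. \<xi> \<in> S \<Longrightarrow> \<exists>i. \<xi> = cls (n, x, f, i)"
    "\<And>h. h \<in> K \<Longrightarrow> \<exists>j. h = deg_frac n f j"
proof -
  have step: "\<exists>p z k. chart p z k \<and>
      range (\<lambda>i. cls (n, x, f, i)) \<union> range (\<lambda>i. cls (m, y, g, i)) \<subseteq> range (\<lambda>i. cls (p, z, k, i)) \<and>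
      range (deg_frac n f) \<union> range (deg_frac m g) \<subseteq> range (deg_frac p k)"
    if c: "chart n x f" "chart m y g" for n x f m y g
  proof -
    obtain p z u v where uv: "chart p z (u \<circ> f)" "\<forall>i. cls (n, x, f, i) = cls (p, z, u \<circ> f, u i)"
      "\<forall>i. cls (m, y, g, i) = cls (p, z, u \<circ> f, v i)"
      "range (deg_frac n f) \<subseteq> range (deg_frac p (u \<circ> f))" "range (deg_frac m g) \<subseteq> range (deg_frac p (u \<circ> f))"
      using chart_common[OF c] by (elim exE conjE) (rule that)
    have "cls (n, x, f, i) \<in> range (\<lambda>i. cls (p, z, u \<circ> f, i))" "cls (m, y, g, i) \<in> range (\<lambda>i. cls (p, z, u \<circ> f, i))" for i
      unfolding uv(2,3)[rule_format] by (rule rangeI)+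
    then have "range (\<lambda>i. cls (n, x, f, i)) \<union> range (\<lambda>i. cls (m, y, g, i)) \<subseteq> range (\<lambda>i. cls (p, z, u \<circ> f, i))"
      by (intro Un_least image_subsetI)
    then show ?thesis
      using uv(1,4,5) by (intro exI[of _ p] exI[of _ z] exI[of _ "u \<circ> f"]) simp
  qed
  define P where "P n x f = range (\<lambda>i. cls (n, x, f, i))" for n x f
  define D where "D n f = range (deg_frac n f)" for n f
  note step = step[folded P_def D_def]
  have P: "\<exists>n x f. chart n x f \<and> \<xi> \<in> P n x f" if "\<xi> \<in> Pts point_action" for \<xi>
    using that unfolding Pts_point_action P_def .
  have D: "\<exists>n x f. chart n x f \<and> h \<in> D n f" if "h \<in> Grp point_action" for h
    using that unfolding Grp_point_action D_def .
  have 1: "\<exists>n x f. chart n x f \<and> S \<subseteq> P n x f"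
    using S
  proof (induction rule: finite_induct)
    case empty
    then show ?case using chart_x0 by blast
  next
    case (insert \<xi> S)
    then obtain n x f where c: "chart n x f" "S \<subseteq> P n x f" by blast
    obtain m y g where c': "chart m y g" "\<xi> \<in> P m y g"
      using insert.prems P by blast
    show ?case using step[OF c(1) c'(1)] c(2) c'(2) by blast
  qed
  have "\<exists>n x f. chart n x f \<and> S \<subseteq> P n x f \<and> K \<subseteq> D n f"
    using K
  proof (induction rule: finite_induct)
    case empty
    then show ?case using 1 by blast
  next
    case (insert h K)
    then obtain n x f where c: "chart n x f" "S \<subseteq> P n x f" "K \<subseteq> D n f" by blast
    obtain m y g where c': "chart m y g" "h \<in> D m g"
      using insert.prems D by blast
    show ?case using step[OF c(1) c'(1)] c(2,3) c'(2) by blast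
  qed
  then obtain n x f where "chart n x f" "S \<subseteq> P n x f" "K \<subseteq> D n f"
    by blast
  then show ?thesis
    using that[of n x f] unfolding P_def D_def by blast
qed

lemma deg_frac_diff: "deg_frac n f i - deg_frac n f j = deg_frac n f (i - j)"
  and deg_frac_add: "deg_frac n f i + deg_frac n f j = deg_frac n f (i + j)"
  by (simp_all add: deg_frac_def diff_divide_distrib add_divide_distrib)

lemma deg_frac_0: "deg_frac n f 0 = 0"
  by (simp add: deg_frac_def)

lemma deg_frac_less_iff: "chart n x f \<Longrightarrow> 0 < deg_frac n f j \<longleftrightarrow> 0 < j"
  using chart_deg[of n x f] by (simp add: deg_frac_def zero_less_divide_iff)

text \<open>Each axiom concerns finitely many points and group elements. By
  \<open>common_chart\<close> it becomes a statement about integers and the relation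
  \<open>le\<close> inside one chart.\<close>

lemma arch_action_point_action: "arch_action point_action"
proof
  show "\<int> \<subseteq> Grp point_action"
  proof
    fix h :: rat assume "h \<in> \<int>"
    then obtain j where "h = of_int j" by (auto elim: Ints_cases)
    moreover have "deg_frac 0 (\<lambda>t. t) j = of_int j"
      by (simp add: deg_frac_def deg_def)
    ultimately show "h \<in> Grp point_action"
      using deg_frac_Grp[OF chart_x0, of j] by simp
  qed
next
  fix h k assume hk: "h \<in> Grp point_action" "k \<in> Grp point_action"
  obtain n a f where c: "chart n a f" and "\<exists>i. h = deg_frac n f i" "\<exists>i. k = deg_frac n f i"
    by (rule common_chart[of "{}" "{h, k}"]) (use hk in auto)
  then show "h - k \<in> Grp point_action"
    using deg_frac_diff deg_frac_Grp[OF c] by auto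
next
  show "Pts point_action \<noteq> {}"
    using cls_Pts[OF chart_x0] by blast
next
  fix x assume "x \<in> Pts point_action"
  then obtain n a f i where c: "chart n a f" "x = cls (n, a, f, i)"
    using Pts_point_action by auto
  then show "Leq point_action x x"
    using Leq_cls[OF c(1) c(1)] le_chart[OF c(1)] by simp
  show "Act point_action 0 x = x"
    using Act_cls[OF c(1), of 0] c(2) by (simp add: deg_frac_0)
  fix h assume h: "h \<in> Grp point_action"
  obtain n a f where c: "chart n a f" and "\<exists>i. x = cls (n, a, f, i)" "\<exists>j. h = deg_frac n f j"
    by (rule common_chart[of "{x}" "{h}"]) (use h \<open>x \<in> Pts point_action\<close> in auto)
  then obtain i j where x: "x = cls (n, a, f, i)" and h: "h = deg_frac n f j" by blast
  show "Act point_action h x \<in> Pts point_action"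
    unfolding x h Act_cls[OF c] by (rule cls_Pts[OF c])
  assume "0 < h"
  then have j: "j > 0"
    using deg_frac_less_iff[OF c] h by simp
  \<comment> \<open>Strictness survives refinement: the slope \<open>s\<close> is positive, so
    \<open>j > 0\<close> periods become \<open>j * s > 0\<close> periods.\<close>
  have "\<not> le (n, a, f, i + j * (int n + 1)) (n, a, f, i)"
  proof
    assume "le (n, a, f, i + j * (int n + 1)) (n, a, f, i)"
    then obtain p z w where w: "refines n a p z w" "w (i + j * (int n + 1)) \<le> w i"
      using le_chartD[OF c] by blast
    obtain s where s: "s > 0" "\<And>t q. w (t + q * (int n + 1)) = w t + q * s * (int p + 1)"
      by (rule refines_slope[OF c w(1)]) (rule that)
    have "j * s * (int p + 1) \<le> 0"
      using w(2) s(2) by simp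
    moreover have "j * s * (int p + 1) > 0"
      using j s(1) by simp
    ultimately show False by simp
  qed
  then show "Leq point_action x (Act point_action h x) \<and> Act point_action h x \<noteq> x"
    unfolding x h Act_cls[OF c] using Leq_cls[OF c c] cls_eq_iff[OF c c] le_chart[OF c] j by simp
next
  fix x y assume xy: "x \<in> Pts point_action" "y \<in> Pts point_action"
  obtain n a f where c: "chart n a f" and "\<exists>i. x = cls (n, a, f, i)" "\<exists>i. y = cls (n, a, f, i)"
    by (rule common_chart[of "{x, y}" "{}"]) (use xy in auto)
  then obtain i k where x: "x = cls (n, a, f, i)" and y: "y = cls (n, a, f, k)" by blast
  show "Leq point_action x y \<or> Leq point_action y x"
    unfolding x y using Leq_cls[OF c c] le_total[OF c c] by simp
  show "x = y" if "Leq point_action x y" "Leq point_action y x"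
    using that unfolding x y using Leq_cls[OF c c] cls_eq_iff[OF c c] by simp
  \<comment> \<open>As a period has length at least 1, this many periods carry \<open>i\<close> at
    least to \<open>k\<close>.\<close>
  have "i + max 0 (k - i) * (int n + 1) \<ge> k"
    using mult_left_mono[of 1 "int n + 1" "max 0 (k - i)"] by simp
  then have "Leq point_action y (Act point_action (deg_frac n f (max 0 (k - i))) x)"
    unfolding x y Act_cls[OF c] Leq_cls[OF c c] by (rule le_chart[OF c])
  moreover have "0 \<le> deg_frac n f (max 0 (k - i))"
    using chart_deg[OF c] by (simp add: deg_frac_def)
  ultimately show "\<exists>h\<in>Grp point_action. 0 \<le> h \<and> Leq point_action y (Act point_action h x)"
    using deg_frac_Grp[OF c] by blast
next
  fix x y z assume xyz: "x \<in> Pts point_action" "y \<in> Pts point_action" "z \<in> Pts point_action"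
    "Leq point_action x y" "Leq point_action y z"
  obtain n a f where c: "chart n a f" and "\<exists>i. x = cls (n, a, f, i)" "\<exists>i. y = cls (n, a, f, i)"
    "\<exists>i. z = cls (n, a, f, i)"
    by (rule common_chart[of "{x, y, z}" "{}"]) (use xyz in auto)
  then obtain i k l where x: "x = cls (n, a, f, i)" and y: "y = cls (n, a, f, k)" and z: "z = cls (n, a, f, l)"
    by blast
  show "Leq point_action x z"
    using xyz(4,5) unfolding x y z Leq_cls[OF c c] by (rule le_trans[OF c c c])
next
  fix h k x assume hk: "h \<in> Grp point_action" "k \<in> Grp point_action" "x \<in> Pts point_action"
  obtain n a f where c: "chart n a f" and "\<exists>i. x = cls (n, a, f, i)" "\<exists>j. h = deg_frac n f j" "\<exists>j. k = deg_frac n f j"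
    by (rule common_chart[of "{x}" "{h, k}"]) (use hk in auto)
  then obtain i j l where x: "x = cls (n, a, f, i)" and h: "h = deg_frac n f j" and k: "k = deg_frac n f l" by blast
  show "Act point_action (h + k) x = Act point_action h (Act point_action k x)"
    unfolding x h k deg_frac_add Act_cls[OF c] by (simp add: algebra_simps)
next
  fix h x y assume hxy: "h \<in> Grp point_action" "x \<in> Pts point_action" "y \<in> Pts point_action"
    "Leq point_action x y"
  obtain n a f where c: "chart n a f" and "\<exists>i. x = cls (n, a, f, i)" "\<exists>i. y = cls (n, a, f, i)"
    "\<exists>j. h = deg_frac n f j"
    by (rule common_chart[of "{x, y}" "{h}"]) (use hxy in auto)
  then obtain i k j where x: "x = cls (n, a, f, i)" and y: "y = cls (n, a, f, k)" and h: "h = deg_frac n f j"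
    by blast
  show "Leq point_action (Act point_action h x) (Act point_action h y)"
    using hxy(4) unfolding x y h Act_cls[OF c] Leq_cls[OF c c] by (rule le_chart_shift[OF c])
qed

end

text \<open>Values on one block and a period extend to \<int>. The wrap condition is monotonicity
  from the end of a block to the beginning of the next.\<close>

lemma periodic_extension:
  fixes i :: "int \<Rightarrow> int"
  assumes step: "\<And>t. 0 \<le> t \<Longrightarrow> t < int n \<Longrightarrow> i t \<le> i (t + 1)"
    and wrap: "i (int n) \<le> i 0 + k * (int m + 1)" and k: "k > 0"
  shows "epicyclic_map n m (\<lambda>t. i (t mod (int n + 1)) + t div (int n + 1) * k * (int m + 1))"
    (is "epicyclic_map n m ?U")
proof -
  have N: "int n + 1 > 0" by simp
  have 1: "?U t \<le> ?U (t + 1)" for t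
  proof (cases "t mod (int n + 1) = int n")
    case True
    then show ?thesis
      using div_mod_Suc_int[OF N, of t] wrap by (simp add: distrib_right)
  next
    case False
    have "0 \<le> t mod (int n + 1)" "t mod (int n + 1) < int n + 1"
      using pos_mod_sign[OF N] pos_mod_bound[OF N] by blast+
    then show ?thesis
      using False div_mod_Suc_int[OF N, of t] step[of "t mod (int n + 1)"] by simp
  qed
  have "?U s \<le> ?U t" if "s \<le> t" for s t
    using that
  proof (induction t rule: int_ge_induct)
    case base
    show ?case by (rule order_refl)
  next
    case (step i)
    show ?case by (rule order_trans[OF step.IH 1])
  qed
  moreover have "?U (t + int n + 1) = ?U t + k * (int m + 1)" for t
  proof -
    have "(t + int n + 1) mod (int n + 1) = t mod (int n + 1)"
      "(t + int n + 1) div (int n + 1) = t div (int n + 1) + 1"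
      using N div_add_self2[of "int n + 1" t] mod_add_self2[of t "int n + 1"] by (simp_all add: add.assoc)
    then show ?thesis
      by (simp add: distrib_right)
  qed
  ultimately show ?thesis
    unfolding epicyclic_map_def mono_def using k by blast
qed

section \<open>The flat functor compared with the functor of its action\<close>

context flat_functor
begin

text \<open>Finitely many inequalities of the colimit are realised by one refinement: the refinement
  added for a new inequality is monotone and keeps the earlier ones.\<close>

lemma refines_le:
  assumes c: "chart n x f" and I: "finite I" "\<And>i j. (i, j) \<in> I \<Longrightarrow> le (n, x, f, i) (n, x, f, j)"
  shows "\<exists>p z w. refines n x p z w \<and> (\<forall>(i, j)\<in>I. w i \<le> w j)"
  using I
proof (induction rule: finite_induct)
  case empty
  then show ?case using refines_id[OF c] by blast
next
  case (insert a I)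
  obtain i j where a: "a = (i, j)" by (cases a)
  obtain p z w where w: "refines n x p z w" "\<forall>(i, j)\<in>I. w i \<le> w j"
    using insert.IH insert.prems by (meson insertCI)
  have cw: "chart p z (w \<circ> f)"
    using chart_refines[OF c w(1)] .
  have "le (n, x, f, i) (n, x, f, j)"
    using insert.prems a by blast
  then have "Leq point_action (cls (n, x, f, i)) (cls (n, x, f, j))"
    using Leq_cls[OF c c] by simp
  then have "le (p, z, w \<circ> f, w i) (p, z, w \<circ> f, w j)"
    using Leq_cls[OF cw cw, of "w i" "w j"] unfolding cls_refines[OF c w(1)] by simp
  then obtain q y v where v: "refines p z q y v" "v (w i) \<le> v (w j)"
    using le_chartD[OF cw] by blast
  have "v s \<le> v t" if "s \<le> t" for s t
    using that v(1) epicyclic_map_mono unfolding refines_def by blast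
  then have "\<forall>(i, j)\<in>insert a I. (v \<circ> w) i \<le> (v \<circ> w) j"
    using w(2) v(2) a by auto
  then show ?case
    using refines_comp[OF w(1) v(1)] by blast
qed

text \<open>The periodic map that \<open>y\<close> induces on the colimit. Since \<open>y\<close>
  need not restrict to the base point, it may have no chart of its own, and it borrows one from an
  element above both \<open>y\<close> and \<open>x0\<close>.\<close>

definition covers :: "nat \<Rightarrow> 'u \<Rightarrow> (int \<Rightarrow> 'u) \<Rightarrow> bool" where
  "covers n y e \<longleftrightarrow> (\<exists>p z v u. chart p z v \<and> refines n y p z u \<and> e = (\<lambda>t. cls (p, z, v, u t)))"

lemma exists_covers:
  assumes y: "y \<in> on_ob F n"
  shows "\<exists>e. covers n y e"
proof -
  obtain p u v z where "z \<in> on_ob F p" "epicyclic_map n p u" "epicyclic_map 0 p v"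
    "restr F p n u z = y" "restr F p 0 v z = x0"
    by (rule R_joint[OF y x0]) (rule that)
  then show ?thesis
    unfolding covers_def chart_def refines_def by blast
qed

lemma covers_periodic:
  assumes "covers n y e"
  shows "e \<in> periodic point_action n"
proof -
  obtain p z v u where c: "chart p z v" and u: "refines n y p z u" and e: "e = (\<lambda>t. cls (p, z, v, u t))"
    using assms unfolding covers_def by blast
  have em: "epicyclic_map n p u"
    using u by (simp add: refines_def)
  obtain s where s: "s > 0" "\<And>t. u (t + int n + 1) = u t + s * (int p + 1)"
    "\<And>t q. u (t + q * (int n + 1)) = u t + q * s * (int p + 1)"
    using em by (rule epicyclic_mapE) (rule that)
  show ?thesis
    unfolding periodic_def mem_Collect_eq
  proof (intro conjI allI impI bexI)
    show "e t \<in> Pts point_action" for t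
      unfolding e by (rule cls_Pts[OF c])
    show "Leq point_action (e t) (e t')" if "t \<le> t'" for t t'
      unfolding e Leq_cls[OF c c] by (rule le_chart[OF c epicyclic_map_mono[OF em that]])
    show "0 < deg_frac p v s"
      using deg_frac_less_iff[OF c] s(1) by simp
    show "deg_frac p v s \<in> Grp point_action"
      by (rule deg_frac_Grp[OF c])
    show "e (t + int n + 1) = Act point_action (deg_frac p v s) (e t)" for t
      unfolding e Act_cls[OF c] s(2) ..
  qed
qed

lemma covers_comp:
  assumes "covers n y e" and g: "epicyclic_map m n g"
  shows "covers m (restr F n m g y) (e \<circ> g)"
proof -
  obtain p z v u where c: "chart p z v" and u: "refines n y p z u" and e: "e = (\<lambda>t. cls (p, z, v, u t))"
    using assms unfolding covers_def by blast
  have "refines m (restr F n m g y) p z (u \<circ> g)"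
    using u R_comp[of n p u m g z] epicyclic_map_comp[OF g] g by (auto simp: refines_def)
  moreover have "e \<circ> g = (\<lambda>t. cls (p, z, v, (u \<circ> g) t))"
    by (simp add: e o_def)
  ultimately show ?thesis
    using c unfolding covers_def by blast
qed

text \<open>In a common refinement \<open>a\<close> of the two charts, \<open>U \<circ> u\<close>
  and \<open>V \<circ> u'\<close> both restrict \<open>a\<close> to \<open>y\<close>. Equalising
  them leaves a shift by \<open>s * (r + 1)\<close>, and on the colimit this shift is a
  translation.\<close>

lemma covers_translates:
  assumes "covers n y e" "covers n y e'"
  shows "translates point_action e e'"
proof -
  obtain p z v u where c: "chart p z v" and u: "refines n y p z u" and e: "e = (\<lambda>t. cls (p, z, v, u t))"
    using assms(1) unfolding covers_def by blast
  obtain p' z' v' u' where c': "chart p' z' v'" and u': "refines n y p' z' u'"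
    and e': "e' = (\<lambda>t. cls (p', z', v', u' t))"
    using assms(2) unfolding covers_def by blast
  obtain q a U V where U: "refines p z q a U" and V: "refines p' z' q a V" and UV: "U \<circ> v = V \<circ> v'"
    using chart_joint[OF c c'] by blast
  have Uu: "refines n y q a (U \<circ> u)" and Vu: "refines n y q a (V \<circ> u')"
    using refines_comp[OF u U] refines_comp[OF u' V] .
  have pre: "a \<in> on_ob F q" "epicyclic_map n q (U \<circ> u)" "epicyclic_map n q (V \<circ> u')"
    "restr F q n (U \<circ> u) a = restr F q n (V \<circ> u') a"
    using Uu Vu by (auto simp: refines_def)
  obtain r w b s where w: "b \<in> on_ob F r" "epicyclic_map q r w" "restr F r q w b = a"
    and s: "\<And>t. w ((V \<circ> u') t) = w ((U \<circ> u) t) + s * (int r + 1)"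
    by (rule R_equalize[OF pre]) (rule that)
  have rw: "refines q a r b w"
    using w by (simp add: refines_def)
  have WU: "refines p z r b (w \<circ> U)" and WV: "refines p' z' r b (w \<circ> V)"
    using refines_comp[OF U rw] refines_comp[OF V rw] .
  let ?f = "w \<circ> U \<circ> v"
  have f': "w \<circ> V \<circ> v' = ?f"
    using UV by (simp add: comp_assoc)
  have C: "chart r b ?f"
    using chart_refines[OF c WU] .
  have "e' t = Act point_action (deg_frac r ?f s) (e t)" for t
  proof -
    have "e' t = cls (r, b, ?f, (w \<circ> V) (u' t))"
      unfolding e' using cls_refines[OF c' WV, of "u' t"] f' by simp
    also have "\<dots> = cls (r, b, ?f, (w \<circ> U) (u t) + s * (int r + 1))"
      using s[of t] by simp
    also have "\<dots> = Act point_action (deg_frac r ?f s) (cls (r, b, ?f, (w \<circ> U) (u t)))"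
      unfolding Act_cls[OF C] ..
    also have "cls (r, b, ?f, (w \<circ> U) (u t)) = e t"
      unfolding e using cls_refines[OF c WU, of "u t"] by simp
    finally show ?thesis .
  qed
  then show ?thesis
    unfolding translates_def using deg_frac_Grp[OF C] by blast
qed

text \<open>In a common refinement the translation is absorbed into one of the two maps. They then
  agree in the colimit, hence at finitely many indices after one more refinement, hence everywhere.
  So \<open>y\<close> and \<open>y'\<close> are restrictions of one element along the same
  map.\<close>

lemma covers_inj:
  assumes "covers n y e" "covers n y' e'" "translates point_action e e'"
  shows "y = y'"
proof -
  obtain p z v u where c: "chart p z v" and u: "refines n y p z u" and e: "e = (\<lambda>t. cls (p, z, v, u t))"
    using assms(1) unfolding covers_def by blast
  obtain p' z' v' u' where c': "chart p' z' v'" and u': "refines n y' p' z' u'"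
    and e': "e' = (\<lambda>t. cls (p', z', v', u' t))"
    using assms(2) unfolding covers_def by blast
  obtain h where h: "h \<in> Grp point_action" "\<And>t. e' t = Act point_action h (e t)"
    using assms(3) unfolding translates_def by blast
  obtain m x f where c2: "chart m x f" "h \<in> range (deg_frac m f)"
    using h(1) unfolding Grp_point_action by blast
  obtain q a U V where U: "refines p z q a U" and V: "refines p' z' q a V" and UV: "U \<circ> v = V \<circ> v'"
    using chart_joint[OF c c'] by blast
  have C: "chart q a (U \<circ> v)"
    using chart_refines[OF c U] .
  \<comment> \<open>A further refinement makes \<open>h\<close> a whole number \<open>j\<close> of
    periods of the chart.\<close>
  obtain r b w w2 where w: "refines q a r b w" "range (deg_frac m f) \<subseteq> range (deg_frac r (w \<circ> (U \<circ> v)))"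
    using chart_common[OF C c2(1)] by blast
  have WU: "refines p z r b (w \<circ> U)" and WV: "refines p' z' r b (w \<circ> V)"
    using refines_comp[OF U w(1)] refines_comp[OF V w(1)] .
  let ?f = "w \<circ> U \<circ> v"
  have f': "w \<circ> V \<circ> v' = ?f"
    using UV by (simp add: comp_assoc)
  have D: "chart r b ?f"
    using chart_refines[OF c WU] .
  obtain j where j: "h = deg_frac r ?f j"
    using c2(2) w(2) by (auto simp: comp_assoc)
  \<comment> \<open>\<open>A\<close> includes the translation by \<open>h\<close>. The shift by
    \<open>j * (r + 1)\<close> changes the representative but not its class, so \<open>A\<close>
    still restricts \<open>b\<close> to \<open>y\<close>.\<close>
  define A B where "A = (\<lambda>t. (w \<circ> U \<circ> u) t + j * (int r + 1))" and "B = w \<circ> V \<circ> u'"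
  have rA: "restr F r n A b = y" "epicyclic_map n r A"
    using refines_comp[OF u WU] R_shift[of r n "w \<circ> U \<circ> u" j b] epicyclic_map_shift[of n r "w \<circ> U \<circ> u" j]
    by (simp_all only: A_def refines_def)
  have rB: "restr F r n B b = y'" "epicyclic_map n r B"
    using refines_comp[OF u' WV] by (simp_all only: B_def refines_def)
  have b: "b \<in> on_ob F r"
    using w(1) by (simp add: refines_def)
  have eq: "cls (r, b, ?f, A t) = cls (r, b, ?f, B t)" for t
  proof -
    have "cls (r, b, ?f, A t) = Act point_action h (cls (r, b, ?f, (w \<circ> U) (u t)))"
      unfolding j Act_cls[OF D] by (simp add: A_def)
    also have "cls (r, b, ?f, (w \<circ> U) (u t)) = e t"
      unfolding e using cls_refines[OF c WU, of "u t"] by simp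
    also have "Act point_action h (e t) = e' t"
      using h(2) by simp
    also have "e' t = cls (r, b, ?f, B t)"
      unfolding e' using cls_refines[OF c' WV, of "u' t"] f' by (simp add: B_def)
    finally show ?thesis .
  qed
  \<comment> \<open>Equality at the \<open>n + 2\<close> arguments that determine an epicyclic map,
    written as inequalities in both directions.\<close>
  define I where "I = (\<lambda>t. (A t, B t)) ` {0..int n + 1} \<union> (\<lambda>t. (B t, A t)) ` {0..int n + 1}"
  have I: "finite I" "\<And>i k. (i, k) \<in> I \<Longrightarrow> le (r, b, ?f, i) (r, b, ?f, k)"
    using eq cls_eq_iff[OF D D] unfolding I_def by auto
  obtain q' d g where g: "refines r b q' d g" "\<forall>(i, k)\<in>I. g i \<le> g k"
    using refines_le[OF D I] by blast
  have gm: "epicyclic_map r q' g" "d \<in> on_ob F q'" "restr F q' r g d = b"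
    using g(1) by (auto simp: refines_def)
  have "g (A t) = g (B t)" if "0 \<le> t" "t \<le> int n + 1" for t
  proof -
    have "(A t, B t) \<in> I" "(B t, A t) \<in> I"
      using that unfolding I_def by auto
    then have "g (A t) \<le> g (B t)" "g (B t) \<le> g (A t)"
      using g(2) by blast+
    then show ?thesis by simp
  qed
  then have gAB: "g \<circ> A = g \<circ> B"
    by (intro epicyclic_map_eqI[OF epicyclic_map_comp[OF rA(2) gm(1)] epicyclic_map_comp[OF rB(2) gm(1)]]) simp
  have "y = restr F q' n (g \<circ> A) d"
    using R_comp[OF gm(1) rA(2) gm(2)] gm(3) rA(1) by simp
  also have "\<dots> = y'"
    using R_comp[OF gm(1) rB(2) gm(2)] gm(3) rB(1) gAB by simp
  finally show ?thesis .
qed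

text \<open>One period of values and the period itself are visible in a single chart, where
  \<open>e\<close> becomes a list of indices. These increase only in the colimit, so a refinement
  first realises the finitely many inequalities. The periodic extension \<open>U\<close> is then a
  map of the epicyclic category, and the required element is the restriction along it.\<close>

lemma covers_surj:
  assumes e: "e \<in> periodic point_action n"
  shows "\<exists>y\<in>on_ob F n. covers n y e"
proof -
  interpret arch_action point_action by (rule arch_action_point_action)
  obtain h where h: "h \<in> Grp point_action" "0 < h" "\<And>t. e (t + int n + 1) = Act point_action h (e t)"
    "\<And>t q. e (t + q * (int n + 1)) = Act point_action (of_int q * h) (e t)"
    using e by (rule periodicE) (rule that)
  have sub: "e ` {0..int n} \<subseteq> Pts point_action"
    using periodic_Pts[OF e] by blast
  obtain p z f where c: "chart p z f" and S: "\<And>\<xi>. \<xi> \<in> e ` {0..int n} \<Longrightarrow> \<exists>i. \<xi> = cls (p, z, f, i)"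
    and K: "\<And>k. k \<in> {h} \<Longrightarrow> \<exists>j. k = deg_frac p f j"
    by (rule common_chart[of "e ` {0..int n}" "{h}"]) (use sub h(1) in auto)
  obtain j where j: "h = deg_frac p f j"
    using K by blast
  have j0: "j > 0"
    using h(2) deg_frac_less_iff[OF c] j by simp
  have "\<forall>t\<in>{0..int n}. \<exists>i. e t = cls (p, z, f, i)"
    using S by blast
  then obtain i where i: "\<And>t. t \<in> {0..int n} \<Longrightarrow> e t = cls (p, z, f, i t)"
    by metis
  \<comment> \<open>The steps inside one period and the step that closes it, from the last index to
    the first one moved by \<open>h\<close>.\<close>
  define I where "I = insert (i (int n), i 0 + j * (int p + 1)) ((\<lambda>t. (i t, i (t + 1))) ` {0..<int n})"
  have "le (p, z, f, i t) (p, z, f, i (t + 1))" if "t \<in> {0..<int n}" for t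
  proof -
    have "Leq point_action (e t) (e (t + 1))"
      using periodic_mono[OF e] by simp
    then show ?thesis
      using i[of t] i[of "t + 1"] that Leq_cls[OF c c] by simp
  qed
  moreover have "le (p, z, f, i (int n)) (p, z, f, i 0 + j * (int p + 1))"
  proof -
    have "Leq point_action (e (int n)) (e (0 + int n + 1))"
      by (rule periodic_mono[OF e]) simp
    moreover have "e (0 + int n + 1) = cls (p, z, f, i 0 + j * (int p + 1))"
      unfolding h(3) j using i[of 0] Act_cls[OF c] by simp
    ultimately show ?thesis
      using i[of "int n"] Leq_cls[OF c c] by simp
  qed
  ultimately have "\<And>a b. (a, b) \<in> I \<Longrightarrow> le (p, z, f, a) (p, z, f, b)"
    unfolding I_def by auto
  moreover have "finite I"
    by (simp add: I_def)
  ultimately obtain r b w where w: "refines p z r b w" "\<forall>(a, b)\<in>I. w a \<le> w b"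
    using refines_le[OF c, of I] by blast
  obtain s where s: "s > 0" "\<And>t q. w (t + q * (int p + 1)) = w t + q * s * (int r + 1)"
      "\<And>j. deg_frac p f j = deg_frac r (w \<circ> f) (j * s)"
    by (rule refines_slope[OF c w(1)]) (rule that)
  have C: "chart r b (w \<circ> f)"
    using chart_refines[OF c w(1)] .
  \<comment> \<open>The refinement has slope \<open>s\<close>, so the \<open>j\<close> periods of
    the old chart in \<open>h\<close> become \<open>j * s\<close> periods of the new one.\<close>
  define U where "U = (\<lambda>t. w (i (t mod (int n + 1))) + t div (int n + 1) * (j * s) * (int r + 1))"
  have "w (i t) \<le> w (i (t + 1))" if "0 \<le> t" "t < int n" for t
  proof -
    have "(i t, i (t + 1)) \<in> I"
      using that unfolding I_def by auto
    then show ?thesis using w(2) by blast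
  qed
  moreover have "w (i (int n)) \<le> w (i 0) + j * s * (int r + 1)"
  proof -
    have "(i (int n), i 0 + j * (int p + 1)) \<in> I"
      unfolding I_def by blast
    then have "w (i (int n)) \<le> w (i 0 + j * (int p + 1))"
      using w(2) by blast
    then show ?thesis
      unfolding s(2) .
  qed
  ultimately have U: "epicyclic_map n r U"
    unfolding U_def using j0 s(1) by (intro periodic_extension[where i = "\<lambda>t. w (i t)"]) simp_all
  have b: "b \<in> on_ob F r"
    using w(1) by (simp add: refines_def)
  have eU: "e t = cls (r, b, w \<circ> f, U t)" for t
  proof -
    let ?r = "t mod (int n + 1)" and ?q = "t div (int n + 1)"
    have r: "?r \<in> {0..int n}"
      using pos_mod_sign[of "int n + 1" t] pos_mod_bound[of "int n + 1" t] by simp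
    have qh: "of_int ?q * h = deg_frac r (w \<circ> f) (?q * (j * s))"
      unfolding j s(3) by (simp add: deg_frac_def)
    have "e t = e (?r + ?q * (int n + 1))"
      by (metis add.commute div_mult_mod_eq)
    also have "\<dots> = Act point_action (of_int ?q * h) (e ?r)"
      by (rule h(4))
    also have "e ?r = cls (r, b, w \<circ> f, w (i ?r))"
      using i[OF r] cls_refines[OF c w(1)] by simp
    also have "Act point_action (of_int ?q * h) \<dots> = cls (r, b, w \<circ> f, U t)"
      unfolding qh Act_cls[OF C] U_def ..
    finally show ?thesis .
  qed
  have "refines n (restr F r n U b) r b U"
    using U b by (simp add: refines_def)
  then have "covers n (restr F r n U b) e"
    unfolding covers_def using C eU by blast
  then show ?thesis
    using R_closed[OF U b] by blast
qed

definition theta :: "nat \<Rightarrow> 'u \<Rightarrow> 'u" where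
  "theta n = (\<lambda>y\<in>on_ob F n. code point_action n (SOME e. covers n y e))"

lemma theta_covers:
  assumes "y \<in> on_ob F n" "covers n y e"
  shows "theta n y = code point_action n e"
proof -
  have 1: "covers n y (SOME e. covers n y e)"
    by (rule someI[of "covers n y", OF assms(2)])
  show ?thesis
    using code_eq_iff[OF arch_action_point_action covers_periodic[OF 1] covers_periodic[OF assms(2)]]
      covers_translates[OF 1 assms(2)] assms(1) by (simp add: theta_def)
qed

lemma bij_theta: "bij_betw (theta n) (on_ob F n) (on_ob (points_ftor point_action) n)"
  unfolding bij_betw_def on_ob_points_ftor
proof
  show "inj_on (theta n) (on_ob F n)"
  proof (rule inj_onI)
    fix y y' assume y: "y \<in> on_ob F n" and y': "y' \<in> on_ob F n" and eq: "theta n y = theta n y'"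
    obtain e e' where e: "covers n y e" and e': "covers n y' e'"
      using exists_covers[OF y] exists_covers[OF y'] by blast
    have "translates point_action e e'"
      using eq code_eq_iff[OF arch_action_point_action covers_periodic[OF e] covers_periodic[OF e']]
      unfolding theta_covers[OF y e] theta_covers[OF y' e'] by simp
    then show "y = y'"
      using covers_inj[OF e e'] by blast
  qed
  show "theta n ` on_ob F n = code point_action n ` periodic point_action n"
  proof (intro equalityI image_subsetI)
    fix y assume y: "y \<in> on_ob F n"
    obtain e where e: "covers n y e"
      using exists_covers[OF y] by blast
    show "theta n y \<in> code point_action n ` periodic point_action n"
      unfolding theta_covers[OF y e] using covers_periodic[OF e] by (rule imageI)
  next
    fix e assume "e \<in> periodic point_action n"
    then obtain y where y: "y \<in> on_ob F n" "covers n y e"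
      using covers_surj by blast
    then show "code point_action n e \<in> theta n ` on_ob F n"
      using theta_covers[OF y] by (metis imageI)
  qed
qed

lemma theta_natural:
  assumes f: "epicyclic_map m n f" and y: "y \<in> on_ob F n"
  shows "theta m (restr F n m f y) = restr (points_ftor point_action) n m f (theta n y)"
proof -
  obtain e where e: "covers n y e"
    using exists_covers[OF y] by blast
  show ?thesis
    unfolding theta_covers[OF y e] theta_covers[OF R_closed[OF f y] covers_comp[OF e f]]
    using restr_points_ftor[OF arch_action_point_action covers_periodic[OF e] f] by simp
qed

end

section \<open>Essential surjectivity of the functor of points\<close>

lemma iso_in_pointsI:
  fixes F G :: "(nat, (int \<Rightarrow> int) set, 'u set, 'u \<Rightarrow> 'u) ftor"
  assumes F: "is_ftor epi_op Sets F" and G: "is_ftor epi_op Sets G"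
    and bij: "\<And>n. bij_betw (\<tau> n) (on_ob F n) (on_ob G n)"
    and nat: "\<And>n m f x. epicyclic_map m n f \<Longrightarrow> x \<in> on_ob F n \<Longrightarrow>
      \<tau> m (restr F n m f x) = restr G n m f (\<tau> n x)"
  shows "\<exists>\<sigma>. iso_in (presheaf_topos_points epi_op) G F \<sigma>"
proof -
  define \<rho> where "\<rho> n = (\<lambda>x\<in>on_ob F n. \<tau> n x)" for n
  \<comment> \<open>The bijections start at \<open>F\<close>, while essential surjectivity asks for
    an isomorphism that ends there; so the inverse is the one returned.\<close>
  define \<sigma> where "\<sigma> n = (\<lambda>y\<in>on_ob G n. inv_into (on_ob F n) (\<tau> n) y)" for n
  have t: "\<tau> n x \<in> on_ob G n" if "x \<in> on_ob F n" for n x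
    using bij[of n] that by (auto simp: bij_betw_def)
  have i: "inv_into (on_ob F n) (\<tau> n) y \<in> on_ob F n" "\<tau> n (inv_into (on_ob F n) (\<tau> n) y) = y"
    if "y \<in> on_ob G n" for n y
    using bij[of n] that by (auto simp: bij_betw_def inv_into_into f_inv_into_f)
  have it: "inv_into (on_ob F n) (\<tau> n) (\<tau> n x) = x" if "x \<in> on_ob F n" for n x
    using bij[of n] that by (simp add: bij_betw_def)
  have RF: "restr F n m f x \<in> on_ob F m" if "epicyclic_map m n f" "x \<in> on_ob F n" for n m f x
    using F that unfolding is_ftor_epi_op_iff by blast
  have RG: "restr G n m f x \<in> on_ob G m" if "epicyclic_map m n f" "x \<in> on_ob G n" for n m f x
    using G that unfolding is_ftor_epi_op_iff by blast
  have "\<rho> \<in> Hom (presheaf_topos_points epi_op) F G"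
    unfolding Hom_points mem_Collect_eq is_nat_trans_epi_op_iff[OF F G]
    using t nat RF by (auto simp: \<rho>_def Ob_epi_op)
  moreover have "\<sigma> \<in> Hom (presheaf_topos_points epi_op) G F"
  proof -
    have "\<sigma> m (restr G n m f y) = restr F n m f (\<sigma> n y)" if f: "epicyclic_map m n f" and y: "y \<in> on_ob G n" for n m f y
    proof -
      have "\<tau> m (restr F n m f (\<sigma> n y)) = restr G n m f y"
        using nat[OF f, of "\<sigma> n y"] i y by (simp add: \<sigma>_def)
      then show ?thesis
        using it[of "restr F n m f (\<sigma> n y)" m] RF[OF f, of "\<sigma> n y"] i y RG[OF f y] by (simp add: \<sigma>_def)
    qed
    then show ?thesis
      unfolding Hom_points mem_Collect_eq is_nat_trans_epi_op_iff[OF G F]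
      using i by (auto simp: \<sigma>_def Ob_epi_op)
  qed
  moreover have "compose (on_ob F n) (\<sigma> n) (\<rho> n) = (\<lambda>x\<in>on_ob F n. x)" for n
    using t it by (auto simp: \<sigma>_def \<rho>_def compose_def)
  moreover have "compose (on_ob G n) (\<rho> n) (\<sigma> n) = (\<lambda>x\<in>on_ob G n. x)" for n
    using i by (auto simp: \<sigma>_def \<rho>_def compose_def)
  ultimately have "iso_in (presheaf_topos_points epi_op) G F \<sigma>"
    unfolding iso_in_def by (auto simp: Comp_points Id_points intro!: bexI[of _ \<rho>])
  then show ?thesis by blast
qed

lemma points_functor_ess_surj:
  assumes "F \<in> Ob (presheaf_topos_points epi_op)"
  shows "\<exists>A\<in>Ob arch_actions. \<exists>\<tau>. iso_in (presheaf_topos_points epi_op) (points_ftor A) F \<tau>"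
proof -
  have F: "is_ftor epi_op Sets F" and cof: "cofiltered (elements_category epi_op F)"
    using assms by (auto simp: Ob_points flat_def)
  obtain n x where x: "x \<in> on_ob F n"
    using cof unfolding cofiltered_elements_iff by blast
  \<comment> \<open>A base point arises from any element by restriction along a map of degree 1 from
    the object 0.\<close>
  have "restr F n 0 (\<lambda>t. t * (int n + 1)) x \<in> on_ob F 0"
    using F epicyclic_map_const x unfolding is_ftor_epi_op_iff by blast
  then interpret flat_functor F "restr F n 0 (\<lambda>t. t * (int n + 1)) x"
    by unfold_locales (use F cof in auto)
  show ?thesis
    using iso_in_pointsI[OF F is_ftor_points_ftor[OF arch_action_point_action] bij_theta theta_natural]
      arch_action_point_action Ob_arch_actions by blast
qed

lemma is_equivalence_points_functor:
  "is_equivalence arch_actions (presheaf_topos_points epi_op) points_functor"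
  unfolding is_equivalence_def
proof (intro conjI ballI)
  show "is_ftor arch_actions (presheaf_topos_points epi_op) points_functor"
    by (rule is_ftor_points_functor)
next
  fix A B :: "'a action" assume "A \<in> Ob arch_actions" "B \<in> Ob arch_actions"
  then have A: "arch_action A" and B: "arch_action B"
    by (auto simp: Ob_arch_actions)
  show "bij_betw (on_arr points_functor A B) (Hom arch_actions A B)
      (Hom (presheaf_topos_points epi_op) (on_ob points_functor A) (on_ob points_functor B))"
    unfolding bij_betw_def points_functor_def
    using points_faithful[OF A B] points_full[OF A B] points_arr_Hom[OF A B]
    by (auto simp: inj_on_def image_iff) (metis)
next
  fix F :: "(nat, (int \<Rightarrow> int) set, 'a set, 'a \<Rightarrow> 'a) ftor"
  assume "F \<in> Ob (presheaf_topos_points epi_op)"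
  then show "\<exists>A\<in>Ob arch_actions. \<exists>\<tau>. iso_in (presheaf_topos_points epi_op) (on_ob points_functor A) F \<tau>"
    using points_functor_ess_surj by (simp add: points_functor_def)
qed

section \<open>Archimedean semimodules as archimedean actions\<close>

text \<open>Additive coordinates on a semifield: \<open>v\<close> inverts an isomorphism onto
  \<open>Hmax H\<close> on the non-zero elements, so products become sums and sums become
  maxima.\<close>

locale valuation = semifield K for K :: "('k, 'r) ring_scheme" (structure) +
  fixes H :: "rat set" and v :: "rat \<Rightarrow> 'k"
  assumes Ints_sub: "\<int> \<subseteq> H"
    and H_diff: "\<lbrakk>h \<in> H; k \<in> H\<rbrakk> \<Longrightarrow> h - k \<in> H"
    and v_bij: "bij_betw v H (carrier K - {\<zero>\<^bsub>K\<^esub>})"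
    and v_0: "v 0 = \<one>\<^bsub>K\<^esub>"
    and v_add: "\<lbrakk>h \<in> H; k \<in> H\<rbrakk> \<Longrightarrow> v (h + k) = v h \<otimes>\<^bsub>K\<^esub> v k"
    and v_max: "\<lbrakk>h \<in> H; k \<in> H\<rbrakk> \<Longrightarrow> v (max h k) = v h \<oplus>\<^bsub>K\<^esub> v k"
begin

lemma H_0: "0 \<in> H" and H_1: "1 \<in> H"
  using Ints_sub by auto

lemma H_uminus: "h \<in> H \<Longrightarrow> - h \<in> H"
  using H_diff[OF H_0] by simp

lemma H_add: "h \<in> H \<Longrightarrow> k \<in> H \<Longrightarrow> h + k \<in> H"
  using H_diff[of h "- k"] H_uminus by simp

lemma v_carrier: "h \<in> H \<Longrightarrow> v h \<in> carrier K" and v_nonzero: "h \<in> H \<Longrightarrow> v h \<noteq> \<zero>\<^bsub>K\<^esub>"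
  using v_bij by (auto simp: bij_betw_def)

lemma v_eq_iff: "h \<in> H \<Longrightarrow> k \<in> H \<Longrightarrow> v h = v k \<longleftrightarrow> h = k"
  using v_bij by (auto simp: bij_betw_def inj_on_def)

lemma carrier_cases:
  assumes "a \<in> carrier K"
  obtains "a = \<zero>\<^bsub>K\<^esub>" | h where "h \<in> H" "a = v h"
  using assms v_bij by (auto simp: bij_betw_def)

lemma add_le_v_iff: "h \<in> H \<Longrightarrow> k \<in> H \<Longrightarrow> add_le K (v h) (v k) \<longleftrightarrow> h \<le> k"
  unfolding add_le_def using v_max[of h k, symmetric] v_eq_iff[of "max h k" k] by (auto simp: max_def)

lemma v_uminus: "h \<in> H \<Longrightarrow> v (- h) \<otimes>\<^bsub>K\<^esub> v h = \<one>\<^bsub>K\<^esub>"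
  using v_add[of "- h" h] H_uminus v_0 by simp

lemma Units_eq: "Units K = carrier K - {\<zero>\<^bsub>K\<^esub>}"
proof
  show "Units K \<subseteq> carrier K - {\<zero>\<^bsub>K\<^esub>}"
    using one_not_zero unfolding Units_def by auto
qed (rule nonzero_Units)

lemma Units_v: "Units K = v ` H"
  using Units_eq v_bij by (simp add: bij_betw_def)

end

lemma exists_valuation:
  assumes "algebraic_extension_Zmax K"
  shows "\<exists>H v. valuation K H v"
proof -
  interpret semifield K
    using assms by (simp add: algebraic_extension_Zmax_def)
  obtain H where H': "\<int> \<subseteq> H \<and> (\<forall>a\<in>H. \<forall>b\<in>H. a - b \<in> H) \<and> ring_iso K (Hmax H) \<noteq> {}"
    using assms unfolding algebraic_extension_Zmax_def by blast
  then obtain \<psi> where \<psi>: "\<psi> \<in> ring_iso K (Hmax H)" by blast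
  have H: "\<int> \<subseteq> H" "\<And>h k. h \<in> H \<Longrightarrow> k \<in> H \<Longrightarrow> h - k \<in> H"
    using H' by auto
  have hom: "\<psi> \<in> ring_hom K (Hmax H)" and bij: "bij_betw \<psi> (carrier K) (carrier (Hmax H))"
    using \<psi> by (auto simp: ring_iso_def)
  have car: "carrier (Hmax H) = insert None (Some ` H)"
    by (simp add: Hmax_def)
  have H0: "0 \<in> H"
    using H(1) by auto
  have Hadd: "h + k \<in> H" if "h \<in> H" "k \<in> H" for h k
    using H(2)[OF that(1) H(2)[OF H0 that(2)]] by simp
  define \<phi> where "\<phi> = inv_into (carrier K) \<psi>"
  have \<phi>: "\<phi> y \<in> carrier K" "\<psi> (\<phi> y) = y" if "y \<in> insert None (Some ` H)" for y
    using bij that unfolding car \<phi>_def by (auto simp: bij_betw_def inv_into_into f_inv_into_f)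
  have inj: "a = b" if "a \<in> carrier K" "b \<in> carrier K" "\<psi> a = \<psi> b" for a b
    using bij that by (auto simp: bij_betw_def inj_on_def)
  \<comment> \<open>An element of \<open>ring_iso\<close> is only required to respect sums, products
    and one. Zero is recovered by adding it to the preimage of -\<infinity>.\<close>
  have z: "\<psi> \<zero>\<^bsub>K\<^esub> = None"
  proof -
    have "\<psi> (\<zero>\<^bsub>K\<^esub> \<oplus>\<^bsub>K\<^esub> \<phi> None) = \<psi> \<zero>\<^bsub>K\<^esub> \<oplus>\<^bsub>Hmax H\<^esub> \<psi> (\<phi> None)"
      using ring_hom_add[OF hom zero_closed \<phi>(1)[of None]] by (simp del: l_zero)
    then show ?thesis
      using \<phi>[of None] by (auto simp: Hmax_def split: option.splits)
  qed
  have "valuation K H (\<lambda>h. \<phi> (Some h))"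
  proof (unfold_locales)
    show "bij_betw (\<lambda>h. \<phi> (Some h)) H (carrier K - {\<zero>\<^bsub>K\<^esub>})"
      unfolding bij_betw_def
    proof
      show "inj_on (\<lambda>h. \<phi> (Some h)) H"
        by (rule inj_onI) (metis \<phi>(2) image_eqI insertCI option.inject)
      show "(\<lambda>h. \<phi> (Some h)) ` H = carrier K - {\<zero>\<^bsub>K\<^esub>}"
      proof (intro equalityI subsetI)
        fix a assume "a \<in> (\<lambda>h. \<phi> (Some h)) ` H"
        then obtain h where h: "h \<in> H" "a = \<phi> (Some h)" by blast
        then have "a \<in> carrier K" "\<psi> a = Some h"
          using \<phi>[of "Some h"] by auto
        then show "a \<in> carrier K - {\<zero>\<^bsub>K\<^esub>}"
          using z by auto
      next
        fix a assume a: "a \<in> carrier K - {\<zero>\<^bsub>K\<^esub>}"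
        then have "\<psi> a \<noteq> None"
          using inj[of a "\<zero>\<^bsub>K\<^esub>"] z by auto
        moreover have "\<psi> a \<in> insert None (Some ` H)"
          using bij a unfolding car by (auto simp: bij_betw_def)
        ultimately obtain h where h: "h \<in> H" "\<psi> a = Some h" by auto
        then have "a = \<phi> (Some h)"
          using inj[of a "\<phi> (Some h)"] \<phi>[of "Some h"] a by auto
        then show "a \<in> (\<lambda>h. \<phi> (Some h)) ` H"
          using h by blast
      qed
    qed
    show "\<phi> (Some 0) = \<one>\<^bsub>K\<^esub>"
    proof (rule inj)
      have "\<psi> \<one>\<^bsub>K\<^esub> = Some 0"
        using ring_hom_one[OF hom] by (simp add: Hmax_def)
      then show "\<psi> (\<phi> (Some 0)) = \<psi> \<one>\<^bsub>K\<^esub>"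
        using \<phi>(2)[of "Some 0"] H0 by auto
    qed (use \<phi>(1) H0 in auto)
    show "\<phi> (Some (h + k)) = \<phi> (Some h) \<otimes>\<^bsub>K\<^esub> \<phi> (Some k)" if hk: "h \<in> H" "k \<in> H" for h k
    proof (rule inj)
      have "\<psi> (\<phi> (Some h) \<otimes>\<^bsub>K\<^esub> \<phi> (Some k)) = Some h \<otimes>\<^bsub>Hmax H\<^esub> Some k"
        using ring_hom_mult[OF hom, of "\<phi> (Some h)" "\<phi> (Some k)"] \<phi> hk by auto
      then show "\<psi> (\<phi> (Some (h + k))) = \<psi> (\<phi> (Some h) \<otimes>\<^bsub>K\<^esub> \<phi> (Some k))"
        using \<phi>(2)[of "Some (h + k)"] Hadd[OF hk] by (auto simp: Hmax_def)
    qed (use \<phi>(1) hk Hadd in auto)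
    show "\<phi> (Some (max h k)) = \<phi> (Some h) \<oplus>\<^bsub>K\<^esub> \<phi> (Some k)" if hk: "h \<in> H" "k \<in> H" for h k
    proof (rule inj)
      have "\<psi> (\<phi> (Some h) \<oplus>\<^bsub>K\<^esub> \<phi> (Some k)) = Some h \<oplus>\<^bsub>Hmax H\<^esub> Some k"
        using ring_hom_add[OF hom, of "\<phi> (Some h)" "\<phi> (Some k)"] \<phi> hk by auto
      then show "\<psi> (\<phi> (Some (max h k))) = \<psi> (\<phi> (Some h) \<oplus>\<^bsub>K\<^esub> \<phi> (Some k))"
        using \<phi>(2)[of "Some (max h k)"] hk by (auto simp: Hmax_def max_def)
      show "\<phi> (Some (max h k)) \<in> carrier K"
        using \<phi>(1)[of "Some (max h k)"] hk by (auto simp: max_def)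
    qed (use \<phi>(1) hk in auto)
  qed (use H in auto)
  then show ?thesis by blast
qed

text \<open>Additive maps on a subgroup of \<rat> containing \<int> are linear: clearing the
  denominator of \<open>h\<close> compares the value at \<open>h\<close> with the value at
  1.\<close>

lemma additive_rat_scale:
  fixes \<phi> :: "rat \<Rightarrow> rat"
  assumes H: "\<int> \<subseteq> H" "\<And>h k. h \<in> H \<Longrightarrow> k \<in> H \<Longrightarrow> h - k \<in> H"
    and add: "\<And>h k. h \<in> H \<Longrightarrow> k \<in> H \<Longrightarrow> \<phi> (h + k) = \<phi> h + \<phi> k"
    and h: "h \<in> H"
  shows "\<phi> h = \<phi> 1 * h"
proof -
  have H0: "0 \<in> H" and H1: "1 \<in> H"
    using H(1) by auto
  have Hadd: "h + k \<in> H" if "h \<in> H" "k \<in> H" for h k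
    using H(2)[OF that(1) H(2)[OF H0 that(2)]] by simp
  have \<phi>0: "\<phi> 0 = 0"
    using add[OF H0 H0] by simp
  have mult: "of_int j * k \<in> H \<and> \<phi> (of_int j * k) = of_int j * \<phi> k" if k: "k \<in> H" for j k
  proof (induction j rule: int_induct[where k = 0])
    case base
    then show ?case using H0 \<phi>0 by simp
  next
    case (step1 i)
    then show ?case using add[of "of_int i * k" k] Hadd k by (simp add: distrib_right)
  next
    case (step2 i)
    then have m: "of_int (i - 1) * k \<in> H"
      using H(2)[of "of_int i * k" k] k by (simp add: left_diff_distrib)
    then show ?case using step2 add[of "of_int (i - 1) * k" k] k by (simp add: left_diff_distrib)
  qed
  obtain p q where pq: "h = of_int p / of_int q" "q > 0"
    by (metis quotient_of_div quotient_of_denom_pos surj_pair)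
  then have "of_int q * h = of_int p * 1"
    by simp
  then have "of_int q * \<phi> h = of_int p * \<phi> 1"
    using mult[OF h, of q] mult[OF H1, of p] by simp
  then have "of_int q * \<phi> h / of_int q = of_int p * \<phi> 1 / of_int q"
    by simp
  then show ?thesis
    using pq by simp
qed

text \<open>In additive coordinates an embedding of semifields is an additive map
  \<open>\<phi>\<close>, hence multiplication by \<open>\<phi> 1\<close>; its positivity comes from
  the preservation of maxima and from injectivity.\<close>

lemma embedding_scale:
  assumes K: "valuation K H v" and L: "valuation L H' v'"
    and \<sigma>: "\<sigma> \<in> ring_hom K L" "\<sigma> \<zero>\<^bsub>K\<^esub> = \<zero>\<^bsub>L\<^esub>" "inj_on \<sigma> (carrier K)"
  shows "\<exists>c>0. \<forall>h\<in>H. c * h \<in> H' \<and> \<sigma> (v h) = v' (c * h)"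
proof -
  interpret K: valuation K H v by (rule K)
  interpret L: valuation L H' v' by (rule L)
  have "\<exists>k. k \<in> H' \<and> \<sigma> (v h) = v' k" if h: "h \<in> H" for h
  proof -
    have "\<sigma> (v h) \<in> carrier L"
      using ring_hom_closed[OF \<sigma>(1)] K.v_carrier h by blast
    moreover have "\<sigma> (v h) \<noteq> \<zero>\<^bsub>L\<^esub>"
      using \<sigma>(2) inj_onD[OF \<sigma>(3), of "v h" "\<zero>\<^bsub>K\<^esub>"] K.v_carrier[OF h] K.v_nonzero[OF h] K.zero_closed by auto
    ultimately show ?thesis
      using L.carrier_cases by metis
  qed
  then obtain \<phi> where \<phi>: "\<And>h. h \<in> H \<Longrightarrow> \<phi> h \<in> H'" "\<And>h. h \<in> H \<Longrightarrow> \<sigma> (v h) = v' (\<phi> h)"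
    by metis
  have add: "\<phi> (h + k) = \<phi> h + \<phi> k" if hk: "h \<in> H" "k \<in> H" for h k
  proof -
    have "v' (\<phi> (h + k)) = v' (\<phi> h + \<phi> k)"
      using ring_hom_mult[OF \<sigma>(1), of "v h" "v k"] K.v_carrier hk K.v_add[OF hk] \<phi> K.H_add[OF hk] L.v_add
      by (metis)
    then show ?thesis
      using L.v_eq_iff \<phi>(1) K.H_add[OF hk] L.H_add hk by blast
  qed
  have sc: "\<phi> h = \<phi> 1 * h" if "h \<in> H" for h
    using additive_rat_scale[OF K.Ints_sub K.H_diff add that] .
  \<comment> \<open>The sum of \<open>v 0\<close> and \<open>v 1\<close> is their maximum
    \<open>v 1\<close>. Its preservation makes \<open>\<phi> 1\<close> non-negative, and injectivity
    then excludes zero.\<close>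
  have "v' (\<phi> 1) = \<sigma> (v 0 \<oplus>\<^bsub>K\<^esub> v 1)"
    using K.v_max[OF K.H_0 K.H_1] \<phi>(2)[OF K.H_1] by (simp add: max_def)
  also have "\<dots> = v' (max (\<phi> 0) (\<phi> 1))"
    using ring_hom_add[OF \<sigma>(1), of "v 0" "v 1"] K.v_carrier K.H_0 K.H_1 \<phi> L.v_max by metis
  finally have "\<phi> 1 = max (\<phi> 0) (\<phi> 1)"
    using L.v_eq_iff[OF \<phi>(1)[OF K.H_1], of "max (\<phi> 0) (\<phi> 1)"] \<phi>(1) K.H_0 K.H_1 by (auto simp: max_def)
  moreover have "\<phi> 0 = 0"
    using sc[OF K.H_0] by simp
  moreover have "\<phi> 1 \<noteq> 0"
  proof
    assume "\<phi> 1 = 0"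
    then have "\<sigma> (v 1) = \<sigma> (v 0)"
      using \<phi>(2)[OF K.H_0] \<phi>(2)[OF K.H_1] \<open>\<phi> 0 = 0\<close> by simp
    then have "v 1 = v 0"
      using inj_onD[OF \<sigma>(3)] K.v_carrier K.H_0 K.H_1 by blast
    then show False
      using K.v_eq_iff K.H_0 K.H_1 by simp
  qed
  ultimately have "\<phi> 1 > 0"
    by (simp add: max_def split: if_splits)
  then show ?thesis
    using \<phi> sc by metis
qed

text \<open>A semifield determines the subgroup of \<rat> only up to a positive factor. One choice
  of coordinates is fixed for each \<open>K\<close>.\<close>

definition vgrp :: "('k, 'r) ring_scheme \<Rightarrow> rat set" where
  "vgrp K = fst (SOME (H, v). valuation K H v)"

definition vmap :: "('k, 'r) ring_scheme \<Rightarrow> rat \<Rightarrow> 'k" where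
  "vmap K = snd (SOME (H, v). valuation K H v)"

lemma valuation_vmap:
  assumes "algebraic_extension_Zmax K"
  shows "valuation K (vgrp K) (vmap K)"
proof -
  have "\<exists>p. case p of (H, v) \<Rightarrow> valuation K H v"
    using exists_valuation[OF assms] by auto
  from someI_ex[OF this] show ?thesis
    by (simp add: vgrp_def vmap_def case_prod_unfold)
qed

section \<open>The action attached to a semimodule\<close>

definition semimodule_action :: "('k, 'r) ring_scheme \<Rightarrow> ('k, 'e, 's) module_scheme \<Rightarrow> 'e action" where
  "semimodule_action K E = \<lparr>Grp = vgrp K, Pts = carrier E - {\<zero>\<^bsub>E\<^esub>}, Leq = add_le E,
     Act = (\<lambda>h x. vmap K h \<odot>\<^bsub>E\<^esub> x)\<rparr>"

locale valued_semimodule = archimedean_semimodule K E + V: valuation K "vgrp K" "vmap K"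
  for K :: "('k, 'r) ring_scheme" and E :: "('k, 'e, 's) module_scheme"
begin

lemma simps:
  "Grp (semimodule_action K E) = vgrp K"
  "Pts (semimodule_action K E) = carrier E - {\<zero>\<^bsub>E\<^esub>}"
  "Leq (semimodule_action K E) x y \<longleftrightarrow> x \<oplus>\<^bsub>E\<^esub> y = y"
  "Act (semimodule_action K E) h x = vmap K h \<odot>\<^bsub>E\<^esub> x"
  by (simp_all add: semimodule_action_def add_le_def)

lemma smult_nonzero:
  assumes "h \<in> vgrp K" "x \<in> carrier E - {\<zero>\<^bsub>E\<^esub>}"
  shows "vmap K h \<odot>\<^bsub>E\<^esub> x \<in> carrier E - {\<zero>\<^bsub>E\<^esub>}"
proof -
  have "vmap K (- h) \<odot>\<^bsub>E\<^esub> (vmap K h \<odot>\<^bsub>E\<^esub> x) = x"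
    using smult_assoc[of "vmap K (- h)" "vmap K h" x] V.v_uminus V.v_carrier V.H_uminus smult_one assms by simp
  then have "vmap K h \<odot>\<^bsub>E\<^esub> x \<noteq> \<zero>\<^bsub>E\<^esub>"
    using smult_r_null[of "vmap K (- h)"] V.v_carrier V.H_uminus assms by auto
  then show ?thesis
    using smult_closed V.v_carrier assms by simp
qed

lemma arch_action_semimodule_action: "arch_action (semimodule_action K E)"
proof (unfold_locales, unfold simps)
  show "\<int> \<subseteq> vgrp K" by (rule V.Ints_sub)
  show "h - k \<in> vgrp K" if "h \<in> vgrp K" "k \<in> vgrp K" for h k
    using that by (rule V.H_diff)
  show "carrier E - {\<zero>\<^bsub>E\<^esub>} \<noteq> {}"
    using nontrivial E.zero_closed by blast
  show "x \<oplus>\<^bsub>E\<^esub> x = x" if "x \<in> carrier E - {\<zero>\<^bsub>E\<^esub>}" for x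
    using add_is_max[of x x] that by auto
  show "x = y" if "x \<in> carrier E - {\<zero>\<^bsub>E\<^esub>}" "y \<in> carrier E - {\<zero>\<^bsub>E\<^esub>}"
    "x \<oplus>\<^bsub>E\<^esub> y = y" "y \<oplus>\<^bsub>E\<^esub> x = x" for x y
    using that E.a_comm[of x y] by auto
  show "x \<oplus>\<^bsub>E\<^esub> z = z" if "x \<in> carrier E - {\<zero>\<^bsub>E\<^esub>}" "y \<in> carrier E - {\<zero>\<^bsub>E\<^esub>}" "z \<in> carrier E - {\<zero>\<^bsub>E\<^esub>}"
    "x \<oplus>\<^bsub>E\<^esub> y = y" "y \<oplus>\<^bsub>E\<^esub> z = z" for x y z
    using that E.a_assoc[of x y z] by auto
  show "x \<oplus>\<^bsub>E\<^esub> y = y \<or> y \<oplus>\<^bsub>E\<^esub> x = x" if "x \<in> carrier E - {\<zero>\<^bsub>E\<^esub>}" "y \<in> carrier E - {\<zero>\<^bsub>E\<^esub>}" for x y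
    using that add_is_max[of x y] E.a_comm[of x y] by auto
  show "vmap K h \<odot>\<^bsub>E\<^esub> x \<in> carrier E - {\<zero>\<^bsub>E\<^esub>}" if "h \<in> vgrp K" "x \<in> carrier E - {\<zero>\<^bsub>E\<^esub>}" for h x
    using that by (rule smult_nonzero)
  show "vmap K 0 \<odot>\<^bsub>E\<^esub> x = x" if "x \<in> carrier E - {\<zero>\<^bsub>E\<^esub>}" for x
    using that smult_one V.v_0 by simp
  show "vmap K (h + k) \<odot>\<^bsub>E\<^esub> x = vmap K h \<odot>\<^bsub>E\<^esub> (vmap K k \<odot>\<^bsub>E\<^esub> x)"
    if "h \<in> vgrp K" "k \<in> vgrp K" "x \<in> carrier E - {\<zero>\<^bsub>E\<^esub>}" for h k x
    using that smult_assoc[of "vmap K h" "vmap K k" x] V.v_add V.v_carrier by simp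
  show "vmap K h \<odot>\<^bsub>E\<^esub> x \<oplus>\<^bsub>E\<^esub> vmap K h \<odot>\<^bsub>E\<^esub> y = vmap K h \<odot>\<^bsub>E\<^esub> y"
    if "h \<in> vgrp K" "x \<in> carrier E - {\<zero>\<^bsub>E\<^esub>}" "y \<in> carrier E - {\<zero>\<^bsub>E\<^esub>}" "x \<oplus>\<^bsub>E\<^esub> y = y" for h x y
    using that smult_r_distr[of "vmap K h" x y] V.v_carrier by simp
  show "x \<oplus>\<^bsub>E\<^esub> vmap K h \<odot>\<^bsub>E\<^esub> x = vmap K h \<odot>\<^bsub>E\<^esub> x \<and> vmap K h \<odot>\<^bsub>E\<^esub> x \<noteq> x"
    if "h \<in> vgrp K" "0 < h" "x \<in> carrier E - {\<zero>\<^bsub>E\<^esub>}" for h x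
  proof -
    have "add_less K \<one>\<^bsub>K\<^esub> (vmap K h)"
      unfolding add_less_def
      using V.add_le_v_iff[OF V.H_0 that(1)] V.v_eq_iff[OF V.H_0 that(1)] V.v_0 that(2) by simp
    then show ?thesis
      using increasing[of "vmap K h" x] V.v_carrier that by (auto simp: add_less_def add_le_def)
  qed
  show "\<exists>h\<in>vgrp K. 0 \<le> h \<and> y \<oplus>\<^bsub>E\<^esub> vmap K h \<odot>\<^bsub>E\<^esub> x = vmap K h \<odot>\<^bsub>E\<^esub> x"
    if "x \<in> carrier E - {\<zero>\<^bsub>E\<^esub>}" "y \<in> carrier E - {\<zero>\<^bsub>E\<^esub>}" for x y
  proof -
    obtain a where a: "a \<in> carrier K" "add_le K \<one>\<^bsub>K\<^esub> a" "add_less E y (a \<odot>\<^bsub>E\<^esub> x)"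
      using archimedean[OF \<open>x \<in> carrier E - {\<zero>\<^bsub>E\<^esub>}\<close> \<open>y \<in> carrier E - {\<zero>\<^bsub>E\<^esub>}\<close>] by blast
    \<comment> \<open>Zero does not lie above one, so \<open>a\<close> has a coordinate
      \<open>h\<close> in the group.\<close>
    have "a \<noteq> \<zero>\<^bsub>K\<^esub>"
      using a(2) V.one_not_zero K.r_zero[of "\<one>\<^bsub>K\<^esub>"] K.one_closed by (auto simp: add_le_def)
    then obtain h where h: "h \<in> vgrp K" "a = vmap K h"
      using V.carrier_cases[OF a(1)] by blast
    have "0 \<le> h"
      using a(2) V.add_le_v_iff[OF V.H_0 h(1)] V.v_0 h(2) by simp
    then show ?thesis
      using h a(3) by (auto simp: add_less_def add_le_def)
  qed
qed

end

lemma valued_semimodule: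
  "algebraic_extension_Zmax K \<Longrightarrow> archimedean_semimodule K E \<Longrightarrow> valued_semimodule K E"
  by (simp add: valued_semimodule_def valuation_vmap)

section \<open>Semilinear maps and maps of actions\<close>

lemma embeddingsD:
  assumes "\<sigma> \<in> semifield_embeddings K L"
  shows "\<sigma> \<in> ring_hom K L" "\<sigma> \<zero>\<^bsub>K\<^esub> = \<zero>\<^bsub>L\<^esub>" "inj_on \<sigma> (carrier K)" "\<sigma> \<in> extensional (carrier K)"
  using assms by (auto simp: semifield_embeddings_def)

lemma semilinearD:
  assumes "f \<in> semilinear_maps K E E' \<sigma>"
  shows "\<And>x. x \<in> carrier E \<Longrightarrow> f x \<in> carrier E'" "f \<in> extensional (carrier E)"
    "\<And>x y. x \<in> carrier E \<Longrightarrow> y \<in> carrier E \<Longrightarrow> f (x \<oplus>\<^bsub>E\<^esub> y) = f x \<oplus>\<^bsub>E'\<^esub> f y"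
    "\<And>a x. a \<in> carrier K \<Longrightarrow> x \<in> carrier E \<Longrightarrow> f (a \<odot>\<^bsub>E\<^esub> x) = \<sigma> a \<odot>\<^bsub>E'\<^esub> f x"
    "\<exists>x\<in>carrier E. f x \<noteq> \<zero>\<^bsub>E'\<^esub>"
  using assms by (auto simp: semilinear_maps_def PiE_iff)

locale two_semimodules =
  A: valued_semimodule K E + B: valued_semimodule K' E'
  for K :: "('k, 'r) ring_scheme" and E :: "('k, 'e, 's) module_scheme"
    and K' :: "('l, 'q) ring_scheme" and E' :: "('l, 'f, 't) module_scheme"
begin

abbreviation "AE \<equiv> semimodule_action K E"
abbreviation "BE \<equiv> semimodule_action K' E'"

lemma semilinear_zero:
  assumes "\<sigma> \<in> semifield_embeddings K K'" "f \<in> semilinear_maps K E E' \<sigma>"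
  shows "f \<zero>\<^bsub>E\<^esub> = \<zero>\<^bsub>E'\<^esub>"
proof -
  obtain x where x: "x \<in> carrier E" "f x \<noteq> \<zero>\<^bsub>E'\<^esub>"
    using semilinearD(5)[OF assms(2)] by blast
  have "f (\<zero>\<^bsub>K\<^esub> \<odot>\<^bsub>E\<^esub> x) = \<sigma> \<zero>\<^bsub>K\<^esub> \<odot>\<^bsub>E'\<^esub> f x"
    using semilinearD(4)[OF assms(2)] x A.K.zero_closed by blast
  then show ?thesis
    using A.smult_l_null[OF x(1)] embeddingsD(2)[OF assms(1)] B.smult_l_null semilinearD(1)[OF assms(2) x(1)] by simp
qed

lemma semilinear_nonzero:
  assumes \<sigma>: "\<sigma> \<in> semifield_embeddings K K'" and f: "f \<in> semilinear_maps K E E' \<sigma>"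
    and x: "x \<in> carrier E - {\<zero>\<^bsub>E\<^esub>}"
  shows "f x \<in> carrier E' - {\<zero>\<^bsub>E'\<^esub>}"
proof -
  obtain y where y: "y \<in> carrier E" "f y \<noteq> \<zero>\<^bsub>E'\<^esub>"
    using semilinearD(5)[OF f] by blast
  then have "y \<in> carrier E - {\<zero>\<^bsub>E\<^esub>}"
    using semilinear_zero[OF \<sigma> f] by auto
  then obtain a where a: "a \<in> carrier K" "add_less E y (a \<odot>\<^bsub>E\<^esub> x)"
    using A.archimedean[OF x] by blast
  have "f y \<oplus>\<^bsub>E'\<^esub> \<sigma> a \<odot>\<^bsub>E'\<^esub> f x = \<sigma> a \<odot>\<^bsub>E'\<^esub> f x"
    using semilinearD(3)[OF f y(1), of "a \<odot>\<^bsub>E\<^esub> x"] semilinearD(4)[OF f a(1), of x] a A.smult_closed x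
    by (simp add: add_less_def add_le_def)
  moreover have "\<sigma> a \<in> carrier K'"
    using ring_hom_closed[OF embeddingsD(1)[OF \<sigma>] a(1)] .
  ultimately have "f x \<noteq> \<zero>\<^bsub>E'\<^esub>"
    using y(2) B.smult_r_null B.E.r_zero semilinearD(1)[OF f y(1)] by auto
  then show ?thesis
    using semilinearD(1)[OF f] x by blast
qed

lemma restrict_act_maps:
  assumes \<sigma>: "\<sigma> \<in> semifield_embeddings K K'" and f: "f \<in> semilinear_maps K E E' \<sigma>"
  shows "restrict f (Pts AE) \<in> act_maps AE BE"
proof -
  obtain c where c: "c > 0" "\<And>h. h \<in> vgrp K \<Longrightarrow> c * h \<in> vgrp K' \<and> \<sigma> (vmap K h) = vmap K' (c * h)"
    using embedding_scale[OF A.V.valuation_axioms B.V.valuation_axioms embeddingsD(1-3)[OF \<sigma>]] by blast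
  have "f (vmap K h \<odot>\<^bsub>E\<^esub> x) = vmap K' (c * h) \<odot>\<^bsub>E'\<^esub> f x"
    if "h \<in> vgrp K" "x \<in> carrier E - {\<zero>\<^bsub>E\<^esub>}" for h x
    using semilinearD(4)[OF f A.V.v_carrier[OF that(1)], of x] c(2)[OF that(1)] that(2) by simp
  moreover have "f x \<oplus>\<^bsub>E'\<^esub> f y = f y" if "x \<in> carrier E" "y \<in> carrier E" "x \<oplus>\<^bsub>E\<^esub> y = y" for x y
    using semilinearD(3)[OF f that(1,2)] that(3) by simp
  ultimately show ?thesis
    unfolding act_maps_def mem_Collect_eq
    using semilinear_nonzero[OF \<sigma> f] A.smult_nonzero c
    by (intro conjI exI[of _ c]) (auto simp: A.simps B.simps)
qed

lemma projective_class_eq: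
  "projective_class E K' E' f = {\<lambda>x\<in>carrier E. vmap K' h \<odot>\<^bsub>E'\<^esub> f x |h. h \<in> vgrp K'}"
  unfolding projective_class_def B.V.Units_v by blast

lemma restrict_projective_class:
  "(\<lambda>g. restrict g (Pts AE)) ` projective_class E K' E' f = act_class AE BE (restrict f (Pts AE))"
proof -
  have "restrict (\<lambda>x\<in>carrier E. vmap K' h \<odot>\<^bsub>E'\<^esub> f x) (Pts AE) =
      (\<lambda>x\<in>Pts AE. Act BE h (restrict f (Pts AE) x))" for h
    by (auto simp: fun_eq_iff A.simps B.simps)
  then show ?thesis
    by (simp only: projective_class_eq act_class_def setcompr_eq_image image_image B.simps(1))
qed

lemma projective_class_eqI:
  assumes f: "\<And>x. x \<in> carrier E \<Longrightarrow> f x \<in> carrier E'" and h: "h \<in> vgrp K'"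
    and g: "\<And>x. x \<in> carrier E \<Longrightarrow> g x = vmap K' h \<odot>\<^bsub>E'\<^esub> f x"
  shows "projective_class E K' E' g = projective_class E K' E' f"
proof -
  have 1: "(\<lambda>x\<in>carrier E. vmap K' k \<odot>\<^bsub>E'\<^esub> g x) = (\<lambda>x\<in>carrier E. vmap K' (k + h) \<odot>\<^bsub>E'\<^esub> f x)"
    if "k \<in> vgrp K'" for k
    using that h f g B.smult_assoc B.V.v_carrier B.V.v_add by (auto simp: fun_eq_iff)
  have 2: "(\<lambda>x\<in>carrier E. vmap K' k \<odot>\<^bsub>E'\<^esub> f x) = (\<lambda>x\<in>carrier E. vmap K' (k - h) \<odot>\<^bsub>E'\<^esub> g x)"
    if "k \<in> vgrp K'" for k
    using 1[OF B.V.H_diff[OF that h]] by simp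
  show ?thesis
    unfolding projective_class_eq using 1 2 B.V.H_add[OF _ h] B.V.H_diff[OF _ h] by blast
qed

lemma embedding_class_faithful:
  assumes \<sigma>: "\<sigma> \<in> semifield_embeddings K K'" and f: "f \<in> semilinear_maps K E E' \<sigma>"
    and \<tau>: "\<tau> \<in> semifield_embeddings K K'" and g: "g \<in> semilinear_maps K E E' \<tau>"
    and eq: "(\<lambda>g. restrict g (Pts AE)) ` projective_class E K' E' f =
      (\<lambda>g. restrict g (Pts AE)) ` projective_class E K' E' g"
  shows "\<sigma> = \<tau>" "projective_class E K' E' f = projective_class E K' E' g"
proof -
  have "act_class AE BE (restrict f (Pts AE)) = act_class AE BE (restrict g (Pts AE))"
    using eq unfolding restrict_projective_class .
  then obtain h where h: "h \<in> vgrp K'"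
    "\<And>x. x \<in> Pts AE \<Longrightarrow> restrict g (Pts AE) x = Act BE h (restrict f (Pts AE) x)"
    using act_class_eq_iff[OF A.arch_action_semimodule_action B.arch_action_semimodule_action
        restrict_act_maps[OF \<sigma> f] restrict_act_maps[OF \<tau> g]] by (auto simp: B.simps(1))
  have gf: "g x = vmap K' h \<odot>\<^bsub>E'\<^esub> f x" if "x \<in> carrier E" for x
  proof (cases "x = \<zero>\<^bsub>E\<^esub>")
    case True
    then show ?thesis
      using semilinear_zero[OF \<sigma> f] semilinear_zero[OF \<tau> g] B.smult_r_null[OF B.V.v_carrier[OF h(1)]] by simp
  next
    case False
    then show ?thesis
      using h(2)[of x] that by (simp add: A.simps B.simps)
  qed
  show "projective_class E K' E' f = projective_class E K' E' g"
    using projective_class_eqI[OF semilinearD(1)[OF f] h(1) gf] by simp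
  have *: "\<sigma> a = \<tau> a" if a: "a \<in> carrier K" for a
  proof (rule A.V.carrier_cases[OF a])
    assume "a = \<zero>\<^bsub>K\<^esub>"
    then show ?thesis
      using embeddingsD(2)[OF \<sigma>] embeddingsD(2)[OF \<tau>] by simp
  next
    fix k assume k: "k \<in> vgrp K" "a = vmap K k"
    obtain c where c: "c * k \<in> vgrp K'" "\<sigma> a = vmap K' (c * k)"
      using embedding_scale[OF A.V.valuation_axioms B.V.valuation_axioms embeddingsD(1-3)[OF \<sigma>]] k by blast
    obtain d where d: "d * k \<in> vgrp K'" "\<tau> a = vmap K' (d * k)"
      using embedding_scale[OF A.V.valuation_axioms B.V.valuation_axioms embeddingsD(1-3)[OF \<tau>]] k by blast
    interpret b: arch_action BE by (rule B.arch_action_semimodule_action)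
    obtain x where x: "x \<in> carrier E - {\<zero>\<^bsub>E\<^esub>}"
      using A.nontrivial A.E.zero_closed by blast
    have gx: "g x \<in> Pts BE"
      using semilinear_nonzero[OF \<tau> g x] by (simp add: B.simps)
    have sc: "vmap K' s \<in> carrier K'" if "s \<in> vgrp K'" for s
      using B.V.v_carrier[OF that] .
    have fx: "f x \<in> carrier E'"
      using semilinearD(1)[OF f] x by blast
    have ax: "a \<odot>\<^bsub>E\<^esub> x \<in> carrier E"
      using A.smult_closed a x by blast
    \<comment> \<open>The value of \<open>g\<close> at the multiple of \<open>x\<close> by
      \<open>a\<close> is computed once through \<open>\<tau>\<close> and once through
      \<open>f\<close> and \<open>\<sigma>\<close>; freeness then compares the coordinates.\<close>
    have "vmap K' (d * k) \<odot>\<^bsub>E'\<^esub> g x = g (a \<odot>\<^bsub>E\<^esub> x)"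
      using semilinearD(4)[OF g a, of x] x d(2) by simp
    also have "\<dots> = vmap K' h \<odot>\<^bsub>E'\<^esub> f (a \<odot>\<^bsub>E\<^esub> x)"
      using gf[OF ax] .
    also have "f (a \<odot>\<^bsub>E\<^esub> x) = vmap K' (c * k) \<odot>\<^bsub>E'\<^esub> f x"
      using semilinearD(4)[OF f a, of x] x c(2) by simp
    also have "vmap K' h \<odot>\<^bsub>E'\<^esub> (vmap K' (c * k) \<odot>\<^bsub>E'\<^esub> f x) = vmap K' (h + c * k) \<odot>\<^bsub>E'\<^esub> f x"
      using B.smult_assoc[OF sc[OF h(1)] sc[OF c(1)] fx] B.V.v_add[OF h(1) c(1)] by simp
    also have "\<dots> = vmap K' (c * k) \<odot>\<^bsub>E'\<^esub> (vmap K' h \<odot>\<^bsub>E'\<^esub> f x)"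
      using B.smult_assoc[OF sc[OF c(1)] sc[OF h(1)] fx] B.V.v_add[OF c(1) h(1)] by (simp add: add.commute)
    also have "\<dots> = vmap K' (c * k) \<odot>\<^bsub>E'\<^esub> g x"
      using gf[of x] x by simp
    finally have "d * k = c * k"
      using b.Act_eq_iff[of "d * k" "c * k" "g x"] c(1) d(1) gx by (simp add: B.simps)
    then show ?thesis
      using c(2) d(2) by (simp only:)
  qed
  show "\<sigma> = \<tau>"
    using * embeddingsD(4)[OF \<sigma>] embeddingsD(4)[OF \<tau>] by (rule extensionalityI[rotated 2])
qed

text \<open>Both maps are extended by zero: \<open>\<sigma>\<close> is multiplication by
  \<open>c\<close> in the coordinates of the semifields, and \<open>f\<close> sends the zero of
  \<open>E\<close> to that of \<open>E'\<close>.\<close>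

lemma embedding_class_full:
  assumes \<phi>: "\<phi> \<in> act_maps AE BE"
  shows "\<exists>\<sigma> f. \<sigma> \<in> semifield_embeddings K K' \<and> f \<in> semilinear_maps K E E' \<sigma> \<and> restrict f (Pts AE) = \<phi>"
proof -
  obtain c where c: "c > 0" "\<And>h. h \<in> vgrp K \<Longrightarrow> c * h \<in> vgrp K'"
    "\<And>h x. h \<in> vgrp K \<Longrightarrow> x \<in> carrier E - {\<zero>\<^bsub>E\<^esub>} \<Longrightarrow> \<phi> (vmap K h \<odot>\<^bsub>E\<^esub> x) = vmap K' (c * h) \<odot>\<^bsub>E'\<^esub> \<phi> x"
    by (rule act_mapsE[OF \<phi>, unfolded A.simps B.simps]) (rule that)
  define w where "w = inv_into (vgrp K) (vmap K)"
  have w: "w (vmap K h) = h" if "h \<in> vgrp K" for h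
    using A.V.v_bij that by (simp add: w_def bij_betw_def)
  define \<sigma> where "\<sigma> = (\<lambda>a\<in>carrier K. if a = \<zero>\<^bsub>K\<^esub> then \<zero>\<^bsub>K'\<^esub> else vmap K' (c * w a))"
  have \<sigma>0: "\<sigma> \<zero>\<^bsub>K\<^esub> = \<zero>\<^bsub>K'\<^esub>"
    using A.K.zero_closed by (simp add: \<sigma>_def)
  have \<sigma>v: "\<sigma> (vmap K h) = vmap K' (c * h)" if "h \<in> vgrp K" for h
    using that A.V.v_carrier A.V.v_nonzero w by (simp add: \<sigma>_def)
  define f where "f = (\<lambda>x\<in>carrier E. if x = \<zero>\<^bsub>E\<^esub> then \<zero>\<^bsub>E'\<^esub> else \<phi> x)"
  have f0: "f \<zero>\<^bsub>E\<^esub> = \<zero>\<^bsub>E'\<^esub>"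
    using A.E.zero_closed by (simp add: f_def)
  have fx: "f x = \<phi> x" if "x \<in> carrier E - {\<zero>\<^bsub>E\<^esub>}" for x
    using that by (simp add: f_def)
  have \<phi>x: "\<phi> x \<in> carrier E' - {\<zero>\<^bsub>E'\<^esub>}" if "x \<in> carrier E - {\<zero>\<^bsub>E\<^esub>}" for x
    using act_maps_Pts[OF \<phi>, of x] that unfolding A.simps B.simps .
  have fc: "f x \<in> carrier E'" if "x \<in> carrier E" for x
    using that fx[of x] \<phi>x[of x] f0 B.E.zero_closed by (cases "x = \<zero>\<^bsub>E\<^esub>") auto
  have \<sigma>c: "\<sigma> a \<in> carrier K'" if "a \<in> carrier K" for a
    using that by (rule A.V.carrier_cases) (use \<sigma>0 \<sigma>v c(2) B.V.v_carrier B.K.zero_closed in auto)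
  have "\<sigma> \<in> ring_hom K K'"
  proof (rule ring_hom_memI)
    fix a assume "a \<in> carrier K"
    then show "\<sigma> a \<in> carrier K'" by (rule \<sigma>c)
  next
    fix a b assume a: "a \<in> carrier K" and b: "b \<in> carrier K"
    have "\<sigma> (a \<otimes>\<^bsub>K\<^esub> b) = \<sigma> a \<otimes>\<^bsub>K'\<^esub> \<sigma> b \<and> \<sigma> (a \<oplus>\<^bsub>K\<^esub> b) = \<sigma> a \<oplus>\<^bsub>K'\<^esub> \<sigma> b"
    proof (cases "a = \<zero>\<^bsub>K\<^esub> \<or> b = \<zero>\<^bsub>K\<^esub>")
      case True
      then show ?thesis
        using a b \<sigma>0 \<sigma>c[OF a] \<sigma>c[OF b] by auto
    next
      case False
      then obtain h k where h: "h \<in> vgrp K" "a = vmap K h" and k: "k \<in> vgrp K" "b = vmap K k"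
        using A.V.carrier_cases a b by metis
      have "c * max h k = max (c * h) (c * k)"
        using c(1) by (simp add: max_def)
      moreover have "max h k \<in> vgrp K"
        using h k by (simp add: max_def)
      ultimately show ?thesis
        using h k \<sigma>v A.V.H_add c(2) A.V.v_add[OF h(1) k(1)] A.V.v_max[OF h(1) k(1)]
          B.V.v_add[of "c * h" "c * k"] B.V.v_max[of "c * h" "c * k"]
        by (metis distrib_left)
    qed
    then show "\<sigma> (a \<otimes>\<^bsub>K\<^esub> b) = \<sigma> a \<otimes>\<^bsub>K'\<^esub> \<sigma> b" "\<sigma> (a \<oplus>\<^bsub>K\<^esub> b) = \<sigma> a \<oplus>\<^bsub>K'\<^esub> \<sigma> b"
      by auto
  next
    show "\<sigma> \<one>\<^bsub>K\<^esub> = \<one>\<^bsub>K'\<^esub>"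
      using \<sigma>v[OF A.V.H_0] A.V.v_0 B.V.v_0 by simp
  qed
  moreover have "inj_on \<sigma> (carrier K)"
  proof (rule inj_onI)
    fix a b assume a: "a \<in> carrier K" and b: "b \<in> carrier K" and eq: "\<sigma> a = \<sigma> b"
    show "a = b"
      using a
    proof (rule A.V.carrier_cases)
      assume a0: "a = \<zero>\<^bsub>K\<^esub>"
      show ?thesis
        using b by (rule A.V.carrier_cases) (use a0 eq \<sigma>0 \<sigma>v c(2) B.V.v_nonzero in auto)
    next
      fix h assume h: "h \<in> vgrp K" "a = vmap K h"
      show ?thesis
        using b
      proof (rule A.V.carrier_cases)
        assume "b = \<zero>\<^bsub>K\<^esub>"
        then show ?thesis
          using h eq \<sigma>0 \<sigma>v[OF h(1)] B.V.v_nonzero[OF c(2)[OF h(1)]] by simp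
      next
        fix k assume k: "k \<in> vgrp K" "b = vmap K k"
        then have "c * h = c * k"
          using eq h \<sigma>v B.V.v_eq_iff[OF c(2)[OF h(1)] c(2)[OF k(1)]] by simp
        then show ?thesis
          using c(1) h k by simp
      qed
    qed
  qed
  ultimately have \<sigma>: "\<sigma> \<in> semifield_embeddings K K'"
    using \<sigma>0 by (simp add: semifield_embeddings_def) (simp add: \<sigma>_def)
  have fadd: "f (x \<oplus>\<^bsub>E\<^esub> y) = f x \<oplus>\<^bsub>E'\<^esub> f y" if x: "x \<in> carrier E" and y: "y \<in> carrier E" for x y
  proof -
    \<comment> \<open>Sums are maxima, so for an ordered pair additivity is monotonicity of
      \<open>\<phi>\<close>. The opposite order follows by commutativity.\<close>
    have *: "f (x \<oplus>\<^bsub>E\<^esub> y) = f x \<oplus>\<^bsub>E'\<^esub> f y" if "x \<in> carrier E - {\<zero>\<^bsub>E\<^esub>}" "y \<in> carrier E - {\<zero>\<^bsub>E\<^esub>}" "x \<oplus>\<^bsub>E\<^esub> y = y" for x y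
      using act_maps_mono[OF \<phi>, of x y] that fx unfolding A.simps B.simps by simp
    show ?thesis
    proof (cases "x = \<zero>\<^bsub>E\<^esub> \<or> y = \<zero>\<^bsub>E\<^esub>")
      case True
      then show ?thesis
        using x y f0 fc[OF x] fc[OF y] by auto
    next
      case False
      then show ?thesis
        using *[of x y] *[of y x] A.add_is_max[OF x y] A.E.a_comm[OF x y] B.E.a_comm[OF fc[OF x] fc[OF y]] x y by auto
    qed
  qed
  have fsm: "f (a \<odot>\<^bsub>E\<^esub> x) = \<sigma> a \<odot>\<^bsub>E'\<^esub> f x" if a: "a \<in> carrier K" and x: "x \<in> carrier E" for a x
  proof (cases "x = \<zero>\<^bsub>E\<^esub>")
    case True
    then show ?thesis
      using f0 A.smult_r_null[OF a] B.smult_r_null[OF \<sigma>c[OF a]] by simp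
  next
    case False
    show ?thesis
      using a
    proof (rule A.V.carrier_cases)
      assume "a = \<zero>\<^bsub>K\<^esub>"
      then show ?thesis
        using f0 \<sigma>0 A.smult_l_null[OF x] B.smult_l_null[OF fc[OF x]] by simp
    next
      fix h assume h: "h \<in> vgrp K" "a = vmap K h"
      have xx: "x \<in> carrier E - {\<zero>\<^bsub>E\<^esub>}"
        using False x by simp
      show ?thesis
        using fx[OF A.smult_nonzero[OF h(1) xx]] fx[OF xx] c(3)[OF h(1) xx] \<sigma>v[OF h(1)] h(2) by simp
    qed
  qed
  obtain x where x: "x \<in> carrier E - {\<zero>\<^bsub>E\<^esub>}"
    using A.nontrivial A.E.zero_closed by blast
  have "f x \<noteq> \<zero>\<^bsub>E'\<^esub>"
    using fx[OF x] \<phi>x[OF x] by simp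
  moreover have "f \<in> carrier E \<rightarrow>\<^sub>E carrier E'"
    using fc by (auto simp: f_def)
  ultimately have f: "f \<in> semilinear_maps K E E' \<sigma>"
    unfolding semilinear_maps_def using fadd fsm x by blast
  have "restrict f (Pts AE) = \<phi>"
    using fx act_maps_extensional[OF \<phi>] by (auto simp: fun_eq_iff extensional_def A.simps)
  then show ?thesis
    using \<sigma> f by blast
qed

end

section \<open>Composition in the category \<P>\<close>

lemma embeddings_compose:
  assumes \<sigma>: "\<sigma> \<in> semifield_embeddings K L" and \<tau>: "\<tau> \<in> semifield_embeddings L M"
    and K: "semiring K"
  shows "compose (carrier K) \<tau> \<sigma> \<in> semifield_embeddings K M"
proof -
  interpret semiring K by (rule K)
  have cl: "\<sigma> a \<in> carrier L" if "a \<in> carrier K" for a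
    using ring_hom_closed[OF embeddingsD(1)[OF \<sigma>] that] .
  have "compose (carrier K) \<tau> \<sigma> \<in> ring_hom K M"
    using embeddingsD(1)[OF \<sigma>] embeddingsD(1)[OF \<tau>] cl
    by (intro ring_hom_memI) (simp_all add: compose_eq ring_hom_closed ring_hom_mult ring_hom_add ring_hom_one)
  moreover have "inj_on (compose (carrier K) \<tau> \<sigma>) (carrier K)"
    using embeddingsD(3)[OF \<sigma>] embeddingsD(3)[OF \<tau>] cl by (auto simp: inj_on_def compose_eq)
  ultimately show ?thesis
    using embeddingsD(2)[OF \<sigma>] embeddingsD(2)[OF \<tau>] by (simp add: semifield_embeddings_def compose_eq)
qed

lemma embeddings_id: "semiring K \<Longrightarrow> (\<lambda>a\<in>carrier K. a) \<in> semifield_embeddings K K"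
proof -
  assume "semiring K"
  then interpret semiring K .
  have "(\<lambda>a\<in>carrier K. a) \<in> ring_hom K K"
    by (intro ring_hom_memI) auto
  then show ?thesis
    by (simp add: semifield_embeddings_def inj_on_def)
qed

lemma semilinear_id:
  assumes "valued_semimodule K E"
  shows "(\<lambda>x\<in>carrier E. x) \<in> semilinear_maps K E E (\<lambda>a\<in>carrier K. a)"
proof -
  interpret valued_semimodule K E by (rule assms)
  have "\<exists>x\<in>carrier E. x \<noteq> \<zero>\<^bsub>E\<^esub>"
    using nontrivial E.zero_closed by blast
  then show ?thesis
    using smult_closed by (auto simp: semilinear_maps_def)
qed

lemma semilinear_compose:
  assumes E: "valued_semimodule K E" and E': "valued_semimodule K' E'" and E'': "valued_semimodule K'' E''"
    and \<sigma>: "\<sigma> \<in> semifield_embeddings K K'" and f: "f \<in> semilinear_maps K E E' \<sigma>"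
    and \<tau>: "\<tau> \<in> semifield_embeddings K' K''" and g: "g \<in> semilinear_maps K' E' E'' \<tau>"
  shows "compose (carrier E) g f \<in> semilinear_maps K E E'' (compose (carrier K) \<tau> \<sigma>)"
proof -
  interpret A: valued_semimodule K E by (rule E)
  interpret B: valued_semimodule K' E' by (rule E')
  interpret AB: two_semimodules K E K' E' ..
  interpret C: valued_semimodule K'' E'' by (rule E'')
  interpret BC: two_semimodules K' E' K'' E'' ..
  obtain x where x: "x \<in> carrier E - {\<zero>\<^bsub>E\<^esub>}"
    using A.nontrivial A.E.zero_closed by blast
  have "g (f x) \<in> carrier E'' - {\<zero>\<^bsub>E''\<^esub>}"
    using BC.semilinear_nonzero[OF \<tau> g AB.semilinear_nonzero[OF \<sigma> f x]] .
  then have "\<exists>x\<in>carrier E. compose (carrier E) g f x \<noteq> \<zero>\<^bsub>E''\<^esub>"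
    using x by (auto simp: compose_eq)
  moreover have "compose (carrier E) g f \<in> carrier E \<rightarrow>\<^sub>E carrier E''"
    using semilinearD(1)[OF f] semilinearD(1)[OF g] by (auto simp: compose_def)
  moreover have "compose (carrier E) g f (x \<oplus>\<^bsub>E\<^esub> y) =
      compose (carrier E) g f x \<oplus>\<^bsub>E''\<^esub> compose (carrier E) g f y" if "x \<in> carrier E" "y \<in> carrier E" for x y
    using that semilinearD(1,3)[OF f] semilinearD(3)[OF g] by (simp add: compose_eq)
  moreover have "compose (carrier E) g f (a \<odot>\<^bsub>E\<^esub> x) =
      compose (carrier K) \<tau> \<sigma> a \<odot>\<^bsub>E''\<^esub> compose (carrier E) g f x" if "a \<in> carrier K" "x \<in> carrier E" for a x
    using that semilinearD(1,4)[OF f] semilinearD(4)[OF g] A.smult_closed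
      ring_hom_closed[OF embeddingsD(1)[OF \<sigma>]] by (simp add: compose_eq)
  ultimately show ?thesis
    by (simp add: semilinear_maps_def)
qed

text \<open>The mechanism is that of \<open>act_class_compose\<close>, now on full carriers with
  their zeros: a unit with coordinate \<open>h\<close> passes through \<open>g\<close> and becomes
  the one with coordinate \<open>d * h\<close>.\<close>

lemma projective_class_compose:
  assumes E: "valued_semimodule K E" and E': "valued_semimodule K' E'" and E'': "valued_semimodule K'' E''"
    and f: "f \<in> semilinear_maps K E E' \<sigma>"
    and \<tau>: "\<tau> \<in> semifield_embeddings K' K''" and g: "g \<in> semilinear_maps K' E' E'' \<tau>"
  shows "{compose (carrier E) g' f' |g' f'. g' \<in> projective_class E' K'' E'' g \<and> f' \<in> projective_class E K' E' f} =
    projective_class E K'' E'' (compose (carrier E) g f)" (is "?L = ?R")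
proof -
  interpret A: valued_semimodule K E by (rule E)
  interpret B: valued_semimodule K' E' by (rule E')
  interpret AB: two_semimodules K E K' E' ..
  interpret C: valued_semimodule K'' E'' by (rule E'')
  interpret BC: two_semimodules K' E' K'' E'' ..
  interpret AC: two_semimodules K E K'' E'' ..
  obtain d where d: "d > 0" "\<And>h. h \<in> vgrp K' \<Longrightarrow> d * h \<in> vgrp K'' \<and> \<tau> (vmap K' h) = vmap K'' (d * h)"
    using embedding_scale[OF B.V.valuation_axioms C.V.valuation_axioms embeddingsD(1-3)[OF \<tau>]] by blast
  have *: "compose (carrier E) (\<lambda>x\<in>carrier E'. vmap K'' k \<odot>\<^bsub>E''\<^esub> g x) (\<lambda>x\<in>carrier E. vmap K' h \<odot>\<^bsub>E'\<^esub> f x) =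
    (\<lambda>x\<in>carrier E. vmap K'' (k + d * h) \<odot>\<^bsub>E''\<^esub> compose (carrier E) g f x)"
    if k: "k \<in> vgrp K''" and h: "h \<in> vgrp K'" for k h
  proof
    fix x
    show "compose (carrier E) (\<lambda>x\<in>carrier E'. vmap K'' k \<odot>\<^bsub>E''\<^esub> g x) (\<lambda>x\<in>carrier E. vmap K' h \<odot>\<^bsub>E'\<^esub> f x) x =
      (\<lambda>x\<in>carrier E. vmap K'' (k + d * h) \<odot>\<^bsub>E''\<^esub> compose (carrier E) g f x) x"
    proof (cases "x \<in> carrier E")
      case True
      have fx: "f x \<in> carrier E'" and gfx: "g (f x) \<in> carrier E''"
        using semilinearD(1)[OF f True] semilinearD(1)[OF g] by auto
      have "vmap K'' k \<odot>\<^bsub>E''\<^esub> g (vmap K' h \<odot>\<^bsub>E'\<^esub> f x) = vmap K'' k \<odot>\<^bsub>E''\<^esub> (vmap K'' (d * h) \<odot>\<^bsub>E''\<^esub> g (f x))"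
        using semilinearD(4)[OF g B.V.v_carrier[OF h] fx] d(2)[OF h] by simp
      also have "\<dots> = vmap K'' (k + d * h) \<odot>\<^bsub>E''\<^esub> g (f x)"
        using C.smult_assoc[OF C.V.v_carrier[OF k] C.V.v_carrier gfx, of "d * h"] C.V.v_add[OF k, of "d * h"] d(2)[OF h]
        by simp
      finally show ?thesis
        using True B.smult_closed[OF B.V.v_carrier[OF h] fx] by (simp add: compose_eq)
    qed (simp add: compose_def)
  qed
  have "?L \<subseteq> ?R"
  proof
    fix x assume "x \<in> ?L"
    then obtain k h where kh: "k \<in> vgrp K''" "h \<in> vgrp K'"
      "x = compose (carrier E) (\<lambda>x\<in>carrier E'. vmap K'' k \<odot>\<^bsub>E''\<^esub> g x) (\<lambda>x\<in>carrier E. vmap K' h \<odot>\<^bsub>E'\<^esub> f x)"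
      unfolding AB.projective_class_eq BC.projective_class_eq by blast
    then show "x \<in> ?R"
      using C.V.H_add[OF kh(1), of "d * h"] d(2)[OF kh(2)] unfolding * [OF kh(1,2)] AC.projective_class_eq by blast
  qed
  moreover have "?R \<subseteq> ?L"
  proof
    fix x assume "x \<in> ?R"
    then obtain k where k: "k \<in> vgrp K''" "x = (\<lambda>x\<in>carrier E. vmap K'' k \<odot>\<^bsub>E''\<^esub> compose (carrier E) g f x)"
      unfolding AC.projective_class_eq by blast
    then have "x = compose (carrier E) (\<lambda>x\<in>carrier E'. vmap K'' k \<odot>\<^bsub>E''\<^esub> g x) (\<lambda>x\<in>carrier E. vmap K' 0 \<odot>\<^bsub>E'\<^esub> f x)"
      using *[OF k(1) B.V.H_0] by simp
    then show "x \<in> ?L"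
      unfolding AB.projective_class_eq BC.projective_class_eq using k(1) B.V.H_0 by blast
  qed
  ultimately show ?thesis by blast
qed

lemma Ob_P: "(K, E) \<in> Ob \<P> \<longleftrightarrow> algebraic_extension_Zmax K \<and> archimedean_semimodule K E"
  by (simp add: \<P>_def)

lemma Ob_P_cases:
  assumes "p \<in> Ob \<P>"
  obtains K E where "p = (K, E)" "valued_semimodule K E"
  using assms valued_semimodule by (cases p) (auto simp: Ob_P)

lemma Hom_P: "Hom \<P> (K, E) (K', E') = {(\<sigma>, projective_class E K' E' f) |\<sigma> f.
    \<sigma> \<in> semifield_embeddings K K' \<and> f \<in> semilinear_maps K E E' \<sigma>}"
  by (simp add: \<P>_def)

lemma Hom_P_cases:
  assumes "F \<in> Hom \<P> (K, E) (K', E')"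
  obtains \<sigma> f where "F = (\<sigma>, projective_class E K' E' f)" "\<sigma> \<in> semifield_embeddings K K'"
    "f \<in> semilinear_maps K E E' \<sigma>"
  using assms unfolding Hom_P by blast

lemma Id_P: "Id \<P> (K, E) = (\<lambda>a\<in>carrier K. a, projective_class E K E (\<lambda>x\<in>carrier E. x))"
  by (simp add: \<P>_def)

lemma Comp_P:
  assumes "valued_semimodule K E" "valued_semimodule K' E'" "valued_semimodule K'' E''"
    "f \<in> semilinear_maps K E E' \<sigma>" "\<tau> \<in> semifield_embeddings K' K''" "g \<in> semilinear_maps K' E' E'' \<tau>"
  shows "Comp \<P> (K, E) (K', E') (K'', E'') (\<tau>, projective_class E' K'' E'' g) (\<sigma>, projective_class E K' E' f) =
    (compose (carrier K) \<tau> \<sigma>, projective_class E K'' E'' (compose (carrier E) g f))"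
  using projective_class_compose[OF assms] by (simp add: \<P>_def)

lemma compose_id:
  assumes "f \<in> extensional S" "\<And>x. x \<in> S \<Longrightarrow> f x \<in> T"
  shows "compose S f (\<lambda>x\<in>S. x) = f" "compose S (\<lambda>x\<in>T. x) f = f"
  using assms by (auto simp: compose_def fun_eq_iff extensional_def)

lemma compose_compose:
  "(\<And>x. x \<in> S \<Longrightarrow> f x \<in> T) \<Longrightarrow> compose S (compose T h g) f = compose S h (compose S g f)"
  by (auto simp: compose_def fun_eq_iff)

lemma is_category_P: "is_category (\<P> :: ('u \<P>_ob, 'u \<P>_arr) cat)"
  unfolding is_category_def
proof (intro conjI ballI)
  fix p :: "'u \<P>_ob" assume "p \<in> Ob \<P>"
  then obtain K E where p: "p = (K, E)" and v: "valued_semimodule K E"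
    by (rule Ob_P_cases)
  interpret valued_semimodule K E by (rule v)
  show "Id \<P> p \<in> Hom \<P> p p"
    using embeddings_id[OF K.semiring_axioms] semilinear_id[OF v] unfolding p Hom_P Id_P by blast
next
  fix p q r :: "'u \<P>_ob" and F G
  assume "p \<in> Ob \<P>" "q \<in> Ob \<P>" "r \<in> Ob \<P>" and FG: "F \<in> Hom \<P> p q" "G \<in> Hom \<P> q r"
  then obtain K E K' E' K'' E'' where p: "p = (K, E)" "q = (K', E')" "r = (K'', E'')"
    and v: "valued_semimodule K E" "valued_semimodule K' E'" "valued_semimodule K'' E''"
    by (metis Ob_P_cases)
  interpret valued_semimodule K E by (rule v)
  obtain \<sigma> f where f: "F = (\<sigma>, projective_class E K' E' f)" "\<sigma> \<in> semifield_embeddings K K'"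
    "f \<in> semilinear_maps K E E' \<sigma>"
    using FG(1) unfolding p by (rule Hom_P_cases)
  obtain \<tau> g where g: "G = (\<tau>, projective_class E' K'' E'' g)" "\<tau> \<in> semifield_embeddings K' K''"
    "g \<in> semilinear_maps K' E' E'' \<tau>"
    using FG(2) unfolding p by (rule Hom_P_cases)
  show "Comp \<P> p q r G F \<in> Hom \<P> p r"
    unfolding p f(1) g(1) Comp_P[OF v f(3) g(2,3)] Hom_P
    using embeddings_compose[OF f(2) g(2) K.semiring_axioms] semilinear_compose[OF v f(2,3) g(2,3)] by blast
next
  fix p q :: "'u \<P>_ob" and F
  assume "p \<in> Ob \<P>" "q \<in> Ob \<P>" and F: "F \<in> Hom \<P> p q"
  then obtain K E K' E' where p: "p = (K, E)" "q = (K', E')"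
    and v: "valued_semimodule K E" "valued_semimodule K' E'"
    by (metis Ob_P_cases)
  interpret A: valued_semimodule K E by (rule v)
  interpret B: valued_semimodule K' E' by (rule v)
  obtain \<sigma> f where f: "F = (\<sigma>, projective_class E K' E' f)" "\<sigma> \<in> semifield_embeddings K K'"
    "f \<in> semilinear_maps K E E' \<sigma>"
    using F unfolding p by (rule Hom_P_cases)
  have e: "compose (carrier K) \<sigma> (\<lambda>a\<in>carrier K. a) = \<sigma>" "compose (carrier K) (\<lambda>a\<in>carrier K'. a) \<sigma> = \<sigma>"
    using compose_id[OF embeddingsD(4)[OF f(2)]] ring_hom_closed[OF embeddingsD(1)[OF f(2)]] by blast+
  have e': "compose (carrier E) f (\<lambda>a\<in>carrier E. a) = f" "compose (carrier E) (\<lambda>a\<in>carrier E'. a) f = f"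
    using compose_id[OF semilinearD(2)[OF f(3)]] semilinearD(1)[OF f(3)] by blast+
  show "Comp \<P> p p q F (Id \<P> p) = F"
    unfolding p Id_P f(1) Comp_P[OF v(1,1,2) semilinear_id[OF v(1)] f(2,3)] e e' ..
  show "Comp \<P> p q q (Id \<P> q) F = F"
    unfolding p Id_P f(1) Comp_P[OF v(1,2,2) f(3) embeddings_id[OF B.K.semiring_axioms] semilinear_id[OF v(2)]] e e' ..
next
  fix p q r s :: "'u \<P>_ob" and F G J
  assume "p \<in> Ob \<P>" "q \<in> Ob \<P>" "r \<in> Ob \<P>" "s \<in> Ob \<P>"
    and FGJ: "F \<in> Hom \<P> p q" "G \<in> Hom \<P> q r" "J \<in> Hom \<P> r s"
  then obtain K E K' E' K'' E'' L M where p: "p = (K, E)" "q = (K', E')" "r = (K'', E'')" "s = (L, M)"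
    and v: "valued_semimodule K E" "valued_semimodule K' E'" "valued_semimodule K'' E''" "valued_semimodule L M"
    by (metis Ob_P_cases)
  interpret A: valued_semimodule K E by (rule v)
  interpret B: valued_semimodule K' E' by (rule v)
  obtain \<sigma> f where f: "F = (\<sigma>, projective_class E K' E' f)" "\<sigma> \<in> semifield_embeddings K K'"
    "f \<in> semilinear_maps K E E' \<sigma>"
    using FGJ(1) unfolding p by (rule Hom_P_cases)
  obtain \<tau> g where g: "G = (\<tau>, projective_class E' K'' E'' g)" "\<tau> \<in> semifield_embeddings K' K''"
    "g \<in> semilinear_maps K' E' E'' \<tau>"
    using FGJ(2) unfolding p by (rule Hom_P_cases)
  obtain \<rho> j where j: "J = (\<rho>, projective_class E'' L M j)" "\<rho> \<in> semifield_embeddings K'' L"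
    "j \<in> semilinear_maps K'' E'' M \<rho>"
    using FGJ(3) unfolding p by (rule Hom_P_cases)
  note gf = semilinear_compose[OF v(1-3) f(2,3) g(2,3)]
  note jg = semilinear_compose[OF v(2-4) g(2,3) j(2,3)] embeddings_compose[OF g(2) j(2) B.K.semiring_axioms]
  have "compose (carrier K) (compose (carrier K') \<rho> \<tau>) \<sigma> = compose (carrier K) \<rho> (compose (carrier K) \<tau> \<sigma>)"
    by (rule compose_compose) (rule ring_hom_closed[OF embeddingsD(1)[OF f(2)]])
  moreover have "compose (carrier E) (compose (carrier E') j g) f = compose (carrier E) j (compose (carrier E) g f)"
    by (rule compose_compose) (rule semilinearD(1)[OF f(3)])
  ultimately show "Comp \<P> p q s (Comp \<P> q r s J G) F = Comp \<P> p r s J (Comp \<P> p q r G F)"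
    unfolding p f(1) g(1) j(1) Comp_P[OF v(1-3) f(3) g(2,3)] Comp_P[OF v(2-4) g(3) j(2,3)]
      Comp_P[OF v(1,2,4) f(3) jg(2,1)] Comp_P[OF v(1,3,4) gf j(2,3)] by simp
qed

section \<open>The functor from semimodules to actions\<close>

definition semimodule_functor :: "('u \<P>_ob, 'u \<P>_arr, 'u action, ('u \<Rightarrow> 'u) set) ftor" where
  "semimodule_functor =
     \<lparr>on_ob = (\<lambda>(K, E). semimodule_action K E),
      on_arr = (\<lambda>(K, E) (K', E') (\<sigma>, F). (\<lambda>f. restrict f (Pts (semimodule_action K E))) ` F)\<rparr>"

lemma on_ob_semimodule_functor: "on_ob semimodule_functor (K, E) = semimodule_action K E"
  by (simp add: semimodule_functor_def)

lemma on_arr_semimodule_functor: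
  assumes "valued_semimodule K E" "valued_semimodule K' E'"
  shows "on_arr semimodule_functor (K, E) (K', E') (\<sigma>, projective_class E K' E' f) =
    act_class (semimodule_action K E) (semimodule_action K' E') (restrict f (Pts (semimodule_action K E)))"
proof -
  interpret A: valued_semimodule K E by (rule assms)
  interpret B: valued_semimodule K' E' by (rule assms)
  interpret two_semimodules K E K' E' ..
  show ?thesis
    using restrict_projective_class by (simp add: semimodule_functor_def)
qed

lemma two_semimodules: "valued_semimodule K E \<Longrightarrow> valued_semimodule K' E' \<Longrightarrow> two_semimodules K E K' E'"
  by (simp add: two_semimodules_def)

lemmas valued_arch_action = valued_semimodule.arch_action_semimodule_action

lemma is_ftor_semimodule_functor: "is_ftor \<P> arch_actions (semimodule_functor :: ('u \<P>_ob, _, _, _) ftor)"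
  unfolding is_ftor_def
proof (intro conjI ballI)
  fix p :: "'u \<P>_ob" assume "p \<in> Ob \<P>"
  then obtain K E where p: "p = (K, E)" and v: "valued_semimodule K E"
    by (rule Ob_P_cases)
  show "on_ob semimodule_functor p \<in> Ob arch_actions"
    unfolding p on_ob_semimodule_functor Ob_arch_actions by (rule valued_arch_action[OF v])
  interpret valued_semimodule K E by (rule v)
  have "restrict (\<lambda>x\<in>carrier E. x) (Pts (semimodule_action K E)) = (\<lambda>x\<in>Pts (semimodule_action K E). x)"
    by (auto simp: fun_eq_iff simps)
  then show "on_arr semimodule_functor p p (Id \<P> p) = Id arch_actions (on_ob semimodule_functor p)"
    unfolding p Id_P on_arr_semimodule_functor[OF v v] on_ob_semimodule_functor Id_arch_actions by simp
next
  fix p q :: "'u \<P>_ob" and F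
  assume "p \<in> Ob \<P>" "q \<in> Ob \<P>" and F: "F \<in> Hom \<P> p q"
  then obtain K E K' E' where p: "p = (K, E)" "q = (K', E')"
    and v: "valued_semimodule K E" "valued_semimodule K' E'"
    by (metis Ob_P_cases)
  obtain \<sigma> f where f: "F = (\<sigma>, projective_class E K' E' f)" "\<sigma> \<in> semifield_embeddings K K'"
    "f \<in> semilinear_maps K E E' \<sigma>"
    using F unfolding p by (rule Hom_P_cases)
  show "on_arr semimodule_functor p q F \<in> Hom arch_actions (on_ob semimodule_functor p) (on_ob semimodule_functor q)"
    unfolding p f(1) on_arr_semimodule_functor[OF v] on_ob_semimodule_functor
    by (rule arch_actions_Hom[OF two_semimodules.restrict_act_maps[OF two_semimodules[OF v] f(2,3)]])
next
  fix p q r :: "'u \<P>_ob" and F G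
  assume "p \<in> Ob \<P>" "q \<in> Ob \<P>" "r \<in> Ob \<P>" and FG: "F \<in> Hom \<P> p q" "G \<in> Hom \<P> q r"
  then obtain K E K' E' K'' E'' where p: "p = (K, E)" "q = (K', E')" "r = (K'', E'')"
    and v: "valued_semimodule K E" "valued_semimodule K' E'" "valued_semimodule K'' E''"
    by (metis Ob_P_cases)
  obtain \<sigma> f where f: "F = (\<sigma>, projective_class E K' E' f)" "\<sigma> \<in> semifield_embeddings K K'"
    "f \<in> semilinear_maps K E E' \<sigma>"
    using FG(1) unfolding p by (rule Hom_P_cases)
  obtain \<tau> g where g: "G = (\<tau>, projective_class E' K'' E'' g)" "\<tau> \<in> semifield_embeddings K' K''"
    "g \<in> semilinear_maps K' E' E'' \<tau>"
    using FG(2) unfolding p by (rule Hom_P_cases)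
  let ?A = "semimodule_action K E" and ?B = "semimodule_action K' E'"
  note rf = two_semimodules.restrict_act_maps[OF two_semimodules[OF v(1,2)] f(2,3)]
  note rg = two_semimodules.restrict_act_maps[OF two_semimodules[OF v(2,3)] g(2,3)]
  \<comment> \<open>\<open>f\<close> maps non-zero points to non-zero points, so restricting
    commutes with composing.\<close>
  have "restrict (compose (carrier E) g f) (Pts ?A) = compose (Pts ?A) (restrict g (Pts ?B)) (restrict f (Pts ?A))"
    using act_maps_Pts[OF rf] by (auto simp: fun_eq_iff compose_def valued_semimodule.simps(2)[OF v(1)])
  then show "on_arr semimodule_functor p r (Comp \<P> p q r G F) =
      Comp arch_actions (on_ob semimodule_functor p) (on_ob semimodule_functor q) (on_ob semimodule_functor r)
        (on_arr semimodule_functor q r G) (on_arr semimodule_functor p q F)"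
    unfolding p f(1) g(1) Comp_P[OF v f(3) g(2,3)] on_ob_semimodule_functor
      on_arr_semimodule_functor[OF v(1,2)] on_arr_semimodule_functor[OF v(2,3)] on_arr_semimodule_functor[OF v(1,3)]
      arch_actions_Comp[OF v[THEN valued_arch_action] rf rg]
    by simp
qed

lemma bij_semimodule_functor:
  fixes p q :: "'u \<P>_ob"
  assumes "p \<in> Ob \<P>" "q \<in> Ob \<P>"
  shows "bij_betw (on_arr semimodule_functor p q) (Hom \<P> p q)
    (Hom arch_actions (on_ob semimodule_functor p) (on_ob semimodule_functor q))"
proof -
  obtain K E K' E' where p: "p = (K, E)" "q = (K', E')"
    and v: "valued_semimodule K E" "valued_semimodule K' E'"
    using assms by (metis Ob_P_cases)
  interpret two_semimodules K E K' E'
    by (rule two_semimodules[OF v])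
  show ?thesis
    unfolding bij_betw_def
  proof
    show "inj_on (on_arr semimodule_functor p q) (Hom \<P> p q)"
    proof (rule inj_onI)
      fix F G assume F: "F \<in> Hom \<P> p q" and G: "G \<in> Hom \<P> p q"
        and eq: "on_arr semimodule_functor p q F = on_arr semimodule_functor p q G"
      obtain \<sigma> f where f: "F = (\<sigma>, projective_class E K' E' f)" "\<sigma> \<in> semifield_embeddings K K'"
        "f \<in> semilinear_maps K E E' \<sigma>"
        using F unfolding p by (rule Hom_P_cases)
      obtain \<tau> g where g: "G = (\<tau>, projective_class E K' E' g)" "\<tau> \<in> semifield_embeddings K K'"
        "g \<in> semilinear_maps K E E' \<tau>"
        using G unfolding p by (rule Hom_P_cases)
      have "(\<lambda>g. restrict g (Pts AE)) ` projective_class E K' E' f =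
          (\<lambda>g. restrict g (Pts AE)) ` projective_class E K' E' g"
        using eq unfolding p f(1) g(1) by (simp add: semimodule_functor_def)
      from embedding_class_faithful[OF f(2,3) g(2,3) this] show "F = G"
        unfolding f(1) g(1) by simp
    qed
    show "on_arr semimodule_functor p q ` Hom \<P> p q =
        Hom arch_actions (on_ob semimodule_functor p) (on_ob semimodule_functor q)"
    proof (intro equalityI image_subsetI subsetI)
      fix F assume "F \<in> Hom \<P> p q"
      then show "on_arr semimodule_functor p q F \<in> Hom arch_actions (on_ob semimodule_functor p) (on_ob semimodule_functor q)"
        using ftor_Hom[OF is_ftor_semimodule_functor assms] by blast
    next
      fix G assume "G \<in> Hom arch_actions (on_ob semimodule_functor p) (on_ob semimodule_functor q)"
      then obtain \<phi> where \<phi>: "\<phi> \<in> act_maps AE BE" "G = act_class AE BE \<phi>"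
        unfolding p on_ob_semimodule_functor by (rule arch_actions_HomE)
      obtain \<sigma> f where f: "\<sigma> \<in> semifield_embeddings K K'" "f \<in> semilinear_maps K E E' \<sigma>"
        "restrict f (Pts AE) = \<phi>"
        using embedding_class_full[OF \<phi>(1)] by blast
      have "on_arr semimodule_functor p q (\<sigma>, projective_class E K' E' f) = G"
        unfolding p on_arr_semimodule_functor[OF v] f(3) \<phi>(2) ..
      moreover have "(\<sigma>, projective_class E K' E' f) \<in> Hom \<P> p q"
        unfolding p Hom_P using f(1,2) by blast
      ultimately show "G \<in> on_arr semimodule_functor p q ` Hom \<P> p q"
        by blast
    qed
  qed
qed

section \<open>Realisation of an action by a semimodule inside the universe\<close>

locale encoded_action = arch_action A for A :: "'u action" +
  fixes j :: "rat option \<Rightarrow> 'u" and m :: "'u option \<Rightarrow> 'u"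
  assumes j: "inj j" and m: "inj m"
begin

text \<open>The semifield \<open>Hmax (Grp A)\<close> transported along the injection
  \<open>j\<close>, since the carriers of objects of \<P> lie in \<open>'u\<close>. The semimodule
  is transported along \<open>m\<close> in the same way.\<close>

definition K :: "'u ring" where
  "K = \<lparr>carrier = j ` carrier (Hmax (Grp A)),
        monoid.mult = (\<lambda>x y. j (inv_into UNIV j x \<otimes>\<^bsub>Hmax (Grp A)\<^esub> inv_into UNIV j y)),
        one = j (Some 0),
        ring.zero = j None,
        add = (\<lambda>x y. j (inv_into UNIV j x \<oplus>\<^bsub>Hmax (Grp A)\<^esub> inv_into UNIV j y))\<rparr>"

definition E :: "('u, 'u) module" where
  "E = \<lparr>carrier = m ` insert None (Some ` Pts A),
        monoid.mult = undefined,
        one = undefined,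
        ring.zero = m None,
        add = (\<lambda>x y. m (case inv_into UNIV m x of None \<Rightarrow> inv_into UNIV m y
                        | Some a \<Rightarrow> (case inv_into UNIV m y of None \<Rightarrow> Some a
                                    | Some b \<Rightarrow> Some (if Leq A a b then b else a)))),
        smult = (\<lambda>a x. m (case inv_into UNIV j a of None \<Rightarrow> None | Some h \<Rightarrow> map_option (Act A h) (inv_into UNIV m x)))\<rparr>"

lemma K_simps [simp]:
  "carrier K = insert (j None) ((\<lambda>h. j (Some h)) ` Grp A)"
  "\<zero>\<^bsub>K\<^esub> = j None" "\<one>\<^bsub>K\<^esub> = j (Some 0)"
  "j (Some h) \<otimes>\<^bsub>K\<^esub> j (Some k) = j (Some (h + k))" "j None \<otimes>\<^bsub>K\<^esub> j b = j None" "j b \<otimes>\<^bsub>K\<^esub> j None = j None"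
  "j (Some h) \<oplus>\<^bsub>K\<^esub> j (Some k) = j (Some (max h k))" "j None \<oplus>\<^bsub>K\<^esub> j b = j b" "j b \<oplus>\<^bsub>K\<^esub> j None = j b"
  by (auto simp: K_def Hmax_def j image_image split: option.splits)

lemma E_simps [simp]:
  "carrier E = insert (m None) ((\<lambda>x. m (Some x)) ` Pts A)"
  "\<zero>\<^bsub>E\<^esub> = m None"
  "m (Some x) \<oplus>\<^bsub>E\<^esub> m (Some y) = m (Some (if Leq A x y then y else x))"
  "m None \<oplus>\<^bsub>E\<^esub> m b = m b" "m b \<oplus>\<^bsub>E\<^esub> m None = m b"
  "j (Some h) \<odot>\<^bsub>E\<^esub> m (Some x) = m (Some (Act A h x))"
  "j None \<odot>\<^bsub>E\<^esub> m b = m None" "j a \<odot>\<^bsub>E\<^esub> m None = m None"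
  by (auto simp: E_def j m image_image split: option.splits)

lemma j_eq_iff [simp]: "j a = j b \<longleftrightarrow> a = b" and m_eq_iff [simp]: "m c = m d \<longleftrightarrow> c = d"
  using j m by (auto simp: inj_eq)

lemma semifield_K: "semifield K"
proof -
  have max_Grp: "max h k \<in> Grp A" if "h \<in> Grp A" "k \<in> Grp A" for h k
    using that by (simp add: max_def)
  have "abelian_monoid K"
    by (rule abelian_monoidI) (auto simp: max_Grp max.assoc max.commute)
  moreover have mult: "comm_monoid K"
    by (rule comm_monoidI) (auto simp: Grp_add Grp_0 add.assoc add.commute)
  moreover have "semiring_axioms K"
    by (rule semiring_axioms.intro) (auto simp: max_add_distrib_left max_add_distrib_right)
  ultimately have "semiring K"
    by (intro semiring.intro comm_monoid.axioms(1))
  moreover have "semifield_axioms K"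
  proof
    show "\<one>\<^bsub>K\<^esub> \<noteq> \<zero>\<^bsub>K\<^esub>"
      by simp
    show "carrier K - {\<zero>\<^bsub>K\<^esub>} \<subseteq> Units K"
    proof
      fix a assume "a \<in> carrier K - {\<zero>\<^bsub>K\<^esub>}"
      then obtain h where h: "h \<in> Grp A" "a = j (Some h)" by auto
      then show "a \<in> Units K"
        using Grp_uminus[OF h(1)] by (auto simp: Units_def intro!: bexI[of _ "- h"])
    qed
  qed
  ultimately show ?thesis
    using mult by (intro semifield.intro)
qed

lemma valuation_K: "valuation K (Grp A) (\<lambda>h. j (Some h))"
proof -
  interpret semifield K by (rule semifield_K)
  show ?thesis
    by unfold_locales (use Ints_Grp Grp_diff in \<open>auto simp: bij_betw_def inj_on_def\<close>)
qed

lemma algebraic_extension_K: "algebraic_extension_Zmax K"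
proof -
  have "inv_into UNIV j \<in> ring_iso K (Hmax (Grp A))"
    unfolding ring_iso_def ring_hom_def mem_Collect_eq
  proof (intro conjI allI impI)
    show "bij_betw (inv_into UNIV j) (carrier K) (carrier (Hmax (Grp A)))"
      unfolding K_def by (auto simp: bij_betw_def inj_on_def j image_image)
  qed (auto simp: K_def Hmax_def j split: option.splits)
  then show ?thesis
    unfolding algebraic_extension_Zmax_def using semifield_K Ints_Grp Grp_diff by blast
qed

lemma archimedean_semimodule_E: "archimedean_semimodule K E"
proof -
  interpret K: semifield K by (rule semifield_K)
  have le: "Leq A x z" if "x \<in> Pts A" "y \<in> Pts A" "z \<in> Pts A" "Leq A x y" "Leq A y z" for x y z
    using that Leq_trans by blast
  have "abelian_monoid E"
  proof (rule abelian_monoidI)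
    \<comment> \<open>Associativity of the maximum. Transitivity enters in the two cases where both
      comparisons of neighbours hold or both fail; the second one needs antisymmetry as
      well.\<close>
    have *: "(if Leq A (if Leq A x y then y else x) z then z else if Leq A x y then y else x) =
        (if Leq A x (if Leq A y z then z else y) then if Leq A y z then z else y else x)"
      if p: "x \<in> Pts A" "y \<in> Pts A" "z \<in> Pts A" for x y z
    proof -
      have "Leq A x y \<and> Leq A y z \<longrightarrow> Leq A x z"
        using le[OF p] by blast
      moreover have "\<not> Leq A x y \<and> \<not> Leq A y z \<longrightarrow> Leq A z x"
        using le[OF p(3,2,1)] Leq_total[OF p(1,2)] Leq_total[OF p(2,3)] by blast
      ultimately show ?thesis
        using Leq_antisym[OF p(1,3)] by auto
    qed
    fix x y z assume "x \<in> carrier E" "y \<in> carrier E" "z \<in> carrier E"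
    then show "x \<oplus>\<^bsub>E\<^esub> y \<oplus>\<^bsub>E\<^esub> z = x \<oplus>\<^bsub>E\<^esub> (y \<oplus>\<^bsub>E\<^esub> z)"
      unfolding E_simps(1) by (elim insertE imageE) (simp_all add: *)
  next
    fix x y assume xy: "x \<in> carrier E" "y \<in> carrier E"
    show "x \<oplus>\<^bsub>E\<^esub> y = y \<oplus>\<^bsub>E\<^esub> x"
    proof (cases "x = m None \<or> y = m None")
      case False
      then obtain a b where ab: "x = m (Some a)" "y = m (Some b)" "a \<in> Pts A" "b \<in> Pts A"
        using xy by auto
      show ?thesis
        using Leq_total[OF ab(3,4)] Leq_antisym[OF ab(3,4)] by (auto simp: ab(1,2))
    qed (use xy in auto)
  qed auto
  moreover have "semimodule_axioms K E"
  proof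
    fix a x y assume axy: "a \<in> carrier K" "x \<in> carrier E" "y \<in> carrier E"
    show "a \<odot>\<^bsub>E\<^esub> (x \<oplus>\<^bsub>E\<^esub> y) = a \<odot>\<^bsub>E\<^esub> x \<oplus>\<^bsub>E\<^esub> a \<odot>\<^bsub>E\<^esub> y"
      using axy Act_Leq_iff by auto
  next
    fix a b x assume abx: "a \<in> carrier K" "b \<in> carrier K" "x \<in> carrier E"
    show "(a \<oplus>\<^bsub>K\<^esub> b) \<odot>\<^bsub>E\<^esub> x = a \<odot>\<^bsub>E\<^esub> x \<oplus>\<^bsub>E\<^esub> b \<odot>\<^bsub>E\<^esub> x"
      using abx Act_Leq_Act_iff by (auto simp: max_def)
    show "a \<otimes>\<^bsub>K\<^esub> b \<odot>\<^bsub>E\<^esub> x = a \<odot>\<^bsub>E\<^esub> (b \<odot>\<^bsub>E\<^esub> x)"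
      using abx Act_add by auto
  qed (auto simp: Act_closed Act_0)
  ultimately have "semimodule K E"
    using K.semiring_axioms by (intro semimodule.intro)
  moreover have "archimedean_semimodule_axioms K E"
  proof
    show "carrier E \<noteq> {\<zero>\<^bsub>E\<^esub>}"
      using Pts_nonempty by auto
  next
    fix x y assume "x \<in> carrier E" "y \<in> carrier E"
    then show "x \<oplus>\<^bsub>E\<^esub> y \<in> {x, y}" by auto
  next
    fix a x assume a: "a \<in> carrier K" "add_less K \<one>\<^bsub>K\<^esub> a" and x: "x \<in> carrier E - {\<zero>\<^bsub>E\<^esub>}"
    obtain h where h: "h \<in> Grp A" "a = j (Some h)" "0 < h"
      using a by (auto simp: add_less_def add_le_def max_def split: if_splits)
    then show "add_less E x (a \<odot>\<^bsub>E\<^esub> x)"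
      using x Act_pos[OF h(1,3)] by (auto simp: add_less_def add_le_def) metis
  next
    fix x y assume "x \<in> carrier E - {\<zero>\<^bsub>E\<^esub>}" "y \<in> carrier E - {\<zero>\<^bsub>E\<^esub>}"
    then obtain x' y' where xy: "x = m (Some x')" "y = m (Some y')" "x' \<in> Pts A" "y' \<in> Pts A"
      by auto
    obtain h where h: "h \<in> Grp A" "0 \<le> h" "Leq A y' (Act A h x')"
      using Act_arch[OF xy(3,4)] by blast
    \<comment> \<open>One more unit turns the weak archimedean bound of actions into the strict one
      of semimodules.\<close>
    have h1: "h + 1 \<in> Grp A"
      using Grp_add h(1) Grp_1 by blast
    have hx: "Act A h x' \<in> Pts A" "Act A (h + 1) x' \<in> Pts A"
      using Act_closed h(1) h1 xy(3) by auto
    have lt: "Leq A (Act A h x') (Act A (h + 1) x')" "\<not> Leq A (Act A (h + 1) x') (Act A h x')"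
      using Act_Leq_Act_iff[OF h(1) h1 xy(3)] Act_Leq_Act_iff[OF h1 h(1) xy(3)] by auto
    have "Leq A y' (Act A (h + 1) x')"
      using le[OF xy(4) hx h(3) lt(1)] .
    moreover have "y' \<noteq> Act A (h + 1) x'"
      using lt(2) h(3) by auto
    ultimately have "add_less E y (j (Some (h + 1)) \<odot>\<^bsub>E\<^esub> x)"
      by (simp add: add_less_def add_le_def xy)
    moreover have "add_le K \<one>\<^bsub>K\<^esub> (j (Some (h + 1)))"
      using h(2) by (simp add: add_le_def)
    ultimately show "\<exists>a\<in>carrier K. add_le K \<one>\<^bsub>K\<^esub> a \<and> add_less E y (a \<odot>\<^bsub>E\<^esub> x)"
      using h1 by (intro bexI[of _ "j (Some (h + 1))"]) auto
  qed
  ultimately show ?thesis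
    by (intro archimedean_semimodule.intro)
qed

text \<open>The coordinates chosen for \<open>K\<close> need not be the original ones, so the two
  groups may differ by a factor. The identity of \<open>K\<close>, read as an embedding between the
  two coordinate systems in either direction, supplies the scaling factors \<open>c\<close> and
  \<open>d\<close>.\<close>

lemma iso_semimodule_action: "\<exists>G. iso_in arch_actions (semimodule_action K E) A G"
proof -
  interpret B: valued_semimodule K E
    by (rule valued_semimodule[OF algebraic_extension_K archimedean_semimodule_E])
  have id: "(\<lambda>a. a) \<in> ring_hom K K" "inj_on (\<lambda>a. a) (carrier K)"
    by (auto simp: ring_hom_def)
  obtain c where c: "c > 0" "\<And>h. h \<in> Grp A \<Longrightarrow> c * h \<in> vgrp K \<and> j (Some h) = vmap K (c * h)"
    using embedding_scale[OF valuation_K B.V.valuation_axioms id(1) refl id(2)] by blast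
  obtain d where d: "d > 0" "\<And>h. h \<in> vgrp K \<Longrightarrow> d * h \<in> Grp A \<and> vmap K h = j (Some (d * h))"
    using embedding_scale[OF B.V.valuation_axioms valuation_K id(1) refl id(2)] by blast
  let ?B = "semimodule_action K E"
  have Pts: "Pts ?B = (\<lambda>x. m (Some x)) ` Pts A"
    unfolding B.simps by auto
  have Leq: "Leq ?B (m (Some x)) (m (Some y)) \<longleftrightarrow> Leq A x y" if "x \<in> Pts A" "y \<in> Pts A" for x y
    unfolding B.simps using Leq_refl that by auto
  define f where "f = (\<lambda>x\<in>Pts A. m (Some x))"
  define g where "g = (\<lambda>y\<in>Pts ?B. the (inv_into UNIV m y))"
  have g: "g (m (Some x)) = x" if "x \<in> Pts A" for x
    using that m by (simp add: g_def Pts)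
  have f: "f \<in> act_maps A ?B"
    unfolding act_maps_def mem_Collect_eq
  proof (intro conjI exI[of _ c] ballI impI)
    show "f \<in> Pts A \<rightarrow>\<^sub>E Pts ?B"
      unfolding Pts by (auto simp: f_def)
    show "c > 0" by (rule c)
    show "c * h \<in> Grp ?B" if "h \<in> Grp A" for h
      using c(2)[OF that] by (simp add: B.simps(1))
    show "Leq ?B (f x) (f y)" if "x \<in> Pts A" "y \<in> Pts A" "Leq A x y" for x y
      using that Leq by (simp add: f_def)
    show "f (Act A h x) = Act ?B (c * h) (f x)" if "h \<in> Grp A" "x \<in> Pts A" for h x
      using that Act_closed c(2)[OF that(1)] by (simp add: f_def B.simps(4) flip: c(2)[OF that(1), THEN conjunct2])
  qed
  have g': "g \<in> act_maps ?B A"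
    unfolding act_maps_def mem_Collect_eq
  proof (intro conjI exI[of _ d] ballI impI)
    show "g \<in> Pts ?B \<rightarrow>\<^sub>E Pts A"
      using g by (auto simp: Pts) (auto simp: g_def Pts)
    show "d > 0" by (rule d)
    show "d * h \<in> Grp A" if "h \<in> Grp ?B" for h
      using d(2)[of h] that by (simp add: B.simps(1))
    show "Leq A (g x) (g y)" if "x \<in> Pts ?B" "y \<in> Pts ?B" "Leq ?B x y" for x y
      using that Leq g unfolding Pts by auto
    show "g (Act ?B h x) = Act A (d * h) (g x)" if hx: "h \<in> Grp ?B" "x \<in> Pts ?B" for h x
    proof -
      obtain y where y: "y \<in> Pts A" "x = m (Some y)"
        using hx(2) unfolding Pts by blast
      have h: "d * h \<in> Grp A" "vmap K h = j (Some (d * h))"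
        using d(2)[of h] hx(1) by (auto simp: B.simps(1))
      show ?thesis
        using g[OF y(1)] g[OF Act_closed[OF h(1) y(1)]] by (simp add: B.simps(4) h(2) y(2))
    qed
  qed
  have "iso_in arch_actions ?B A (act_class ?B A g)"
    by (rule iso_in_arch_actionsI[OF B.arch_action_semimodule_action arch_action_axioms g' f])
      (use g in \<open>auto simp: f_def Pts\<close>)
  then show ?thesis by blast
qed

end

lemma is_equivalence_semimodule_functor:
  "is_equivalence \<P> arch_actions (semimodule_functor :: ('u \<P>_ob, _, _, _) ftor)"
  unfolding is_equivalence_def
proof (intro conjI ballI)
  fix A :: "'u action" assume "A \<in> Ob arch_actions"
  then have A: "arch_action A"
    by (simp add: Ob_arch_actions)
  have inf: "infinite (UNIV :: 'u set)"
    using infinite_arch_action[OF A] .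
  obtain \<nu> :: "nat \<Rightarrow> 'u" where nu: "inj \<nu>"
    using infinite_countable_subset[OF inf] by blast
  then have j: "inj (\<lambda>h :: rat option. \<nu> (to_nat h))"
    by (auto intro!: injI dest!: injD)
  obtain c :: "'u list \<Rightarrow> 'u" where c: "\<And>n. inj_on c {xs. length xs = n}"
    using exists_list_code[OF inf] by blast
  \<comment> \<open>A tag in the first entry separates -\<infinity> from the points. Both cases use
    lists of length 2, because \<open>c\<close> is injective only for a fixed length.\<close>
  define m where "m = (\<lambda>x :: 'u option. case x of None \<Rightarrow> c [\<nu> 0, \<nu> 0] | Some x \<Rightarrow> c [\<nu> 1, x])"
  have "inj m"
  proof (rule injI)
    fix x y assume "m x = m y"
    then have "(case x of None \<Rightarrow> [\<nu> 0, \<nu> 0] | Some x \<Rightarrow> [\<nu> 1, x]) = (case y of None \<Rightarrow> [\<nu> 0, \<nu> 0] | Some x \<Rightarrow> [\<nu> 1, x])"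
      by (intro inj_onD[OF c[of 2]]) (auto simp: m_def split: option.splits)
    then show "x = y"
      using nu by (auto simp: inj_eq split: option.splits)
  qed
  then interpret encoded_action A "\<lambda>h. \<nu> (to_nat h)" m
    using A j by (simp add: encoded_action_def encoded_action_axioms_def)
  show "\<exists>p\<in>Ob \<P>. \<exists>G. iso_in arch_actions (on_ob semimodule_functor p) A G"
    using iso_semimodule_action algebraic_extension_K archimedean_semimodule_E
    by (intro bexI[of _ "(K, E)"]) (simp_all add: on_ob_semimodule_functor Ob_P)
qed (use is_ftor_semimodule_functor bij_semimodule_functor in blast)+

theorem theorem3p1:
  shows "equivalent_categories
    (presheaf_topos_points (opposite epicyclic) ::
       ((nat, (int \<Rightarrow> int) set, 'u set, 'u \<Rightarrow> 'u) ftor, nat \<Rightarrow> 'u \<Rightarrow> 'u) cat)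
    (\<P> :: ('u \<P>_ob, 'u \<P>_arr) cat)"
proof (rule is_equivalence_imp_equivalent_categories)
  show "is_category (presheaf_topos_points (opposite epicyclic) ::
       ((nat, (int \<Rightarrow> int) set, 'u set, 'u \<Rightarrow> 'u) ftor, nat \<Rightarrow> 'u \<Rightarrow> 'u) cat)"
    unfolding presheaf_topos_points_def
    by (intro is_category_full_subcategory is_category_functor_category is_category_Sets)
  then show "is_equivalence \<P> (presheaf_topos_points (opposite epicyclic))
      (comp_ftor points_functor (semimodule_functor :: ('u \<P>_ob, _, _, _) ftor))"
    by (rule is_equivalence_comp[OF _ is_equivalence_semimodule_functor is_equivalence_points_functor])
qed (rule is_category_P)

end
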